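(* Let $D$ be a regular discriminant form of even signature and level $N=\prod_{p\mid N}p^{\nu_p}$, and let $F=\sum_{\gamma\in D}F_\gamma e^\gamma$ be a weakly reflective modular form of weight $k$ for $\rho_D$ with singular $F_0$. Then there is a linear combination $g$ of the components $F_\gamma$ of $F$ with the following properties: (i) $g$ is a non-zero modular form of weight $k$ for $\Gamma_0(N)$ with character $\chi_D$ and small pole orders at cusps; (ii) if $p\mid N$ is odd and $g$ has a pole at the cusp $s=a/c$, then $\nu_p(c)\in\{0,\nu_p-1,\nu_p\}$; (iii) if $2\mid N$, the $2$-adic part of $D$ is not of type $2_{l_2}^{\epsilon_2n_2}4_{l_4}^{\epsilon_4n_4}8_{\mathrm{II}}^{\epsilon_8n_8}$ with $n_2\equiv n_4\equiv1\pmod 2$, and $g$ has a pole at the cusp $s=a/c$, then $\nu_2(c)\in\{0,\nu_2-1,\nu_2\}$.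
   Context: Discriminant form: finite abelian $D$ with non-degenerate $q:D\to\mathbb{Q}/\mathbb{Z}$, bilinear form $(\beta,\gamma)=q(\beta+\gamma)-q(\beta)-q(\gamma)$; level $N$: least positive integer with $Nq\equiv0$; signature: signature mod $8$ of any even lattice with discriminant form $D$. $D_c$, $D^c$: kernel and image of multiplication by $c$; $D_{c,x}=\{\gamma\in D_c:q(\gamma)=x\bmod1\}$. Regular: $D^{N/p}$ contains a non-zero isotropic element for every prime $p\mid N$. Weil representation: $\rho_D(T)e^\gamma=e(-q(\gamma))e^\gamma$, $\rho_D(S)e^\gamma=\frac{e(\operatorname{sign}D/8)}{\sqrt{|D|}}\sum_\beta e((\gamma,\beta))e^\beta$, $e(x)=e^{2\pi ix}$. A modular form of weight $k$ for $\rho_D$: holomorphic $F:\mathbb{H}\to\mathbb{C}[D]$ with $F(M\tau)=(c\tau+d)^k\rho_D(M)F(\tau)$ for all $M\in\mathrm{SL}_2(\mathbb{Z})$, meromorphic at $\infty$; $F_\gamma$ is singular if it has a pole at $\infty$. $F$ is weakly reflective if (a) there is an even lattice $L$ of signature $(n,2)$, $n>2$, with $k=1-n/2$ and $D\cong L'/L$, and (b) every singular $F_\gamma$ satisfies $\gamma\in D_{d,1/d}$ and $F_\gamma=c_\gamma q^{-1/d}+\dots$ for some $d\mid N$, $c_\gamma\in\mathbb{Q}$. The character $\chi_D$ of $\Gamma_0(N)$ is defined by $\rho_D(M)e^0=\chi_D(M)e^0$ for $M\in\Gamma_0(N)$ (it is quadratic). For a cusp $s=a/c$ of $\Gamma_0(N)$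 ($\gcd(a,c)=1$), $t_s=N/\gcd(c^2,N)$ is its width, $M_s\in\mathrm{SL}_2(\mathbb{Z})$ maps $\infty$ to $s$, $T_s=M_sT^{t_s}M_s^{-1}$, and $m_s=1$ if $\chi_D(T_s)=1$, $m_s=2$ if $\chi_D(T_s)=-1$. A modular form $f$ of weight $k$ for $\Gamma_0(N)$ with character $\chi_D$ (holomorphic on $\mathbb{H}$, possibly with poles at cusps) has small pole orders at cusps if for every cusp $s$, $f|_{k,M_s}(\tau)=c_sq^{-1/(m_st_s)}+(\text{higher powers})$ for some constant $c_s$. $\nu_p$ denotes $p$-adic valuation. The type condition in (iii) is in Conway–Sloane Jordan-decomposition notation: the $2$-adic part of $D$ is the orthogonal sum of a Jordan component of exponent $2$ of odd rank $n_2$, one of exponent $4$ of odd rank $n_4$, and an even (type II) component of exponent $8$. *)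

theory Defs
  imports "HOL-Analysis.Analysis" "HOL-Computational_Algebra.Primes"
begin

section \<open>Discriminant forms\<close>

text \<open>
  The finite abelian group \<open>D\<close> is a type of class finite and ab_group_add. A map
  \<open>D \<Rightarrow> \<rat>/\<int>\<close> is given by a lift \<open>q :: 'd \<Rightarrow> rat\<close>; only the values modulo
  \<open>\<int>\<close> are ever used, so that the choice of the lift is immaterial.
\<close>

definition nmul :: "nat \<Rightarrow> 'd::ab_group_add \<Rightarrow> 'd" where
  "nmul c \<gamma> = (\<Sum>i<c. \<gamma>)"

definition bil :: "('d::ab_group_add \<Rightarrow> rat) \<Rightarrow> 'd \<Rightarrow> 'd \<Rightarrow> rat" where
  "bil q \<beta> \<gamma> = q (\<beta> + \<gamma>) - q \<beta> - q \<gamma>"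

definition discriminant_form :: "('d::{finite,ab_group_add} \<Rightarrow> rat) \<Rightarrow> bool" where
  "discriminant_form q \<longleftrightarrow>
     (\<forall>n \<gamma>. q (nmul n \<gamma>) - of_nat n ^ 2 * q \<gamma> \<in> \<int>) \<and>
     (\<forall>\<gamma>. q (- \<gamma>) - q \<gamma> \<in> \<int>) \<and>
     (\<forall>\<alpha> \<beta> \<gamma>. bil q (\<alpha> + \<beta>) \<gamma> - bil q \<alpha> \<gamma> - bil q \<beta> \<gamma> \<in> \<int>) \<and>
     (\<forall>\<gamma>. (\<forall>\<beta>. bil q \<beta> \<gamma> \<in> \<int>) \<longrightarrow> \<gamma> = 0)"

definition level :: "('d::{finite,ab_group_add} \<Rightarrow> rat) \<Rightarrow> nat" where
  "level q = (LEAST N. 0 < N \<and> (\<forall>\<gamma>. of_nat N * q \<gamma> \<in> \<int>))"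

definition mul_kernel :: "nat \<Rightarrow> 'd::ab_group_add set" where
  "mul_kernel c = {\<gamma>. nmul c \<gamma> = 0}"

definition mul_image :: "nat \<Rightarrow> 'd::ab_group_add set" where
  "mul_image c = range (nmul c)"

definition mul_kernel_val :: "('d::ab_group_add \<Rightarrow> rat) \<Rightarrow> nat \<Rightarrow> rat \<Rightarrow> 'd set" where
  "mul_kernel_val q c x = {\<gamma> \<in> mul_kernel c. q \<gamma> - x \<in> \<int>}"

definition regular :: "('d::{finite,ab_group_add} \<Rightarrow> rat) \<Rightarrow> bool" where
  "regular q \<longleftrightarrow>
     (\<forall>p. prime p \<and> p dvd level q \<longrightarrow>
        (\<exists>\<gamma> \<in> mul_image (level q div p). \<gamma> \<noteq> 0 \<and> q \<gamma> \<in> \<int>))"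


section \<open>Even lattices\<close>

text \<open>
  An even lattice of rank \<open>m\<close> is \<open>\<int>\<^sup>m\<close> with the bilinear form of an integral
  Gram matrix \<open>G\<close> (entries with indices below \<open>m\<close>). Vectors are functions on
  \<open>nat\<close> vanishing from \<open>m\<close> on.
\<close>

definition gram_form ::
    "nat \<Rightarrow> (nat \<Rightarrow> nat \<Rightarrow> int) \<Rightarrow> (nat \<Rightarrow> 'f::field_char_0) \<Rightarrow> (nat \<Rightarrow> 'f) \<Rightarrow> 'f" where
  "gram_form m G x y = (\<Sum>i<m. \<Sum>j<m. x i * of_int (G i j) * y j)"

text \<open>
  Signature \<open>(b\<^sup>+, b\<^sup>-)\<close>: there is an orthogonal basis of \<open>L \<otimes> \<real>\<close> with
  \<open>b\<^sup>+\<close> vectors of norm \<open>1\<close> and \<open>b\<^sup>-\<close> vectors of norm \<open>-1\<close> (linear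
  independence follows from orthogonality). In particular the form is non-degenerate.
\<close>

definition even_lattice :: "nat \<Rightarrow> (nat \<Rightarrow> nat \<Rightarrow> int) \<Rightarrow> nat \<Rightarrow> nat \<Rightarrow> bool" where
  "even_lattice m G bp bm \<longleftrightarrow>
     (\<forall>i<m. \<forall>j<m. G i j = G j i) \<and> (\<forall>i<m. even (G i i)) \<and>
     m = bp + bm \<and>
     (\<exists>v :: nat \<Rightarrow> nat \<Rightarrow> real. \<forall>i<m. \<forall>j<m.
        gram_form m G (v i) (v j) = (if i \<noteq> j then 0 else if i < bp then 1 else - 1))"

definition int_lattice :: "nat \<Rightarrow> (nat \<Rightarrow> rat) set" where
  "int_lattice m = {x. (\<forall>i\<ge>m. x i = 0) \<and> (\<forall>i<m. x i \<in> \<int>)}"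

definition dual_lattice :: "nat \<Rightarrow> (nat \<Rightarrow> nat \<Rightarrow> int) \<Rightarrow> (nat \<Rightarrow> rat) set" where
  "dual_lattice m G =
     {x. (\<forall>i\<ge>m. x i = 0) \<and> (\<forall>y \<in> int_lattice m. gram_form m G x y \<in> \<int>)}"

text \<open>
  \<open>D \<cong> L'/L\<close> as discriminant forms: a surjective homomorphism \<open>L' \<Rightarrow> D\<close>
  with kernel \<open>L\<close> under which \<open>q\<close> becomes \<open>(x,x)/2 mod 1\<close>.
\<close>

definition has_discriminant_form ::
    "nat \<Rightarrow> (nat \<Rightarrow> nat \<Rightarrow> int) \<Rightarrow> ('d::{finite,ab_group_add} \<Rightarrow> rat) \<Rightarrow> bool" where
  "has_discriminant_form m G q \<longleftrightarrow>
     (\<exists>\<phi> :: (nat \<Rightarrow> rat) \<Rightarrow> 'd.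
        (\<forall>x \<in> dual_lattice m G. \<forall>y \<in> dual_lattice m G. \<phi> (\<lambda>i. x i + y i) = \<phi> x + \<phi> y) \<and>
        \<phi> ` dual_lattice m G = UNIV \<and>
        (\<forall>x \<in> dual_lattice m G. \<phi> x = 0 \<longleftrightarrow> x \<in> int_lattice m) \<and>
        (\<forall>x \<in> dual_lattice m G. q (\<phi> x) - gram_form m G x x / 2 \<in> \<int>))"

text \<open>
  The signature of \<open>D\<close>, represented in \<open>{0..<8}\<close>; by Milgram's formula all even lattices
  with discriminant form \<open>D\<close> give the same residue.
\<close>

definition disc_signature :: "('d::{finite,ab_group_add} \<Rightarrow> rat) \<Rightarrow> int" where
  "disc_signature q =
     (SOME s. \<exists>m G bp bm. even_lattice m G bp bm \<and> has_discriminant_form m G q \<and>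
        s = (int bp - int bm) mod 8)"


section \<open>The 2-adic Jordan type\<close>

text \<open>\<open>A\<close> is a subgroup isomorphic to \<open>(\<int>/m)\<^sup>n\<close>, with basis \<open>b\<close>.\<close>

definition homogeneous_subgroup :: "'d::ab_group_add set \<Rightarrow> nat \<Rightarrow> nat \<Rightarrow> bool" where
  "homogeneous_subgroup A m n \<longleftrightarrow>
     (\<exists>b :: nat \<Rightarrow> 'd. (\<forall>i<n. nmul m (b i) = 0) \<and>
        bij_betw (\<lambda>c. \<Sum>i<n. nmul (c i) (b i)) ({..<n} \<rightarrow>\<^sub>E {..<m}) A)"

definition two_adic_part :: "'d::ab_group_add set" where
  "two_adic_part = {\<gamma>. \<exists>k. nmul (2 ^ k) \<gamma> = 0}"

definition orthogonal_sets :: "('d::ab_group_add \<Rightarrow> rat) \<Rightarrow> 'd set \<Rightarrow> 'd set \<Rightarrow> bool" where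
  "orthogonal_sets q A B \<longleftrightarrow> (\<forall>\<alpha>\<in>A. \<forall>\<beta>\<in>B. bil q \<alpha> \<beta> \<in> \<int>)"

text \<open>
  The 2-adic part of \<open>D\<close> is of type
  \<open>2\<^sub>l\<^sup>\<epsilon>\<^sup>n\<close> \<open>4\<^sub>l\<^sup>\<epsilon>\<^sup>n\<close> \<open>8\<^sub>I\<^sub>I\<^sup>\<epsilon>\<^sup>n\<close> with
  odd ranks of the first two components. A component of exponent \<open>8\<close> is of even type
  (type II) iff \<open>8 q\<close> vanishes modulo \<open>1\<close> on it. Components of odd rank are
  automatically of odd type, and the components of an orthogonal decomposition are
  automatically non-degenerate.
\<close>

definition type_2_4_8II_odd_ranks :: "('d::{finite,ab_group_add} \<Rightarrow> rat) \<Rightarrow> bool" where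
  "type_2_4_8II_odd_ranks q \<longleftrightarrow>
     (\<exists>A2 A4 A8 n2 n4 n8.
        homogeneous_subgroup A2 2 n2 \<and> homogeneous_subgroup A4 4 n4 \<and>
        homogeneous_subgroup A8 8 n8 \<and>
        odd n2 \<and> odd n4 \<and> n8 > 0 \<and>
        (\<forall>\<gamma>\<in>A8. 8 * q \<gamma> \<in> \<int>) \<and>
        orthogonal_sets q A2 A4 \<and> orthogonal_sets q A2 A8 \<and> orthogonal_sets q A4 A8 \<and>
        bij_betw (\<lambda>(x, y, z). x + y + z) (A2 \<times> A4 \<times> A8) two_adic_part)"


section \<open>The modular group and Fourier expansions\<close>

definition SL2Z :: "(int^2^2) set" where
  "SL2Z = {M. det M = 1}"

definition S_mat :: "int^2^2" where
  "S_mat = vector [vector [0, - 1], vector [1, 0]]"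

definition T_mat :: "int \<Rightarrow> int^2^2" where  \<comment> \<open>the power \<open>T\<^sup>t\<close>\<close>
  "T_mat t = vector [vector [1, t], vector [0, 1]]"

definition Gamma0 :: "nat \<Rightarrow> (int^2^2) set" where
  "Gamma0 N = {M \<in> SL2Z. int N dvd M $ 2 $ 1}"

definition upper_half_plane :: "complex set" where
  "upper_half_plane = {\<tau>. Im \<tau> > 0}"

definition moebius :: "int^2^2 \<Rightarrow> complex \<Rightarrow> complex" where
  "moebius M \<tau> = (of_int (M $ 1 $ 1) * \<tau> + of_int (M $ 1 $ 2)) /
                 (of_int (M $ 2 $ 1) * \<tau> + of_int (M $ 2 $ 2))"

definition aut_factor :: "int^2^2 \<Rightarrow> complex \<Rightarrow> complex" where
  "aut_factor M \<tau> = of_int (M $ 2 $ 1) * \<tau> + of_int (M $ 2 $ 2)"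

definition slash :: "int \<Rightarrow> (complex \<Rightarrow> complex) \<Rightarrow> int^2^2 \<Rightarrow> complex \<Rightarrow> complex" where
  "slash k f M \<tau> = aut_factor M \<tau> powi (- k) * f (moebius M \<tau>)"

definition e :: "complex \<Rightarrow> complex" where
  "e x = exp (2 * of_real pi * \<i> * x)"

text \<open>\<open>f = \<Sum>\<^sub>j a\<^sub>j q\<^bsup>(m+j)/h\<^esup>\<close> on the upper half plane, where \<open>q\<^sup>r = e(r \<tau>)\<close>.\<close>

definition q_expansion :: "(complex \<Rightarrow> complex) \<Rightarrow> nat \<Rightarrow> int \<Rightarrow> (nat \<Rightarrow> complex) \<Rightarrow> bool" where
  "q_expansion f h m a \<longleftrightarrow> h > 0 \<and>
     (\<forall>\<tau> \<in> upper_half_plane. (\<lambda>j. a j * e (of_int (m + int j) / of_nat h * \<tau>)) sums f \<tau>)"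

definition meromorphic_at_ioo :: "(complex \<Rightarrow> complex) \<Rightarrow> bool" where
  "meromorphic_at_ioo f \<longleftrightarrow> (\<exists>h m a. q_expansion f h m a)"

definition pole_at_ioo :: "(complex \<Rightarrow> complex) \<Rightarrow> bool" where
  "pole_at_ioo f \<longleftrightarrow> (\<exists>h m a. q_expansion f h m a \<and> m < 0 \<and> a 0 \<noteq> 0)"

text \<open>\<open>f = c q\<^sup>r + (higher powers)\<close>; the constant \<open>c\<close> may be zero.\<close>

definition leading_term :: "(complex \<Rightarrow> complex) \<Rightarrow> rat \<Rightarrow> complex \<Rightarrow> bool" where
  "leading_term f r c \<longleftrightarrow>
     (\<exists>h m a. q_expansion f h m a \<and> of_int m / of_nat h = r \<and> a 0 = c)"


section \<open>The Weil representation and its modular forms\<close>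

text \<open>\<open>\<complex>[D]\<close> is \<open>complex^'d\<close> with \<open>e\<^sup>\<gamma> = axis \<gamma> 1\<close>.\<close>

type_synonym 'd group_alg = "(complex, 'd) vec"
type_synonym 'd group_alg_mat = "((complex, 'd) vec, 'd) vec"

text \<open>
  As \<open>S\<close> and \<open>T\<close> generate
  \<open>SL\<^sub>2(\<int>)\<close>, the following conditions determine \<open>\<rho>\<close> on \<open>SL\<^sub>2(\<int>)\<close>; such a
  \<open>\<rho>\<close> exists for every discriminant form of even signature.
\<close>

definition weil_representation ::
    "('d::{finite,ab_group_add} \<Rightarrow> rat) \<Rightarrow> (int^2^2 \<Rightarrow> 'd group_alg_mat) \<Rightarrow> bool" where
  "weil_representation q \<rho> \<longleftrightarrow>
     \<rho> (mat 1) = mat 1 \<and>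
     (\<forall>M \<in> SL2Z. \<forall>M' \<in> SL2Z. \<rho> (M ** M') = \<rho> M ** \<rho> M') \<and>
     (\<forall>\<gamma>. \<rho> (T_mat 1) *v axis \<gamma> 1 = e (of_rat (- q \<gamma>)) *s axis \<gamma> 1) \<and>
     (\<forall>\<gamma>. \<rho> S_mat *v axis \<gamma> 1 =
        (e (of_int (disc_signature q) / 8) / of_real (sqrt (real CARD('d)))) *s
          (\<Sum>\<beta>\<in>UNIV. e (of_rat (bil q \<gamma> \<beta>)) *s axis \<beta> 1))"

definition weil_modular_form ::
    "(int^2^2 \<Rightarrow> 'd group_alg_mat) \<Rightarrow> int \<Rightarrow> (complex \<Rightarrow> 'd::finite group_alg) \<Rightarrow> bool" where
  "weil_modular_form \<rho> k F \<longleftrightarrow>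
     (\<forall>\<gamma>. (\<lambda>\<tau>. F \<tau> $ \<gamma>) holomorphic_on upper_half_plane) \<and>
     (\<forall>M \<in> SL2Z. \<forall>\<tau> \<in> upper_half_plane.
        F (moebius M \<tau>) = aut_factor M \<tau> powi k *s (\<rho> M *v F \<tau>)) \<and>
     (\<forall>\<gamma>. meromorphic_at_ioo (\<lambda>\<tau>. F \<tau> $ \<gamma>))"

definition singular_component :: "(complex \<Rightarrow> 'd::finite group_alg) \<Rightarrow> 'd \<Rightarrow> bool" where
  "singular_component F \<gamma> \<longleftrightarrow> pole_at_ioo (\<lambda>\<tau>. F \<tau> $ \<gamma>)"

definition weakly_reflective ::
    "('d::{finite,ab_group_add} \<Rightarrow> rat) \<Rightarrow> (int^2^2 \<Rightarrow> 'd group_alg_mat) \<Rightarrow> int \<Rightarrow>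
       (complex \<Rightarrow> 'd group_alg) \<Rightarrow> bool" where
  "weakly_reflective q \<rho> k F \<longleftrightarrow>
     weil_modular_form \<rho> k F \<and>
     (\<exists>n m G. n > 2 \<and> even_lattice m G n 2 \<and> has_discriminant_form m G q \<and>
        real_of_int k = 1 - real n / 2) \<and>
     (\<forall>\<gamma>. singular_component F \<gamma> \<longrightarrow>
        (\<exists>d c. d dvd level q \<and> \<gamma> \<in> mul_kernel_val q d (1 / of_nat d) \<and>
           c \<in> \<rat> \<and> leading_term (\<lambda>\<tau>. F \<tau> $ \<gamma>) (- 1 / of_nat d) c))"


section \<open>Modular forms for \<open>\<Gamma>\<^sub>0(N)\<close>\<close>

text \<open>\<open>\<rho>(M) e\<^sup>0 = \<chi>(M) e\<^sup>0\<close>; only meaningful for \<open>M \<in> \<Gamma>\<^sub>0(N)\<close>.\<close>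

definition weil_character ::
    "(int^2^2 \<Rightarrow> 'd::{finite,zero} group_alg_mat) \<Rightarrow> int^2^2 \<Rightarrow> complex" where
  "weil_character \<rho> M = (THE z. \<rho> M *v axis 0 1 = z *s axis 0 1)"

text \<open>
  The cusps are the \<open>s = M\<infinity> = a/c\<close> for \<open>M \<in> SL\<^sub>2(\<int>)\<close> with first column \<open>(a, c)\<close>.
  Conditions at all cusps are stated for all \<open>M\<close>; they depend neither on the choice of
  \<open>M\<close> for a given \<open>s\<close> nor on that of \<open>s\<close> modulo \<open>\<Gamma>\<^sub>0(N)\<close>.
\<close>

definition Gamma0_modular_form ::
    "nat \<Rightarrow> (int^2^2 \<Rightarrow> complex) \<Rightarrow> int \<Rightarrow> (complex \<Rightarrow> complex) \<Rightarrow> bool" where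
  "Gamma0_modular_form N \<psi> k f \<longleftrightarrow>
     f holomorphic_on upper_half_plane \<and>
     (\<forall>M \<in> Gamma0 N. \<forall>\<tau> \<in> upper_half_plane.
        f (moebius M \<tau>) = \<psi> M * aut_factor M \<tau> powi k * f \<tau>) \<and>
     (\<forall>M \<in> SL2Z. meromorphic_at_ioo (slash k f M))"

definition cusp_width :: "nat \<Rightarrow> int^2^2 \<Rightarrow> nat" where
  "cusp_width N M = N div nat (gcd ((M $ 2 $ 1)\<^sup>2) (int N))"

definition cusp_stabilizer :: "nat \<Rightarrow> int^2^2 \<Rightarrow> int^2^2" where
  "cusp_stabilizer N M = M ** T_mat (int (cusp_width N M)) ** matrix_inv M"

definition cusp_sign_order :: "nat \<Rightarrow> (int^2^2 \<Rightarrow> complex) \<Rightarrow> int^2^2 \<Rightarrow> nat" where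
  "cusp_sign_order N \<psi> M = (if \<psi> (cusp_stabilizer N M) = 1 then 1 else 2)"

definition small_pole_orders ::
    "nat \<Rightarrow> (int^2^2 \<Rightarrow> complex) \<Rightarrow> int \<Rightarrow> (complex \<Rightarrow> complex) \<Rightarrow> bool" where
  "small_pole_orders N \<psi> k f \<longleftrightarrow>
     (\<forall>M \<in> SL2Z. \<exists>c.
        leading_term (slash k f M)
          (- 1 / of_nat (cusp_sign_order N \<psi> M * cusp_width N M)) c)"

text \<open>
  The valuation at \<open>p\<close> of the denominator of \<open>s = a/c\<close>, capped at \<open>\<nu>\<^sub>p(N)\<close>. This is
  the invariant of the class of \<open>s\<close> modulo \<open>\<Gamma>\<^sub>0(N)\<close>, and it is \<open>\<nu>\<^sub>p(c)\<close> for the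
  usual representatives with \<open>c\<close> dividing \<open>N\<close> (\<open>c = N\<close> for the cusp
  \<open>\<infinity> = 1/0\<close>).
\<close>

definition cusp_valuation :: "nat \<Rightarrow> nat \<Rightarrow> int^2^2 \<Rightarrow> nat" where
  "cusp_valuation p N M = multiplicity (int p) (gcd (M $ 2 $ 1) (int N))"

end

theory Submission
  imports Defs "HOL-Real_Asymp.Real_Asymp" "HOL-Library.Function_Algebras" "HOL-Library.Z2"
begin

text \<open>
  For every prime \<open>p | N\<close> choose a non-zero isotropic \<open>\<gamma>\<^sub>p \<in> D\<^bsup>N/p\<^esup>\<close>. The form \<open>g\<close> is the pairing
  of \<open>F\<close> with a vector \<open>v \<in> \<complex>[D]\<close> supported on the isotropic subgroup generated by the
  \<open>\<gamma>\<^sub>p\<close>, invariant under units, with \<open>v(0) \<noteq> 0\<close>, and killed by averaging over each group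
  \<open>\<int>\<gamma>\<^sub>p\<close>. Such a \<open>v\<close> transforms with \<open>\<chi>\<^sub>D\<close>, and the pole of \<open>F\<^sub>0\<close> survives in \<open>g\<close>.

  At a cusp \<open>M\<infinity>\<close> the form \<open>g|M\<close> is \<open>\<Sum>\<^sub>x R(x) F\<^sub>x\<close> with \<open>R = v\<^sup>T \<rho>(M)\<close>. Conjugating
  Heisenberg operators by \<open>\<rho>(M)\<close> turns the averaging property of \<open>v\<close> into a vanishing property of \<open>R\<close>:
  if \<open>R(x) \<noteq> 0\<close>, then the order of \<open>x\<close> is divisible by \<open>p\<^bsup>\<nu>-j\<^esup>\<close>, where \<open>\<nu> = \<nu>\<^sub>p(N)\<close> and
  \<open>j = \<nu>\<^sub>p(c)\<close> with \<open>j \<le> \<nu> - 2\<close> or \<open>j = 0\<close>. Since \<open>x \<in> D\<^bsub>d,1/d\<^esub>\<close> for singular \<open>F\<^sub>x\<close>, this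
  forces the width of the cusp to divide \<open>d\<close>, which bounds the pole orders. On the other hand, \<open>R\<close> is
  supported on a coset of \<open>D\<^sup>c\<close>, and for \<open>1 \<le> j \<le> \<nu> - 2\<close> the values of \<open>q\<close> there have too
  small denominators, except for \<open>p = 2\<close>, \<open>j = 1\<close>, \<open>\<nu> = 3\<close> and odd rank of the Jordan component
  of exponent 2. As \<open>k\<close> is an integer, the lattice \<open>L\<close> has even rank, so the 2-rank of \<open>D\<close> is even, and
  the component of exponent 4 has odd rank, too.
\<close>


section \<open>Integer multiples and rationals modulo the integers\<close>

text \<open>For N > 1 the plain component \<open>F_0\<close> fails at the cusp 0: its row there is
  constant, so the index 0 contributes a pole of order 1. The averaging property removes such
  indices. Translating v by \<open>\<gamma> p\<close> becomes, after conjugation with \<rho>(M), a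
  shift of the row by a multiple of \<open>\<gamma> p\<close> times a character. To compare values
  at one and the same index, this shift must be undone by a shift c h, under which the row is
  quasi-periodic as soon as h pairs integrally with every \<open>\<gamma> p'\<close>. So one solves
  c h = -a \<open>\<gamma> p\<close>, and this is what membership in D^(N/p) is for. If
  \<open>\<gamma> p\<close> = p^(\<nu>-1) r, then h is a multiple of p^(\<nu>-1-j) r, and the
  integrality of c q(h) and (h, \<open>\<gamma> p\<close>) follows from j \<le> \<nu>-2, or for
  \<nu> = 1 from the isotropy of \<open>\<gamma> p\<close>. For j \<ge> \<nu>-1 \<ge> 1 the argument
  stops, but there p does not divide the width. At j = 0 the coset condition at p is empty, whence
  the value 0 in (ii) and (iii).\<close>

lemma nmul_0 [simp]: "nmul 0 x = 0"
  by (simp add: nmul_def)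

lemma nmul_Suc [simp]: "nmul (Suc n) x = x + nmul n x"
  by (simp add: nmul_def add.commute)

lemma nmul_add: "nmul (m + n) x = nmul m x + nmul n x"
  by (induction m) (simp_all add: algebra_simps)

lemma nmul_add_right: "nmul m (x + y) = nmul m x + nmul m y"
  by (induction m) (simp_all add: algebra_simps)

text \<open>Matrix entries act on D and may be negative, whereas \<open>nmul\<close> only takes
  natural numbers.\<close>

definition zmul :: "int \<Rightarrow> 'd::ab_group_add \<Rightarrow> 'd" where
  "zmul n x = nmul (nat n) x - nmul (nat (- n)) x"

lemma zmul_of_nat: "zmul (int n) x = nmul n x"
  by (simp add: zmul_def)

lemma zmul_diff_of_nat: "zmul (int m - int n) x = nmul m x - nmul n x"
proof (cases "m \<ge> n")
  case True
  then obtain k where "m = k + n" using le_Suc_ex by (metis add.commute)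
  thus ?thesis by (simp add: zmul_def nmul_add)
next
  case False
  then obtain k where "n = k + m" using le_Suc_ex by (metis add.commute nat_le_linear)
  thus ?thesis by (simp add: zmul_def nmul_add)
qed

lemma int_diff_natE:
  obtains m n where "k = int m - int n"
  by (metis int_diff_cases)

lemma zmul_0_left [simp]: "zmul 0 x = 0"
  by (simp add: zmul_def)

lemma zmul_1 [simp]: "zmul 1 x = x"
  by (simp add: zmul_def)

lemma zmul_add_left: "zmul (m + n) x = zmul m x + zmul n x"
proof -
  obtain a b c d where "m = int a - int b" "n = int c - int d"
    using int_diff_natE by metis
  moreover have "m + n = int (a + c) - int (b + d)" using calculation by simp
  ultimately show ?thesis by (simp only: zmul_diff_of_nat nmul_add) (simp add: algebra_simps)
qed

lemma zmul_minus_left: "zmul (- n) x = - zmul n x"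
  by (simp add: zmul_def)

lemma zmul_diff_left: "zmul (m - n) x = zmul m x - zmul n x"
  using zmul_add_left[of m "- n" x] by (simp add: zmul_minus_left)

lemma zmul_add_right: "zmul n (x + y) = zmul n x + zmul n y"
  by (simp add: zmul_def nmul_add_right)

lemma zmul_0_right [simp]: "zmul n 0 = 0"
  using zmul_add_right[of n 0 0] by simp

lemma zmul_minus_right: "zmul n (- x) = - zmul n x"
  using zmul_add_right[of n x "- x"] by (simp add: eq_neg_iff_add_eq_0 add.commute)

lemma zmul_diff_right: "zmul n (x - y) = zmul n x - zmul n y"
  using zmul_add_right[of n x "- y"] by (simp add: zmul_minus_right)

lemma zmul_mult: "zmul (m * n) x = zmul m (zmul n x)"
proof -
  have nn: "zmul (int a * n) x = zmul (int a) (zmul n x)" for a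
    by (induction a) (simp_all add: algebra_simps zmul_add_left)
  show ?thesis
    by (cases m rule: int_cases2) (simp_all add: nn zmul_minus_left)
qed

lemma zmul_commute: "zmul m (zmul n x) = zmul n (zmul m x)"
  by (metis zmul_mult mult.commute)

lemma zmul_eq_0_coprime:
  assumes "zmul m x = 0" "zmul n x = 0" "coprime m n"
  shows "x = 0"
proof -
  obtain a b where "a * m + b * n = 1"
    using assms(3) bezout_int by (metis coprime_iff_gcd_eq_1)
  hence "x = zmul (a * m + b * n) x" by simp
  also have "\<dots> = 0" using assms by (simp only: zmul_add_left zmul_mult) simp
  finally show ?thesis .
qed

text \<open>Bezout. Together with \<open>zmul_eq_0_coprime\<close> this takes the place of a primary
  decomposition of D: a value is integral if two coprime multiples of it are.\<close>

lemma Ints_coprime: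
  fixes r :: rat
  assumes "of_int m * r \<in> \<int>" "of_int n * r \<in> \<int>" "coprime m n"
  shows "r \<in> \<int>"
proof -
  obtain a b where ab: "a * m + b * n = 1"
    using assms(3) bezout_int by (metis coprime_iff_gcd_eq_1)
  have "r = of_int (a * m + b * n) * r" using ab by simp
  also have "\<dots> = of_int a * (of_int m * r) + of_int b * (of_int n * r)"
    by (simp add: algebra_simps)
  also have "\<dots> \<in> \<int>" using assms(1,2) by (intro Ints_add) (metis Ints_mult Ints_of_int)+
  finally show ?thesis .
qed

section \<open>Congruence of rationals modulo 1 and the standard character\<close>

definition cg :: "rat \<Rightarrow> rat \<Rightarrow> bool" (infix "\<simeq>" 50) where
  "r \<simeq> s \<longleftrightarrow> r - s \<in> \<int>"

lemma cg_refl [simp, intro]: "r \<simeq> r"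
  by (simp add: cg_def)

lemma cg_sym: "r \<simeq> s \<Longrightarrow> s \<simeq> r"
  unfolding cg_def by (metis Ints_minus minus_diff_eq)

lemma cg_trans [trans]: "r \<simeq> s \<Longrightarrow> s \<simeq> t \<Longrightarrow> r \<simeq> t"
  unfolding cg_def by (metis Ints_add diff_add_cancel add_diff_eq)

lemma cg_add: "r \<simeq> s \<Longrightarrow> r' \<simeq> s' \<Longrightarrow> r + r' \<simeq> s + s'"
  unfolding cg_def using Ints_add by (metis add_diff_add)

lemma cg_minus: "r \<simeq> s \<Longrightarrow> - r \<simeq> - s"
  unfolding cg_def by (metis Ints_minus minus_diff_eq minus_diff_minus)

lemma cg_diff: "r \<simeq> s \<Longrightarrow> r' \<simeq> s' \<Longrightarrow> r - r' \<simeq> s - s'"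
  using cg_add[of r s "- r'" "- s'"] cg_minus by simp

lemma cg_mult: "r \<simeq> s \<Longrightarrow> of_int n * r \<simeq> of_int n * s"
  unfolding cg_def by (metis Ints_mult Ints_of_int right_diff_distrib)

lemma cg_0_iff: "r \<simeq> 0 \<longleftrightarrow> r \<in> \<int>"
  by (simp add: cg_def)

lemma cg_Ints: "r \<simeq> s \<Longrightarrow> r \<in> \<int> \<longleftrightarrow> s \<in> \<int>"
  by (meson cg_0_iff cg_sym cg_trans)

definition E :: "rat \<Rightarrow> complex" where
  "E r = e (of_rat r)"

lemma e_add: "e (x + y) = e x * e y"
  by (simp add: e_def exp_add algebra_simps)

lemma E_add: "E (r + s) = E r * E s"
  by (simp add: E_def of_rat_add e_add)

lemma E_0 [simp]: "E 0 = 1"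
  by (simp add: E_def e_def)

lemma E_nonzero [simp]: "E r \<noteq> 0"
  by (simp add: E_def e_def)

lemma of_rat_complex: "complex_of_rat r = complex_of_real (of_rat r)"
  by (cases r) (simp add: of_rat_rat)

lemma E_eq_1_iff: "E r = 1 \<longleftrightarrow> r \<in> \<int>"
proof -
  have "E r = 1 \<longleftrightarrow> (\<exists>n::int. 2 * pi * real_of_rat r = of_int (2 * n) * pi)"
    by (simp add: E_def e_def exp_eq_1 of_rat_complex)
  also have "\<dots> \<longleftrightarrow> (\<exists>n::int. real_of_rat r = real_of_rat (of_int n))"
    by (simp add: mult.commute)
  also have "\<dots> \<longleftrightarrow> r \<in> \<int>"
    by (simp only: of_rat_eq_iff) (auto simp: Ints_def)
  finally show ?thesis .
qed

lemma E_cong: "r \<simeq> s \<Longrightarrow> E r = E s"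
proof -
  assume "r \<simeq> s"
  hence "E (r - s) = 1" by (simp add: E_eq_1_iff cg_def)
  thus ?thesis using E_add[of "r - s" s] by simp
qed


section \<open>Discriminant forms\<close>

locale disc_form =
  fixes q :: "'d::{finite,ab_group_add} \<Rightarrow> rat"
  assumes discriminant_form: "discriminant_form q"
begin

abbreviation B :: "'d \<Rightarrow> 'd \<Rightarrow> rat" where "B \<equiv> bil q"

lemma q_add: "q (x + y) = q x + q y + B x y"
  by (simp add: bil_def)

lemma B_commute: "B x y = B y x"
  by (simp add: bil_def add.commute)

lemma B_add_left: "B (x + y) z \<simeq> B x z + B y z"
  using discriminant_form by (simp add: discriminant_form_def cg_def algebra_simps)

lemma B_add_right: "B x (y + z) \<simeq> B x y + B x z"
  using B_add_left[of y z x] by (simp only: B_commute[of x])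

lemma B_0_left: "B 0 x \<in> \<int>"
  using B_add_left[of 0 0 x] Ints_minus by (fastforce simp: cg_def)

lemma B_0_right: "B x 0 \<in> \<int>"
  using B_0_left[of x] by (simp only: B_commute[of x])

lemma B_minus_left: "B (- x) y \<simeq> - B x y"
proof -
  have "B (- x) y + B x y \<simeq> B (- x + x) y" by (rule cg_sym[OF B_add_left])
  also have "\<dots> \<simeq> 0" using B_0_left by (simp add: cg_def)
  finally show ?thesis by (simp add: cg_def)
qed

lemma B_nmul_left: "B (nmul n x) y \<simeq> of_nat n * B x y"
proof (induction n)
  case 0
  show ?case using B_0_left by (simp add: cg_def)
next
  case (Suc n)
  have "B (nmul (Suc n) x) y \<simeq> B x y + B (nmul n x) y"
    using B_add_left[of x "nmul n x" y] by simp
  also have "\<dots> \<simeq> B x y + of_nat n * B x y" by (intro cg_add Suc) auto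
  finally show ?case by (simp add: algebra_simps)
qed

lemma B_zmul_left: "B (zmul n x) y \<simeq> of_int n * B x y"
proof -
  have "B (zmul n x) y \<simeq> B (nmul (nat n) x) y + B (- nmul (nat (- n)) x) y"
    unfolding zmul_def using B_add_left by (metis diff_conv_add_uminus)
  also have "\<dots> \<simeq> of_nat (nat n) * B x y + - (of_nat (nat (- n)) * B x y)"
    by (intro cg_add B_nmul_left cg_trans[OF B_minus_left cg_minus] B_nmul_left)
  also have "\<dots> = of_int n * B x y"
    by (cases "n \<ge> 0") (auto simp: of_nat_nat)
  finally show ?thesis .
qed

lemma B_zmul_right: "B x (zmul n y) \<simeq> of_int n * B x y"
  using B_zmul_left[of n y x] by (simp only: B_commute[of x])

lemma B_minus_right: "B x (- y) \<simeq> - B x y"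
  using B_minus_left[of y x] by (simp only: B_commute[of x])

lemma q_minus: "q (- x) \<simeq> q x"
  using discriminant_form by (simp add: discriminant_form_def cg_def)

lemma q_nmul: "q (nmul n x) \<simeq> of_nat (n ^ 2) * q x"
  using discriminant_form by (simp add: discriminant_form_def cg_def)

lemma q_zmul: "q (zmul n x) \<simeq> of_int (n\<^sup>2) * q x"
proof (cases "n \<ge> 0")
  case True
  thus ?thesis using q_nmul[of "nat n" x] by (simp add: zmul_def)
next
  case False
  have "q (zmul n x) \<simeq> q (nmul (nat (- n)) x)"
    using False q_minus by (simp add: zmul_def)
  also have "\<dots> \<simeq> of_nat ((nat (- n)) ^ 2) * q x" by (rule q_nmul)
  also have "\<dots> = of_int (n\<^sup>2) * q x" using False by (simp add: of_nat_nat)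
  finally show ?thesis .
qed

lemma q_0: "q 0 \<in> \<int>"
  using q_zmul[of 0 0] by (simp add: cg_def)

lemma B_self: "B x x \<simeq> 2 * q x"
proof -
  have "q (zmul 2 x) \<simeq> 4 * q x" using q_zmul[of 2 x] by simp
  moreover have "zmul 2 x = x + x" using zmul_add_left[of 1 1 x] by simp
  ultimately show ?thesis by (simp add: q_add cg_def)
qed

lemma B_nondegenerate: "(\<And>y. B y x \<in> \<int>) \<Longrightarrow> x = 0"
  using discriminant_form by (simp add: discriminant_form_def)

lemma B_lincomb_left: "B (zmul m x + zmul n y) z \<simeq> of_int m * B x z + of_int n * B y z"
  by (intro cg_trans[OF B_add_left] cg_add B_zmul_left)

lemma q_lincomb:
  "q (zmul m x + zmul n y) \<simeq> of_int (m\<^sup>2) * q x + of_int (n\<^sup>2) * q y + of_int (m * n) * B x y"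
proof -
  have "B (zmul m x) (zmul n y) \<simeq> of_int m * B x (zmul n y)" by (rule B_zmul_left)
  also have "\<dots> \<simeq> of_int m * (of_int n * B x y)" by (rule cg_mult[OF B_zmul_right])
  finally show ?thesis unfolding q_add by (intro cg_add q_zmul) (simp add: mult.assoc)
qed

lemma B_lincomb2:
  "B (zmul m x + zmul n y) (zmul m' x + zmul n' y) \<simeq>
     of_int (2 * m * m') * q x + of_int (2 * n * n') * q y + of_int (m * n' + n * m') * B x y"
proof -
  have *: "B u (zmul m' x + zmul n' y) \<simeq> of_int m' * B u x + of_int n' * B u y" for u
    using B_lincomb_left[of m' x n' y u] by (simp only: B_commute[of u])
  have "B (zmul m x + zmul n y) (zmul m' x + zmul n' y) \<simeq>
      of_int m * B x (zmul m' x + zmul n' y) + of_int n * B y (zmul m' x + zmul n' y)"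
    by (rule B_lincomb_left)
  also have "\<dots> \<simeq> of_int m * (of_int m' * B x x + of_int n' * B x y)
      + of_int n * (of_int m' * B y x + of_int n' * B y y)"
    by (intro cg_add cg_mult *)
  also have "\<dots> \<simeq> of_int m * (of_int m' * (2 * q x) + of_int n' * B x y)
      + of_int n * (of_int m' * B y x + of_int n' * (2 * q y))"
    by (intro cg_add cg_mult B_self) auto
  also have "\<dots> = of_int (2 * m * m') * q x + of_int (2 * n * n') * q y + of_int (m * n' + n * m') * B x y"
    by (simp add: B_commute[of y x] algebra_simps)
  finally show ?thesis .
qed

lemma order_B: "zmul n x = 0 \<Longrightarrow> of_int n * B x y \<in> \<int>"
  using B_zmul_left[of n x y] B_0_left cg_Ints by auto

lemma order_B_right: "zmul n x = 0 \<Longrightarrow> of_int n * B y x \<in> \<int>"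
  using order_B by (simp only: B_commute[of y])

lemma B_coprime:
  assumes "zmul m x = 0" "zmul n y = 0" "coprime m n"
  shows "B x y \<in> \<int>"
  using Ints_coprime[OF order_B[OF assms(1)] order_B_right[OF assms(2)] assms(3)] .

lemma E_B_add_left: "E (B (x + y) z) = E (B x z) * E (B y z)"
  using E_cong[OF B_add_left] by (simp add: E_add)

lemma E_B_add_right: "E (B x (y + z)) = E (B x y) * E (B x z)"
  using E_cong[OF B_add_right] by (simp add: E_add)

text \<open>\<open>LEAST\<close> says nothing until some admissible number is known; as D is finite,
  the product of all denominators of q is one.\<close>

lemma level_pos: "level q > 0" and level_q: "of_nat (level q) * q x \<in> \<int>"
proof -
  define K where "K = (\<Prod>x\<in>UNIV. nat (snd (quotient_of (q x))))"
  have den: "snd (quotient_of r) > 0" for r using quotient_of_denom_pos' by simp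
  have "K > 0" unfolding K_def using den by (intro prod_pos) simp
  moreover have "of_nat K * q x \<in> \<int>" for x
  proof -
    define d where "d = nat (snd (quotient_of (q x)))"
    have "d dvd K" unfolding K_def d_def by (rule dvd_prodI) auto
    then obtain l where l: "K = d * l" ..
    have "of_int (snd (quotient_of (q x))) * q x = of_int (fst (quotient_of (q x)))"
      using quotient_of_div[of "q x" "fst (quotient_of (q x))" "snd (quotient_of (q x))"] den[of "q x"]
      by (simp add: field_simps)
    moreover have "of_nat d = (of_int (snd (quotient_of (q x))) :: rat)"
      unfolding d_def using den[of "q x"] by (simp add: of_nat_nat)
    ultimately have "of_nat K * q x = of_nat l * of_int (fst (quotient_of (q x)))"
      using l by (simp add: algebra_simps)
    thus ?thesis by simp
  qed
  ultimately have "\<exists>N. 0 < N \<and> (\<forall>\<gamma>. of_nat N * q \<gamma> \<in> \<int>)" by blast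
  from LeastI_ex[OF this] show "level q > 0" "of_nat (level q) * q x \<in> \<int>"
    unfolding level_def by auto
qed

text \<open>B is an integral combination of values of q, so multiplication by the level makes it
  integral; non-degeneracy turns this into annihilation of D.\<close>

lemma level_zmul: "zmul (int (level q)) (x :: 'd) = 0"
proof (rule B_nondegenerate)
  fix y :: 'd
  have "B y (zmul (int (level q)) x) \<simeq> of_nat (level q) * B y x"
    using B_zmul_right[of y "int (level q)" x] by simp
  also have "of_nat (level q) * B y x = of_nat (level q) * q (y + x) - of_nat (level q) * q y - of_nat (level q) * q x"
    by (simp add: bil_def algebra_simps)
  also have "\<dots> \<simeq> 0" unfolding cg_0_iff by (intro Ints_diff level_q)
  finally show "B y (zmul (int (level q)) x) \<in> \<int>" by (simp add: cg_0_iff)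
qed

end


section \<open>Generation of the modular group\<close>

lemma mat2_eq_iff:
  fixes M M' :: "'a^2^2"
  shows "M = M' \<longleftrightarrow> M$1$1 = M'$1$1 \<and> M$1$2 = M'$1$2 \<and> M$2$1 = M'$2$1 \<and> M$2$2 = M'$2$2"
  by (auto simp: vec_eq_iff forall_2)

lemma mat2_mult:
  fixes M M' :: "'a::comm_semiring_1^2^2"
  shows "(M ** M') $ i $ j = M$i$1 * M'$1$j + M$i$2 * M'$2$j"
  by (simp add: matrix_matrix_mult_def sum_2)

lemma S_mat_simps [simp]: "S_mat$1$1 = 0" "S_mat$1$2 = -1" "S_mat$2$1 = 1" "S_mat$2$2 = 0"
  by (simp_all add: S_mat_def)

lemma T_mat_simps [simp]: "T_mat t$1$1 = 1" "T_mat t$1$2 = t" "T_mat t$2$1 = 0" "T_mat t$2$2 = 1"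
  by (simp_all add: T_mat_def)

lemma mat_1_simps [simp]: "(mat 1 :: 'a::zero_neq_one^2^2)$1$1 = 1" "(mat 1 :: 'a^2^2)$1$2 = 0"
  "(mat 1 :: 'a^2^2)$2$1 = 0" "(mat 1 :: 'a^2^2)$2$2 = 1"
  by (simp_all add: mat_def)

lemma SL2Z_iff: "M \<in> SL2Z \<longleftrightarrow> M$1$1 * M$2$2 - M$1$2 * M$2$1 = 1"
  by (simp add: SL2Z_def det_2)

lemma S_SL2Z [simp]: "S_mat \<in> SL2Z" and T_SL2Z [simp]: "T_mat t \<in> SL2Z"
  and mat_1_SL2Z [simp]: "mat 1 \<in> SL2Z"
  by (simp_all add: SL2Z_iff)

lemma SL2Z_mult [simp]: "M \<in> SL2Z \<Longrightarrow> M' \<in> SL2Z \<Longrightarrow> M ** M' \<in> SL2Z"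
  unfolding SL2Z_def by (simp add: det_mul)

lemma T_mat_add: "T_mat s ** T_mat t = T_mat (s + t)"
  by (simp add: mat2_eq_iff mat2_mult)

lemma T_mat_0: "T_mat 0 = mat 1"
  by (simp add: mat2_eq_iff)

lemma SL2Z_coprime: "M \<in> SL2Z \<Longrightarrow> coprime (M$2$1) (M$2$2)" "M \<in> SL2Z \<Longrightarrow> coprime (M$1$1) (M$2$1)"
proof -
  assume "M \<in> SL2Z"
  hence d: "M$1$1 * M$2$2 - M$1$2 * M$2$1 = 1" by (simp add: SL2Z_iff)
  have "x dvd 1" if "x dvd M$2$1" "x dvd M$2$2 \<or> x dvd M$1$1" for x
  proof -
    have "x dvd M$1$2 * M$2$1" "x dvd M$1$1 * M$2$2" using that by (auto intro: dvd_mult dvd_mult2)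
    thus ?thesis using d by (metis dvd_diff)
  qed
  thus "coprime (M$2$1) (M$2$2)" "coprime (M$1$1) (M$2$1)"
    by (auto intro!: coprimeI)
qed

text \<open>Euclid's algorithm on the first column. The matrix -1 arises as the square of S.\<close>

lemma SL2Z_induct [consumes 1, case_names one S T T_inv]:
  assumes "M \<in> SL2Z" and one: "P (mat 1)"
    and S: "\<And>M. M \<in> SL2Z \<Longrightarrow> P M \<Longrightarrow> P (S_mat ** M)"
    and T: "\<And>M. M \<in> SL2Z \<Longrightarrow> P M \<Longrightarrow> P (T_mat 1 ** M)"
    and T_inv: "\<And>M. M \<in> SL2Z \<Longrightarrow> P M \<Longrightarrow> P (T_mat (-1) ** M)"
  shows "P M"
proof -
  have Tn: "P (T_mat n ** M)" if "M \<in> SL2Z" "P M" for n M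
  proof (induction n rule: int_induct[where k = 0])
    case base
    show ?case using that by (simp add: T_mat_0)
  next
    case (step1 i)
    from T[OF _ step1(2)] that show ?case by (simp add: matrix_mul_assoc T_mat_add add.commute)
  next
    case (step2 i)
    from T_inv[OF _ step2(2)] that show ?case by (simp add: matrix_mul_assoc T_mat_add)
  qed
  show ?thesis using assms(1)
  proof (induction "nat \<bar>M$2$1\<bar>" arbitrary: M rule: less_induct)
    case less
    have d: "M$1$1 * M$2$2 - M$1$2 * M$2$1 = 1" using less.prems by (simp add: SL2Z_iff)
    show ?case
    proof (cases "M$2$1 = 0")
      case True
      hence "M$1$1 * M$2$2 = 1" using d by simp
      hence "M$1$1 = 1 \<and> M$2$2 = 1 \<or> M$1$1 = -1 \<and> M$2$2 = -1" by (simp add: zmult_eq_1_iff)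
      thus ?thesis
      proof
        assume "M$1$1 = 1 \<and> M$2$2 = 1"
        hence "M = T_mat (M$1$2) ** mat 1" using True by (simp add: mat2_eq_iff)
        thus ?thesis using Tn one by (metis mat_1_SL2Z)
      next
        assume "M$1$1 = -1 \<and> M$2$2 = -1"
        hence "M = T_mat (- (M$1$2)) ** (S_mat ** (S_mat ** mat 1))"
          using True by (simp add: mat2_eq_iff mat2_mult)
        moreover have "P (S_mat ** (S_mat ** mat 1))" "S_mat ** (S_mat ** mat 1) \<in> SL2Z"
          by (intro S one mat_1_SL2Z S_SL2Z SL2Z_mult)+
        ultimately show ?thesis using Tn by metis
      qed
    next
      case False
      \<comment> \<open>\<open>M'\<close> is S^(-1) T^(-n) M. Its lower left entry is minus the
        remainder of the division, hence smaller than the divisor in absolute value.\<close>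
      define n where "n = M$1$1 div M$2$1"
      define M' :: "int^2^2" where
        "M' = vector [vector [M$2$1, M$2$2], vector [- (M$1$1 mod M$2$1), n * M$2$2 - M$1$2]]"
      have M': "M'$1$1 = M$2$1" "M'$1$2 = M$2$2" "M'$2$1 = - (M$1$1 mod M$2$1)" "M'$2$2 = n * M$2$2 - M$1$2"
        by (simp_all add: M'_def)
      have n: "M$1$1 mod M$2$1 = M$1$1 - n * M$2$1" by (simp add: n_def minus_div_mult_eq_mod)
      have "M' \<in> SL2Z" using d by (simp add: SL2Z_iff M' n algebra_simps)
      moreover have "nat \<bar>M'$2$1\<bar> < nat \<bar>M$2$1\<bar>"
        using False abs_mod_less[of "M$2$1" "M$1$1"] by (simp add: M')
      ultimately have "P M'" using less.hyps by blast
      hence "P (T_mat n ** (S_mat ** M'))" using \<open>M' \<in> SL2Z\<close> by (intro Tn S) auto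
      moreover have "T_mat n ** (S_mat ** M') = M"
        by (simp add: mat2_eq_iff mat2_mult M' n)
      ultimately show ?thesis by simp
    qed
  qed
qed


section \<open>The Weil representation\<close>

lemma matrix_vector_axis: "(A *v axis x (1::complex)) $ y = A $ y $ x"
  by (simp add: matrix_vector_mult_def axis_def if_distrib cong: if_cong)

locale weil_rep = disc_form q for q :: "'d::{finite,ab_group_add} \<Rightarrow> rat" +
  fixes \<rho> :: "int^2^2 \<Rightarrow> 'd group_alg_mat"
  assumes weil: "weil_representation q \<rho>"
begin

lemma rho_1: "\<rho> (mat 1) $ y $ x = (if y = x then 1 else 0)"
  using weil by (simp add: weil_representation_def mat_def)

lemma rho_mult:
  "M \<in> SL2Z \<Longrightarrow> M' \<in> SL2Z \<Longrightarrow> \<rho> (M ** M') $ y $ x = (\<Sum>z\<in>UNIV. \<rho> M $ y $ z * \<rho> M' $ z $ x)"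
  using weil by (simp add: weil_representation_def matrix_matrix_mult_def)

lemma rho_T: "\<rho> (T_mat 1) $ y $ x = (if y = x then E (- q x) else 0)"
proof -
  have "\<rho> (T_mat 1) *v axis x 1 = E (- q x) *s axis x 1"
    using weil by (simp add: weil_representation_def E_def)
  hence "(\<rho> (T_mat 1) *v axis x 1) $ y = (E (- q x) *s axis x 1) $ y" by simp
  thus ?thesis by (simp add: matrix_vector_axis) (simp add: axis_def)
qed

lemma rho_S_ex: "\<exists>\<sigma>. \<forall>x y. \<rho> S_mat $ y $ x = \<sigma> * E (B x y)"
proof -
  define \<sigma> where "\<sigma> = e (of_int (disc_signature q) / 8) / of_real (sqrt (real CARD('d)))"
  have "\<rho> S_mat $ y $ x = \<sigma> * E (B x y)" for x y
  proof -
    have "\<rho> S_mat *v axis x 1 = \<sigma> *s (\<Sum>\<beta>\<in>UNIV. E (B x \<beta>) *s axis \<beta> 1)"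
      using weil by (simp add: weil_representation_def E_def \<sigma>_def)
    hence "(\<rho> S_mat *v axis x 1) $ y = (\<sigma> *s (\<Sum>\<beta>\<in>UNIV. E (B x \<beta>) *s axis \<beta> 1)) $ y" by simp
    also have "\<dots> = \<sigma> * (\<Sum>\<beta>\<in>UNIV. if \<beta> = y then E (B x \<beta>) else 0)"
      by (simp add: axis_def if_distrib cong: if_cong)
    also have "\<dots> = \<sigma> * E (B x y)" by simp
    finally show ?thesis by (simp add: matrix_vector_axis)
  qed
  thus ?thesis by blast
qed

lemma rho_T_mult:
  assumes "M \<in> SL2Z"
  shows "\<rho> (T_mat 1 ** M) $ y $ x = E (- q y) * \<rho> M $ y $ x"
proof -
  have "\<rho> (T_mat 1 ** M) $ y $ x = (\<Sum>z\<in>UNIV. \<rho> (T_mat 1) $ y $ z * \<rho> M $ z $ x)"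
    using assms by (simp add: rho_mult)
  also have "\<dots> = (\<Sum>z\<in>UNIV. if z = y then E (- q y) * \<rho> M $ y $ x else 0)"
    by (intro sum.cong) (auto simp: rho_T)
  finally show ?thesis by simp
qed

lemma rho_T_nat: "\<rho> (T_mat (int t)) $ y $ x = (if y = x then E (- of_nat t * q x) else 0)"
proof (induction t)
  case 0
  show ?case using rho_1[of y x] by (simp add: T_mat_0)
next
  case (Suc t)
  have "T_mat (int (Suc t)) = T_mat 1 ** T_mat (int t)" by (simp add: T_mat_add)
  hence "\<rho> (T_mat (int (Suc t))) $ y $ x = E (- q y) * \<rho> (T_mat (int t)) $ y $ x"
    using rho_T_mult[of "T_mat (int t)" y x] by simp
  thus ?case using Suc by (auto simp: algebra_simps simp flip: E_add)
qed

text \<open>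
  The commutation relation of \<open>\<rho>(M)\<close> with the Heisenberg operators
  \<open>e\<^sup>x \<mapsto> e((\<beta>, x)) e\<^bsup>x + \<alpha>\<^esup>\<close>, written for matrix entries.
\<close>

definition heisenberg_rel :: "int^2^2 \<Rightarrow> bool" where
  "heisenberg_rel M \<longleftrightarrow> (\<forall>\<alpha> \<beta> x y.
     \<rho> M $ y $ (x + \<alpha>) * E (B \<beta> x) =
     E (of_int (- (M$1$2 * M$2$2)) * q \<alpha> + of_int (- (M$1$1 * M$2$1)) * q \<beta> + of_int (M$1$2 * M$2$1) * B \<alpha> \<beta>) *
     E (B (zmul (- (M$1$2)) \<alpha> + zmul (M$1$1) \<beta>) (y - (zmul (M$2$2) \<alpha> + zmul (- (M$2$1)) \<beta>))) *
     \<rho> M $ (y - (zmul (M$2$2) \<alpha> + zmul (- (M$2$1)) \<beta>)) $ x)"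

lemma heisenberg_rel_one: "heisenberg_rel (mat 1)"
proof -
  have "\<rho> (mat 1) $ y $ (x + \<alpha>) * E (B \<beta> x) = E (B \<beta> (y - \<alpha>)) * \<rho> (mat 1) $ (y - \<alpha>) $ x" for \<alpha> \<beta> x y
    by (auto simp: rho_1 algebra_simps)
  thus ?thesis unfolding heisenberg_rel_def by simp
qed

text \<open>\<open>\<rho> S_mat\<close> is a Fourier transform: substituting z + \<alpha>' turns the
  translation by \<alpha>' into a character of y, and the character \<beta>' into a translation of
  y. The new pair is (-\<beta>', \<alpha>'). The phases differ by (\<alpha>', \<beta>') because
  translation and character are now applied in the opposite order.\<close>

lemma heisenberg_rel_S:
  assumes M: "M \<in> SL2Z" and IH: "heisenberg_rel M"
  shows "heisenberg_rel (S_mat ** M)"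
  unfolding heisenberg_rel_def
proof (intro allI, goal_cases)
  case (1 \<alpha> \<beta> x y)
  obtain a b c d where abcd: "M$1$1 = a" "M$1$2 = b" "M$2$1 = c" "M$2$2 = d" by blast
  have SM: "(S_mat ** M)$1$1 = - c" "(S_mat ** M)$1$2 = - d" "(S_mat ** M)$2$1 = a" "(S_mat ** M)$2$2 = b"
    by (simp_all add: mat2_mult abcd)
  define \<alpha>' where "\<alpha>' = zmul d \<alpha> + zmul (- c) \<beta>"
  define \<beta>' where "\<beta>' = zmul (- b) \<alpha> + zmul a \<beta>"
  define f where "f = of_int (- (b * d)) * q \<alpha> + of_int (- (a * c)) * q \<beta> + of_int (b * c) * B \<alpha> \<beta>"
  define f' where "f' = of_int (b * d) * q \<alpha> + of_int (a * c) * q \<beta> + of_int (- (a * d)) * B \<alpha> \<beta>"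
  have IH': "\<rho> M $ z $ (x + \<alpha>) * E (B \<beta> x) = E f * E (B \<beta>' (z - \<alpha>')) * \<rho> M $ (z - \<alpha>') $ x" for z
    using IH unfolding heisenberg_rel_def abcd \<alpha>'_def \<beta>'_def f_def by blast
  obtain \<sigma> where \<sigma>: "\<And>x y. \<rho> S_mat $ y $ x = \<sigma> * E (B x y)" using rho_S_ex by blast
  have SM_entry: "\<rho> (S_mat ** M) $ y $ x = (\<Sum>z\<in>UNIV. \<sigma> * E (B z y) * \<rho> M $ z $ x)" for x y
    using M by (simp add: rho_mult \<sigma>)
  have "\<rho> (S_mat ** M) $ y $ (x + \<alpha>) * E (B \<beta> x) =
      (\<Sum>z\<in>UNIV. \<sigma> * E (B z y) * (\<rho> M $ z $ (x + \<alpha>) * E (B \<beta> x)))"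
    by (simp add: SM_entry sum_distrib_right mult.assoc)
  also have "\<dots> = (\<Sum>z\<in>UNIV. \<sigma> * E (B z y) * (E f * E (B \<beta>' (z - \<alpha>')) * \<rho> M $ (z - \<alpha>') $ x))"
    by (simp only: IH')
  also have "\<dots> = (\<Sum>z\<in>UNIV. \<sigma> * E (B (z + \<alpha>') y) * (E f * E (B \<beta>' z) * \<rho> M $ z $ x))"
    by (rule sum.reindex_bij_witness[of _ "\<lambda>z. z + \<alpha>'" "\<lambda>z. z - \<alpha>'"]) auto
  also have "\<dots> = E f * E (B \<alpha>' y) * (\<Sum>z\<in>UNIV. \<sigma> * E (B z (y + \<beta>')) * \<rho> M $ z $ x)"
    by (simp add: sum_distrib_left E_B_add_left E_B_add_right B_commute[of \<beta>'] algebra_simps)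
  also have "\<dots> = E f * E (B \<alpha>' y) * \<rho> (S_mat ** M) $ (y + \<beta>') $ x" by (simp add: SM_entry)
  also have "E f = E (f' + B \<alpha>' \<beta>')"
  proof (rule E_cong)
    have "f' + B \<alpha>' \<beta>' \<simeq> f' + (of_int (2 * d * (- b)) * q \<alpha> + of_int (2 * (- c) * a) * q \<beta>
        + of_int (d * a + (- c) * (- b)) * B \<alpha> \<beta>)"
      unfolding \<alpha>'_def \<beta>'_def by (intro cg_add B_lincomb2 cg_refl)
    also have "\<dots> = f" by (simp add: f_def f'_def algebra_simps)
    finally show "f \<simeq> f' + B \<alpha>' \<beta>'" by (rule cg_sym)
  qed
  also have "E (f' + B \<alpha>' \<beta>') * E (B \<alpha>' y) = E f' * E (B \<alpha>' (y + \<beta>'))"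
    by (simp add: E_add E_B_add_right)
  finally have "\<rho> (S_mat ** M) $ y $ (x + \<alpha>) * E (B \<beta> x) =
      E f' * E (B \<alpha>' (y + \<beta>')) * \<rho> (S_mat ** M) $ (y + \<beta>') $ x" .
  moreover have "zmul b \<alpha> + zmul (- a) \<beta> = - \<beta>'" by (simp add: \<beta>'_def zmul_minus_left)
  ultimately show ?case unfolding SM by (simp add: \<alpha>'_def f'_def mult.commute)
qed

text \<open>\<open>\<rho> (T_mat 1)\<close> is diagonal, so both sides of the relation only acquire
  the factor e(-q(y)): the difference q(y) - q(y - \<alpha>') is absorbed by passing from \<beta>'
  to \<beta>' - \<alpha>', up to q(\<alpha>'), which goes into the phase. The equivalence serves T
  and its inverse at once.\<close>

lemma heisenberg_rel_T_iff:
  assumes M: "M \<in> SL2Z"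
  shows "heisenberg_rel (T_mat 1 ** M) \<longleftrightarrow> heisenberg_rel M"
proof -
  obtain a b c d where abcd: "M$1$1 = a" "M$1$2 = b" "M$2$1 = c" "M$2$2 = d" by blast
  have TM: "(T_mat 1 ** M)$1$1 = a + c" "(T_mat 1 ** M)$1$2 = b + d" "(T_mat 1 ** M)$2$1 = c" "(T_mat 1 ** M)$2$2 = d"
    by (simp_all add: mat2_mult abcd)
  have "\<rho> (T_mat 1 ** M) $ y $ (x + \<alpha>) * E (B \<beta> x) =
     E (of_int (- ((b + d) * d)) * q \<alpha> + of_int (- ((a + c) * c)) * q \<beta> + of_int ((b + d) * c) * B \<alpha> \<beta>) *
     E (B (zmul (- (b + d)) \<alpha> + zmul (a + c) \<beta>) (y - (zmul d \<alpha> + zmul (- c) \<beta>))) *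
     \<rho> (T_mat 1 ** M) $ (y - (zmul d \<alpha> + zmul (- c) \<beta>)) $ x \<longleftrightarrow>
     \<rho> M $ y $ (x + \<alpha>) * E (B \<beta> x) =
     E (of_int (- (b * d)) * q \<alpha> + of_int (- (a * c)) * q \<beta> + of_int (b * c) * B \<alpha> \<beta>) *
     E (B (zmul (- b) \<alpha> + zmul a \<beta>) (y - (zmul d \<alpha> + zmul (- c) \<beta>))) *
     \<rho> M $ (y - (zmul d \<alpha> + zmul (- c) \<beta>)) $ x" (is "?L = ?R \<longleftrightarrow> ?L' = ?R'") for \<alpha> \<beta> x y
  proof -
    define \<alpha>' where "\<alpha>' = zmul d \<alpha> + zmul (- c) \<beta>"
    define \<beta>' where "\<beta>' = zmul (- b) \<alpha> + zmul a \<beta>"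
    define f where "f = of_int (- (b * d)) * q \<alpha> + of_int (- (a * c)) * q \<beta> + of_int (b * c) * B \<alpha> \<beta>"
    define f' where "f' = of_int (- ((b + d) * d)) * q \<alpha> + of_int (- ((a + c) * c)) * q \<beta> + of_int ((b + d) * c) * B \<alpha> \<beta>"
    have \<beta>'': "zmul (- (b + d)) \<alpha> + zmul (a + c) \<beta> = \<beta>' + - \<alpha>'"
      by (simp add: \<beta>'_def \<alpha>'_def zmul_add_left zmul_minus_left zmul_diff_left)
    have L: "?L = E (- q y) * ?L'" using M by (simp only: rho_T_mult mult.assoc)
    have "?R = E (f' + B (\<beta>' + - \<alpha>') (y - \<alpha>') + - q (y - \<alpha>')) * \<rho> M $ (y - \<alpha>') $ x"
      by (simp only: rho_T_mult[OF M] \<beta>'' E_add mult.assoc flip: \<alpha>'_def f'_def)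
    also have "E (f' + B (\<beta>' + - \<alpha>') (y - \<alpha>') + - q (y - \<alpha>')) = E (- q y + (f + B \<beta>' (y - \<alpha>')))"
    proof (rule E_cong)
      have "f' + B (\<beta>' + - \<alpha>') (y - \<alpha>') + - q (y - \<alpha>') \<simeq>
          f' + (B \<beta>' (y - \<alpha>') + - B \<alpha>' (y - \<alpha>')) + - q (y - \<alpha>')"
        by (intro cg_add cg_refl cg_trans[OF B_add_left] B_minus_left)
      also have "\<dots> = f' + B \<beta>' (y - \<alpha>') - q y + q \<alpha>'"
        by (simp add: bil_def algebra_simps)
      also have "\<dots> \<simeq> f' + B \<beta>' (y - \<alpha>') - q y + (of_int (d\<^sup>2) * q \<alpha> + of_int ((- c)\<^sup>2) * q \<beta> + of_int (d * (- c)) * B \<alpha> \<beta>)"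
        unfolding \<alpha>'_def[of ] by (intro cg_add cg_refl q_lincomb)
      also have "\<dots> = - q y + (f + B \<beta>' (y - \<alpha>'))"
        by (simp add: f_def f'_def algebra_simps power2_eq_square)
      finally show "f' + B (\<beta>' + - \<alpha>') (y - \<alpha>') + - q (y - \<alpha>') \<simeq> - q y + (f + B \<beta>' (y - \<alpha>'))" .
    qed
    also have "E (- q y + (f + B \<beta>' (y - \<alpha>'))) * \<rho> M $ (y - \<alpha>') $ x = E (- q y) * ?R'"
      by (simp only: E_add mult.assoc flip: \<alpha>'_def \<beta>'_def f_def)
    finally have R: "?R = E (- q y) * ?R'" .
    show ?thesis unfolding L R by simp
  qed
  thus ?thesis unfolding heisenberg_rel_def TM abcd by (simp only:)
qed

lemma heisenberg_rel: "M \<in> SL2Z \<Longrightarrow> heisenberg_rel M"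
proof (induction rule: SL2Z_induct)
  case (T_inv M)
  have "T_mat 1 ** (T_mat (-1) ** M) = M" by (simp add: matrix_mul_assoc T_mat_add T_mat_0)
  thus ?case using heisenberg_rel_T_iff[of "T_mat (-1) ** M"] T_inv by simp
qed (auto intro: heisenberg_rel_one heisenberg_rel_S simp: heisenberg_rel_T_iff)

end


section \<open>A unit-invariant vector on isotropic elements that is killed by averaging\<close>

context disc_form
begin

lemma B_zmul_zmul_self: "B (zmul m x) (zmul n x) \<simeq> of_int (2 * m * n) * q x"
  using B_lincomb2[of m x 0 x n 0] by simp

lemma zmul_coprime_inj:
  assumes "coprime u (int (level q))" "zmul u x = zmul u y"
  shows "x = (y :: 'd)"
proof -
  have "zmul u (x - y) = 0" using assms(2) by (simp add: zmul_diff_right)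
  thus ?thesis using zmul_eq_0_coprime[OF _ level_zmul assms(1)] by force
qed

lemma prime_order:
  assumes "\<gamma> \<in> mul_image (level q div p)" "p dvd level q"
  shows "zmul (int p) (\<gamma> :: 'd) = 0"
proof -
  obtain r where "\<gamma> = zmul (int (level q div p)) r"
    using assms(1) by (auto simp: mul_image_def zmul_of_nat)
  hence "zmul (int p) \<gamma> = zmul (int p * int (level q div p)) r" by (simp add: zmul_mult)
  also have "int p * int (level q div p) = int (level q)" using assms(2) by (metis dvd_mult_div_cancel of_nat_mult)
  finally show ?thesis by (simp add: level_zmul)
qed

definition cyc :: "'d \<Rightarrow> 'd set" where
  "cyc x = range (\<lambda>k. zmul k x)"

lemma cyc_closed: "w \<in> cyc x \<Longrightarrow> zmul u w \<in> cyc x" "w \<in> cyc x \<Longrightarrow> w' \<in> cyc x \<Longrightarrow> w + w' \<in> cyc x"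
  "0 \<in> cyc x" "x \<in> cyc x" "w \<in> cyc x \<Longrightarrow> - w \<in> cyc x"
  unfolding cyc_def
  by (auto simp: image_iff simp flip: zmul_mult zmul_add_left zmul_minus_left)
    (metis zmul_0_left, metis zmul_1)

lemma sum_cyc_translate:
  assumes "w \<in> cyc x"
  shows "(\<Sum>w'\<in>cyc x. f (w + w')) = (\<Sum>w'\<in>cyc x. f w')"
  by (rule sum.reindex_bij_witness[of _ "\<lambda>y. y + - w" "\<lambda>y. w + y"])
    (use assms in \<open>auto intro!: cyc_closed simp del: add_uminus_conv_diff\<close>)

lemma sum_cyc_unit:
  assumes "coprime u (int (level q))"
  shows "(\<Sum>w\<in>cyc x. f (zmul u w)) = (\<Sum>w\<in>cyc x. f w)"
proof (rule sum.reindex_bij_betw)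
  have "inj_on (zmul u) (cyc x)"
    using zmul_coprime_inj[OF assms] by (auto intro: inj_onI)
  moreover from this have "zmul u ` cyc x = cyc x"
    by (intro card_subset_eq) (auto simp: card_image cyc_closed)
  ultimately show "bij_betw (zmul u) (cyc x) (cyc x)" by (simp add: bij_betw_def)
qed

text \<open>The condition with h says that x lies in the subgroup generated by the
  \<open>\<gamma> p\<close>, phrased through its orthogonal complement because
  \<open>row_translate\<close> needs it in this form. Annihilation by the product of the primes
  keeps each further \<open>\<gamma> p\<close> independent of the support in the inductive
  construction.\<close>

definition annihilated :: "nat set \<Rightarrow> (nat \<Rightarrow> 'd) \<Rightarrow> ('d \<Rightarrow> complex) \<Rightarrow> bool" where
  "annihilated P \<gamma> v \<longleftrightarrow> v 0 \<noteq> 0 \<and>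
    (\<forall>x. v x \<noteq> 0 \<longrightarrow> q x \<in> \<int> \<and> zmul (\<Prod>p\<in>P. int p) x = 0 \<and>
        (\<forall>h. (\<forall>p\<in>P. B h (\<gamma> p) \<in> \<int>) \<longrightarrow> B h x \<in> \<int>)) \<and>
    (\<forall>u x. coprime u (int (level q)) \<longrightarrow> v (zmul u x) = v x) \<and>
    (\<forall>p\<in>P. \<forall>x. (\<Sum>w\<in>cyc (\<gamma> p). v (x - w)) = 0)"

lemma annihilatedD:
  assumes "annihilated P \<gamma> v"
  shows "v 0 \<noteq> 0" "\<And>x. v x \<noteq> 0 \<Longrightarrow> q x \<in> \<int>"
    "\<And>x. v x \<noteq> 0 \<Longrightarrow> zmul (\<Prod>p\<in>P. int p) x = 0"
    "\<And>x h. v x \<noteq> 0 \<Longrightarrow> (\<And>p. p \<in> P \<Longrightarrow> B h (\<gamma> p) \<in> \<int>) \<Longrightarrow> B h x \<in> \<int>"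
    "\<And>u x. coprime u (int (level q)) \<Longrightarrow> v (zmul u x) = v x"
    "\<And>p x. p \<in> P \<Longrightarrow> (\<Sum>w\<in>cyc (\<gamma> p). v (x - w)) = 0"
  using assms unfolding annihilated_def by simp_all

text \<open>Induction over the primes. With G generated by the new \<open>\<gamma> p\<close>, v is
  replaced by |G| v minus the sum of its translates by G. This is killed by averaging over G, and
  averaging over the earlier groups commutes with the construction. As G meets the support of v only
  in 0, the value at 0 is multiplied by |G| - 1 > 0.\<close>

lemma annihilated_vector_exists:
  fixes \<gamma> :: "nat \<Rightarrow> 'd"
  assumes "finite P" "\<And>p. p \<in> P \<Longrightarrow> prime p"
    and "\<And>p. p \<in> P \<Longrightarrow> zmul (int p) (\<gamma> p) = 0 \<and> \<gamma> p \<noteq> 0 \<and> q (\<gamma> p) \<in> \<int>"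
  shows "\<exists>v. annihilated P \<gamma> v"
  using assms
proof (induction P rule: finite_induct)
  case empty
  have "zmul u x = 0 \<longleftrightarrow> x = 0" if "coprime u (int (level q))" for u and x :: 'd
    using zmul_coprime_inj[OF that, of x 0] by auto
  thus ?case unfolding annihilated_def
    by (intro exI[of _ "\<lambda>x. if x = 0 then 1 else 0"] conjI allI impI)
      (simp_all add: q_0 B_0_right split: if_splits)
next
  case (insert p P)
  from insert obtain v where "annihilated P \<gamma> v" by blast
  note v = annihilatedD[OF this]
  define Pi where "Pi = (\<Prod>p\<in>P. int p)"
  define G where "G = cyc (\<gamma> p)"
  have p: "prime p" and \<gamma>: "zmul (int p) (\<gamma> p) = 0" "\<gamma> p \<noteq> 0" "q (\<gamma> p) \<in> \<int>"
    using insert.prems by auto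
  have "coprime (int p') (int p)" if "p' \<in> P" for p'
    using that insert.hyps(2) p insert.prems(1) by (metis coprime_int_iff insertCI primes_coprime)
  hence cop: "coprime Pi (int p)" unfolding Pi_def by (rule prod_coprime_left)
  have G_ord: "zmul (int p) w = 0" if "w \<in> G" for w
    using that \<gamma>(1) by (auto simp: G_def cyc_def zmul_commute[of "int p"])
  have vG: "v w = 0" if "w \<in> G" "w \<noteq> 0" for w
    using v(3)[of w] that zmul_eq_0_coprime[OF _ G_ord cop] by (auto simp: Pi_def)
  define v' where "v' x = of_nat (card G) * v x - (\<Sum>w\<in>G. v (x - w))" for x
  have supp: "q x \<in> \<int> \<and> zmul (int p * Pi) x = 0 \<and>
      (\<forall>h. (\<forall>p'\<in>insert p P. B h (\<gamma> p') \<in> \<int>) \<longrightarrow> B h x \<in> \<int>)" if "v' x \<noteq> 0" for x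
  proof -
    have "\<exists>w\<in>G. v (x - w) \<noteq> 0"
    proof (rule ccontr)
      assume *: "\<not> (\<exists>w\<in>G. v (x - w) \<noteq> 0)"
      have "v x = v (x - 0)" by simp
      also have "\<dots> = 0" using * cyc_closed(3)[of "\<gamma> p"] unfolding G_def by blast
      finally show False using that * unfolding v'_def by simp
    qed
    then obtain w y where w: "w \<in> G" "x = y + w" "v y \<noteq> 0" by (metis diff_add_cancel)
    obtain k where k: "w = zmul k (\<gamma> p)" using w(1) by (auto simp: G_def cyc_def)
    have Byw: "B y w \<in> \<int>" using B_coprime[OF v(3)[OF w(3)] G_ord[OF w(1)]] cop by (simp add: Pi_def)
    have "q w \<in> \<int>"
      using cg_Ints[OF q_zmul[of k "\<gamma> p"]] \<gamma>(3) unfolding k by (metis Ints_mult Ints_of_int)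
    hence "q x \<in> \<int>" unfolding w(2) q_add using Byw v(2)[OF w(3)] by simp
    moreover have "zmul (int p * Pi) x = 0"
      using v(3)[OF w(3)] G_ord[OF w(1)]
      by (metis Pi_def w(2) zmul_add_right zmul_mult mult.commute zmul_0_right add_0)
    moreover have "B h x \<in> \<int>" if "\<forall>p'\<in>insert p P. B h (\<gamma> p') \<in> \<int>" for h
    proof -
      have "B h x \<simeq> B h y + of_int k * B h (\<gamma> p)"
        unfolding w(2) k by (intro cg_trans[OF B_add_right] cg_add B_zmul_right cg_refl)
      moreover have "B h y + of_int k * B h (\<gamma> p) \<in> \<int>"
        using that v(4)[OF w(3), of h] by (intro Ints_add Ints_mult) auto
      ultimately show ?thesis by (simp add: cg_Ints)
    qed
    ultimately show ?thesis by blast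
  qed
  have v'0: "v' 0 \<noteq> 0"
  proof -
    have "0 \<in> G" "\<gamma> p \<in> G" by (auto simp: G_def cyc_closed)
    hence "card {0, \<gamma> p} \<le> card G" by (intro card_mono) auto
    hence "card G \<ge> 2" using \<gamma>(2) by simp
    have "(\<Sum>w\<in>G. v (0 - w)) = (\<Sum>w\<in>G. if w = 0 then v 0 else 0)"
    proof (rule sum.cong)
      fix w assume "w \<in> G"
      hence "- w \<in> G" by (simp add: G_def cyc_closed)
      thus "v (0 - w) = (if w = 0 then v 0 else 0)" using vG[of "- w"] by auto
    qed simp
    also have "\<dots> = v 0" using \<open>0 \<in> G\<close> by simp
    finally have "v' 0 = of_nat (card G - 1) * v 0"
      using \<open>card G \<ge> 2\<close> by (simp add: v'_def of_nat_diff algebra_simps)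
    thus ?thesis using v(1) \<open>card G \<ge> 2\<close> by simp
  qed
  have v'u: "v' (zmul u x) = v' x" if u: "coprime u (int (level q))" for u x
  proof -
    have "(\<Sum>w\<in>G. v (zmul u x - w)) = (\<Sum>w\<in>G. v (zmul u x - zmul u w))"
      using sum_cyc_unit[OF u, of "\<lambda>w. v (zmul u x - w)"] by (simp add: G_def)
    also have "\<dots> = (\<Sum>w\<in>G. v (x - w))" by (simp add: v(5)[OF u] flip: zmul_diff_right)
    finally show ?thesis by (simp add: v'_def v(5)[OF u])
  qed
  have v'p: "(\<Sum>w\<in>G. v' (x - w)) = 0" for x
  proof -
    have "(\<Sum>w\<in>G. \<Sum>w'\<in>G. v (x - w - w')) = (\<Sum>w\<in>G. \<Sum>w'\<in>G. v (x - w'))"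
      using sum_cyc_translate[of _ "\<gamma> p" "\<lambda>w'. v (x - w')"]
      by - (rule sum.cong, simp_all add: G_def diff_diff_eq)
    thus ?thesis by (simp add: v'_def sum_subtractf sum_distrib_left)
  qed
  have v'P: "(\<Sum>w\<in>cyc (\<gamma> p'). v' (x - w)) = 0" if "p' \<in> P" for p' x
  proof -
    have "(\<Sum>w\<in>cyc (\<gamma> p'). \<Sum>w'\<in>G. v (x - w - w')) = (\<Sum>w'\<in>G. \<Sum>w\<in>cyc (\<gamma> p'). v (x - w' - w))"
      by (subst sum.swap) (simp add: algebra_simps)
    also have "\<dots> = 0" by (simp add: v(6)[OF that])
    finally show ?thesis
      by (simp add: v'_def sum_subtractf v(6)[OF that] flip: sum_distrib_left)
  qed
  show ?case unfolding annihilated_def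
  proof (intro exI[of _ v'] conjI allI impI ballI)
    show "zmul (\<Prod>p\<in>insert p P. int p) x = 0" if "v' x \<noteq> 0" for x
      using supp[OF that] insert.hyps by (simp add: Pi_def)
  qed (use supp v'0 v'u v'p v'P in \<open>auto simp: G_def\<close>)
qed

end


section \<open>Rows of the Weil representation\<close>

context weil_rep
begin

definition wrow :: "('d \<Rightarrow> complex) \<Rightarrow> int^2^2 \<Rightarrow> 'd \<Rightarrow> complex" where
  "wrow v M x = (\<Sum>y\<in>UNIV. v y * \<rho> M $ y $ x)"

text \<open>An applicable form of the relation: the transformed pair (\<alpha>', \<beta>') may be
  given in simplified form, and the phase f only modulo 1.\<close>

lemma heisenberg:
  assumes "M \<in> SL2Z"
    and "zmul (M$2$2) \<alpha> + zmul (- (M$2$1)) \<beta> = \<alpha>'" "zmul (- (M$1$2)) \<alpha> + zmul (M$1$1) \<beta> = \<beta>'"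
    and "of_int (- (M$1$2 * M$2$2)) * q \<alpha> + of_int (- (M$1$1 * M$2$1)) * q \<beta>
      + of_int (M$1$2 * M$2$1) * B \<alpha> \<beta> \<simeq> f"
  shows "\<rho> M $ y $ (x + \<alpha>) * E (B \<beta> x) = E f * E (B \<beta>' (y - \<alpha>')) * \<rho> M $ (y - \<alpha>') $ x"
  using heisenberg_rel[OF assms(1)] unfolding heisenberg_rel_def E_cong[OF assms(4), symmetric]
    assms(2)[symmetric] assms(3)[symmetric] by blast

text \<open>The pair \<alpha> = c h, \<beta> = d h is the one that is sent to \<alpha>' = 0,
  \<beta>' = h. What remains is the character (h, y), trivial on the support of v. This
  quasi-periodicity both confines the support of the row and allows shifts by c h to be
  undone.\<close>

lemma row_translate:
  assumes M: "M \<in> SL2Z" and h: "\<And>y. v y \<noteq> 0 \<Longrightarrow> B h y \<in> \<int>"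
  shows "wrow v M (x + zmul (M$2$1) h) * E (B (zmul (M$2$2) h) x) =
    E (of_int (- (M$2$1 * M$2$2)) * q h) * wrow v M x"
proof -
  obtain a b c d where abcd: "M$1$1 = a" "M$1$2 = b" "M$2$1 = c" "M$2$2 = d" by blast
  have det: "a * d = 1 + b * c" using M by (simp add: SL2Z_iff abcd)
  have "\<rho> M $ y $ (x + zmul c h) * E (B (zmul d h) x) =
      E (of_int (- (c * d)) * q h) * E (B h (y - 0)) * \<rho> M $ (y - 0) $ x" for y
  proof (rule heisenberg[OF M], unfold abcd)
    show "zmul d (zmul c h) + zmul (- c) (zmul d h) = 0"
      by (simp add: zmul_minus_left flip: zmul_mult) (simp add: mult.commute)
    show "zmul (- b) (zmul c h) + zmul a (zmul d h) = h"
      by (simp add: det zmul_add_left zmul_minus_left flip: zmul_mult)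
    have "of_int (- (b * d)) * q (zmul c h) + of_int (- (a * c)) * q (zmul d h) + of_int (b * c) * B (zmul c h) (zmul d h)
        \<simeq> of_int (- (b * d)) * (of_int (c\<^sup>2) * q h) + of_int (- (a * c)) * (of_int (d\<^sup>2) * q h)
          + of_int (b * c) * (of_int (2 * c * d) * q h)"
      by (intro cg_add cg_mult q_zmul B_zmul_zmul_self)
    also have "\<dots> = of_int (- (b * d) * c\<^sup>2 - (a * d) * (c * d) + b * c * (2 * c * d)) * q h"
      by (simp add: algebra_simps power2_eq_square)
    also have "- (b * d) * c\<^sup>2 - (a * d) * (c * d) + b * c * (2 * c * d) = - (c * d)"
      unfolding det by (simp add: algebra_simps power2_eq_square)
    finally show "of_int (- (b * d)) * q (zmul c h) + of_int (- (a * c)) * q (zmul d h)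
        + of_int (b * c) * B (zmul c h) (zmul d h) \<simeq> of_int (- (c * d)) * q h" .
  qed
  hence *: "\<rho> M $ y $ (x + zmul c h) * E (B (zmul d h) x) =
      E (of_int (- (c * d)) * q h) * E (B h y) * \<rho> M $ y $ x" for y by simp
  have "wrow v M (x + zmul c h) * E (B (zmul d h) x) =
      (\<Sum>y\<in>UNIV. v y * (\<rho> M $ y $ (x + zmul c h) * E (B (zmul d h) x)))"
    by (simp add: wrow_def sum_distrib_right mult.assoc)
  also have "\<dots> = (\<Sum>y\<in>UNIV. E (of_int (- (c * d)) * q h) * (v y * \<rho> M $ y $ x))"
  proof (rule sum.cong)
    fix y
    show "v y * (\<rho> M $ y $ (x + zmul c h) * E (B (zmul d h) x)) =
        E (of_int (- (c * d)) * q h) * (v y * \<rho> M $ y $ x)"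
      using h[of y] E_eq_1_iff[of "B h y"] unfolding * by (cases "v y = 0") auto
  qed simp
  finally show ?thesis by (simp add: abcd wrow_def sum_distrib_left)
qed

text \<open>Here \<alpha> = -a \<gamma>, \<beta> = -b \<gamma> is sent to \<alpha>' = -\<gamma>,
  \<beta>' = 0, so that a shift of the row index becomes a shift and a character in the column
  index. Isotropy of \<gamma> removes the phase.\<close>

lemma rho_isotropic:
  assumes M: "M \<in> SL2Z" and \<gamma>: "q \<gamma> \<in> \<int>"
  shows "\<rho> M $ (y + \<gamma>) $ x = \<rho> M $ y $ (x - zmul (M$1$1) \<gamma>) * E (B (zmul (- (M$1$2)) \<gamma>) x)"
proof -
  obtain a b c d where abcd: "M$1$1 = a" "M$1$2 = b" "M$2$1 = c" "M$2$2 = d" by blast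
  have det: "a * d = 1 + b * c" using M by (simp add: SL2Z_iff abcd)
  have "\<rho> M $ y $ (x + zmul (- a) \<gamma>) * E (B (zmul (- b) \<gamma>) x) =
      E 0 * E (B 0 (y - (- \<gamma>))) * \<rho> M $ (y - (- \<gamma>)) $ x"
  proof (rule heisenberg[OF M], unfold abcd)
    have "zmul d (zmul (- a) \<gamma>) + zmul (- c) (zmul (- b) \<gamma>) = zmul (- (a * d) + b * c) \<gamma>"
      by (simp only: zmul_add_left flip: zmul_mult) (simp add: mult.commute)
    thus "zmul d (zmul (- a) \<gamma>) + zmul (- c) (zmul (- b) \<gamma>) = - \<gamma>"
      by (simp add: det zmul_minus_left)
    show "zmul (- b) (zmul (- a) \<gamma>) + zmul a (zmul (- b) \<gamma>) = 0"
      by (simp add: zmul_minus_left zmul_minus_right zmul_commute[of b])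
    have "of_int (- (b * d)) * q (zmul (- a) \<gamma>) + of_int (- (a * c)) * q (zmul (- b) \<gamma>) + of_int (b * c) * B (zmul (- a) \<gamma>) (zmul (- b) \<gamma>)
        \<simeq> of_int (- (b * d)) * (of_int ((- a)\<^sup>2) * q \<gamma>) + of_int (- (a * c)) * (of_int ((- b)\<^sup>2) * q \<gamma>)
          + of_int (b * c) * (of_int (2 * (- a) * (- b)) * q \<gamma>)"
      by (intro cg_add cg_mult q_zmul B_zmul_zmul_self)
    also have "\<dots> \<simeq> 0" unfolding cg_0_iff using \<gamma> by (intro Ints_add Ints_mult Ints_of_int)
    finally show "of_int (- (b * d)) * q (zmul (- a) \<gamma>) + of_int (- (a * c)) * q (zmul (- b) \<gamma>)
        + of_int (b * c) * B (zmul (- a) \<gamma>) (zmul (- b) \<gamma>) \<simeq> 0" .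
  qed
  moreover have "E (B 0 (y + \<gamma>)) = 1" using B_0_left by (simp add: E_eq_1_iff)
  ultimately show ?thesis by (simp add: abcd zmul_minus_left)
qed

lemma Gamma0_SL2Z: "M \<in> Gamma0 N \<Longrightarrow> M \<in> SL2Z"
  by (simp add: Gamma0_def)

lemma Gamma0_coprime:
  assumes "M \<in> Gamma0 N"
  shows "coprime (M$1$1) (int N)" "coprime (M$2$2) (int N)"
  using SL2Z_coprime[OF Gamma0_SL2Z[OF assms]] assms
  by (auto simp: Gamma0_def elim: coprime_divisors[rotated 2] simp: coprime_commute)

lemma zmul_level_dvd: "int (level q) dvd n \<Longrightarrow> zmul n (x :: 'd) = 0"
  using level_zmul by (auto elim!: dvdE simp: mult.commute[of "int (level q)"] zmul_mult)

text \<open>As N divides c, the pair (0, h) is sent to (0, a h). Comparing the characters at a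
  non-zero entry gives (h, x) = (h, a y) for every h, and non-degeneracy concludes.\<close>

lemma rho_Gamma0_nonzero:
  assumes M: "M \<in> Gamma0 (level q)" and nz: "\<rho> M $ y $ x \<noteq> 0"
  shows "x = zmul (M$1$1) y"
proof -
  obtain a b c d where abcd: "M$1$1 = a" "M$1$2 = b" "M$2$1 = c" "M$2$2 = d" by blast
  have c: "int (level q) dvd c" using M by (simp add: Gamma0_def abcd)
  have "B h (x - zmul a y) \<in> \<int>" for h
  proof -
    have "\<rho> M $ y $ (x + 0) * E (B h x) = E 0 * E (B (zmul a h) (y - 0)) * \<rho> M $ (y - 0) $ x"
    proof (rule heisenberg[OF Gamma0_SL2Z[OF M]], unfold abcd)
      show "zmul d 0 + zmul (- c) h = 0" using c by (simp add: zmul_minus_left zmul_level_dvd)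
      show "zmul (- b) 0 + zmul a h = zmul a h" by simp
      obtain l where l: "c = int (level q) * l" using c ..
      have "of_int (- (a * c)) * q h = of_int (- (a * l)) * (of_nat (level q) * q h)"
        by (simp add: l)
      also have "\<dots> \<in> \<int>" by (intro Ints_mult Ints_of_int level_q)
      finally have acq: "of_int (- (a * c)) * q h \<in> \<int>" .
      show "of_int (- (b * d)) * q 0 + of_int (- (a * c)) * q h + of_int (b * c) * B 0 h \<simeq> 0"
        unfolding cg_0_iff
        by (intro Ints_add[OF Ints_add[OF _ acq]]) (intro Ints_mult Ints_of_int q_0 B_0_left)+
    qed
    hence "E (B h x) = E (B (zmul a h) y)" using nz by simp
    hence "E (B h x - B (zmul a h) y) = 1"
      using E_add[of "B h x - B (zmul a h) y" "B (zmul a h) y"] by simp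
    hence 1: "B h x \<simeq> B (zmul a h) y" by (simp add: E_eq_1_iff cg_def)
    have "B h (x + - zmul a y) \<simeq> B h x + - (of_int a * B h y)"
      by (intro cg_trans[OF B_add_right] cg_add cg_trans[OF B_minus_right] cg_minus B_zmul_right cg_refl)
    also have "\<dots> \<simeq> of_int a * B h y + - (of_int a * B h y)"
      by (intro cg_add cg_refl cg_trans[OF 1] B_zmul_left)
    finally show ?thesis by (simp add: cg_def)
  qed
  hence "x - zmul a y = 0" by (rule B_nondegenerate)
  thus ?thesis by (simp add: abcd)
qed

lemma rho_Gamma0_isotropic:
  assumes M: "M \<in> Gamma0 (level q)" and y: "q y \<in> \<int>"
  shows "\<rho> M $ y $ zmul (M$1$1) y = \<rho> M $ 0 $ 0"
proof -
  have "B (zmul (- (M$1$2)) y) (zmul (M$1$1) y) \<in> \<int>"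
    using cg_Ints[OF B_zmul_zmul_self] y by (metis Ints_mult Ints_of_int)
  thus ?thesis
    using rho_isotropic[OF Gamma0_SL2Z[OF M] y, of 0 "zmul (M$1$1) y"] by (simp add: flip: E_eq_1_iff)
qed

lemma weil_character_eq:
  assumes M: "M \<in> Gamma0 (level q)"
  shows "weil_character \<rho> M = \<rho> M $ 0 $ 0"
  unfolding weil_character_def
proof (rule the_equality)
  have "\<rho> M $ y $ 0 = 0" if "y \<noteq> 0" for y
    using rho_Gamma0_nonzero[OF M, of y 0] zmul_coprime_inj[OF Gamma0_coprime(1)[OF M], of y 0] that by auto
  thus "\<rho> M *v axis 0 1 = \<rho> M $ 0 $ 0 *s axis 0 1"
    unfolding vec_eq_iff matrix_vector_axis by (simp add: axis_def)
  fix z assume "\<rho> M *v axis 0 1 = z *s axis 0 1"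
  hence "(\<rho> M *v axis 0 1) $ 0 = (z *s axis 0 1) $ 0" by simp
  thus "z = \<rho> M $ 0 $ 0" unfolding matrix_vector_axis by (simp add: axis_def)
qed

text \<open>\<open>\<rho> M\<close> permutes the basis, up to scalars, by multiplication with a
  unit, and at isotropic indices the scalar is always the character value. A vector on isotropic
  elements that is invariant under units is therefore an eigenvector.\<close>

lemma row_Gamma0:
  assumes M: "M \<in> Gamma0 (level q)" and iso: "\<And>x. v x \<noteq> 0 \<Longrightarrow> q x \<in> \<int>"
    and unit: "\<And>u x. coprime u (int (level q)) \<Longrightarrow> v (zmul u x) = v x"
  shows "wrow v M x = weil_character \<rho> M * v x"
proof -
  obtain a b c d where abcd: "M$1$1 = a" "M$1$2 = b" "M$2$1 = c" "M$2$2 = d" by blast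
  have det: "a * d = 1 + b * c" using Gamma0_SL2Z[OF M] by (simp add: SL2Z_iff abcd)
  have "int (level q) dvd b * c" using M by (simp add: Gamma0_def abcd)
  hence ad: "zmul a (zmul d x) = x"
    by (simp add: det zmul_add_left zmul_level_dvd flip: zmul_mult)
  have "v y * \<rho> M $ y $ x = (if y = zmul d x then weil_character \<rho> M * v x else 0)" for y
  proof (cases "y = zmul d x")
    case True
    have "v y = v x" unfolding True using unit Gamma0_coprime(2)[OF M] by (simp add: abcd)
    moreover have "\<rho> M $ y $ x = \<rho> M $ 0 $ 0" if "v y \<noteq> 0"
      using rho_Gamma0_isotropic[OF M iso[OF that]] True ad by (simp add: abcd)
    ultimately show ?thesis using True by (auto simp: weil_character_eq[OF M])
  next
    case False
    have "\<rho> M $ y $ x = 0"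
    proof (rule ccontr)
      assume "\<rho> M $ y $ x \<noteq> 0"
      hence "zmul a (zmul d x) = zmul a y" using rho_Gamma0_nonzero[OF M] ad by (simp add: abcd)
      thus False using zmul_coprime_inj[OF Gamma0_coprime(1)[OF M]] False by (simp add: abcd)
    qed
    thus ?thesis using False by simp
  qed
  thus ?thesis by (simp add: wrow_def)
qed

lemma row_mult:
  assumes "M \<in> SL2Z" "M' \<in> SL2Z"
  shows "wrow v (M ** M') x = (\<Sum>z\<in>UNIV. wrow v M z * \<rho> M' $ z $ x)"
proof -
  have "wrow v (M ** M') x = (\<Sum>y\<in>UNIV. \<Sum>z\<in>UNIV. v y * \<rho> M $ y $ z * \<rho> M' $ z $ x)"
    by (simp add: wrow_def rho_mult[OF assms] sum_distrib_left mult.assoc)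
  also have "\<dots> = (\<Sum>z\<in>UNIV. \<Sum>y\<in>UNIV. v y * \<rho> M $ y $ z * \<rho> M' $ z $ x)" by (rule sum.swap)
  finally show ?thesis by (simp add: wrow_def sum_distrib_right)
qed

lemma row_T:
  assumes "M \<in> SL2Z"
  shows "wrow v (M ** T_mat (int t)) x = wrow v M x * E (- of_nat t * q x)"
proof -
  have "wrow v (M ** T_mat (int t)) x = (\<Sum>z\<in>UNIV. if z = x then wrow v M x * E (- of_nat t * q x) else 0)"
    unfolding row_mult[OF assms T_SL2Z] by (intro sum.cong) (auto simp: rho_T_nat)
  thus ?thesis by simp
qed

end


section \<open>Vanishing and support of the rows of the chosen vector\<close>

locale weil_vector = weil_rep q \<rho>
  for q :: "'d::{finite,ab_group_add} \<Rightarrow> rat" and \<rho> :: "int^2^2 \<Rightarrow> 'd group_alg_mat" +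
  fixes \<gamma> :: "nat \<Rightarrow> 'd" and v :: "'d \<Rightarrow> complex"
  assumes \<gamma>: "\<And>p. prime p \<Longrightarrow> p dvd level q \<Longrightarrow> \<gamma> p \<in> mul_image (level q div p) \<and> \<gamma> p \<noteq> 0 \<and> q (\<gamma> p) \<in> \<int>"
    and annihilated: "annihilated {p. prime p \<and> p dvd level q} \<gamma> v"
begin

lemmas v_props = annihilatedD[OF annihilated]

lemma \<gamma>_order: "prime p \<Longrightarrow> p dvd level q \<Longrightarrow> zmul (int p) (\<gamma> p) = 0"
  using \<gamma> prime_order by blast

text \<open>Translating v by w = k \<open>\<gamma> p\<close> moves the index x by -a w and adds a
  character. This shift equals c (k h), so \<open>row_translate\<close> undoes it, and the condition
  on x makes the two characters agree. Thus all translates of v have the same row value at x, while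
  their sum is zero.\<close>

lemma row_eq_0:
  assumes M: "M \<in> SL2Z" and p: "prime p" "p dvd level q"
    and h: "zmul (M$2$1) h = - zmul (M$1$1) (\<gamma> p)" "of_int (M$2$1) * q h \<in> \<int>"
      "\<And>p'. prime p' \<Longrightarrow> p' dvd level q \<Longrightarrow> B h (\<gamma> p') \<in> \<int>"
    and x: "B (zmul (M$1$2) (\<gamma> p) + zmul (M$2$2) h) x \<in> \<int>"
  shows "wrow v M x = 0"
proof -
  obtain a b c d where abcd: "M$1$1 = a" "M$1$2 = b" "M$2$1 = c" "M$2$2 = d" by blast
  note h = h[unfolded abcd] and x = x[unfolded abcd]
  have hv: "B h y \<in> \<int>" if "v y \<noteq> 0" for y using v_props(4)[OF that, of h] h(3) by simp
  define G where "G = cyc (\<gamma> p)"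
  have "(\<Sum>y\<in>UNIV. v y * \<rho> M $ (y + w) $ x) = wrow v M x" if "w \<in> G" for w
  proof -
    obtain k where k: "w = zmul k (\<gamma> p)" using \<open>w \<in> G\<close> by (auto simp: G_def cyc_def)
    have qw: "q w \<in> \<int>"
      using cg_Ints[OF q_zmul] \<gamma>[OF p] unfolding k by (metis Ints_mult Ints_of_int)
    have aw: "x - zmul a w = x + zmul c (zmul k h)"
      unfolding k by (subst zmul_commute, subst (2) zmul_commute) (simp add: h(1) zmul_minus_right)
    have "wrow v M (x - zmul a w) * E (B (zmul d (zmul k h)) x) = E (of_int (- (c * d)) * q (zmul k h)) * wrow v M x"
      unfolding aw unfolding abcd[symmetric]
    proof (rule row_translate[OF M])
      fix y assume "v y \<noteq> 0"
      thus "B (zmul k h) y \<in> \<int>"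
        using cg_Ints[OF B_zmul_left] hv by (metis Ints_mult Ints_of_int)
    qed
    also have "E (of_int (- (c * d)) * q (zmul k h)) = 1"
      unfolding E_eq_1_iff
    proof (rule cg_Ints[THEN iffD2])
      show "of_int (- (c * d)) * q (zmul k h) \<simeq> of_int (- (c * d)) * (of_int (k\<^sup>2) * q h)"
        by (intro cg_mult q_zmul)
      have "of_int (- (c * d)) * (of_int (k\<^sup>2) * q h) = of_int (- (d * k\<^sup>2)) * (of_int c * q h)" by simp
      also have "\<dots> \<in> \<int>" by (intro Ints_mult h Ints_of_int)
      finally show "of_int (- (c * d)) * (of_int (k\<^sup>2) * q h) \<in> \<int>" .
    qed
    finally have 1: "wrow v M (x - zmul a w) * E (B (zmul d (zmul k h)) x) = wrow v M x" by simp
    have "E (B (zmul (- b) w) x) = E (B (zmul d (zmul k h)) x)"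
    proof (rule E_cong)
      have "B (zmul (- b) w) x - B (zmul d (zmul k h)) x \<simeq>
          of_int (- b) * (of_int k * B (\<gamma> p) x) - of_int d * (of_int k * B h x)"
        unfolding k by (intro cg_diff cg_trans[OF B_zmul_left cg_mult] B_zmul_left)
      also have "\<dots> = of_int (- k) * (of_int b * B (\<gamma> p) x + of_int d * B h x)" by (simp add: algebra_simps)
      also have "\<dots> \<simeq> of_int (- k) * B (zmul b (\<gamma> p) + zmul d h) x"
        by (intro cg_mult cg_sym[OF B_lincomb_left])
      also have "\<dots> \<simeq> 0" unfolding cg_0_iff using x by (intro Ints_mult Ints_of_int)
      finally show "B (zmul (- b) w) x \<simeq> B (zmul d (zmul k h)) x" by (simp add: cg_def)
    qed
    hence "(\<Sum>y\<in>UNIV. v y * \<rho> M $ (y + w) $ x) =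
        (\<Sum>y\<in>UNIV. v y * (\<rho> M $ y $ (x - zmul a w) * E (B (zmul d (zmul k h)) x)))"
      using rho_isotropic[OF M qw] by (simp add: abcd)
    also have "\<dots> = wrow v M (x - zmul a w) * E (B (zmul d (zmul k h)) x)"
      by (simp add: wrow_def sum_distrib_right mult.assoc)
    finally show ?thesis using 1 by simp
  qed
  hence "of_nat (card G) * wrow v M x = (\<Sum>w\<in>G. \<Sum>y\<in>UNIV. v y * \<rho> M $ (y + w) $ x)" by simp
  also have "\<dots> = (\<Sum>w\<in>G. \<Sum>y\<in>UNIV. v (y - w) * \<rho> M $ y $ x)"
  proof (rule sum.cong[OF refl])
    fix w
    show "(\<Sum>y\<in>UNIV. v y * \<rho> M $ (y + w) $ x) = (\<Sum>y\<in>UNIV. v (y - w) * \<rho> M $ y $ x)"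
      by (rule sum.reindex_bij_witness[of _ "\<lambda>y. y - w" "\<lambda>y. y + w"]) auto
  qed
  also have "\<dots> = (\<Sum>y\<in>UNIV. (\<Sum>w\<in>G. v (y - w)) * \<rho> M $ y $ x)"
    by (subst sum.swap) (simp add: sum_distrib_right)
  also have "\<dots> = 0" using v_props(6) p by (simp add: G_def)
  finally have "card G = 0 \<or> wrow v M x = 0" by simp
  moreover have "G \<noteq> {}" using cyc_closed(3) by (auto simp: G_def)
  ultimately show ?thesis by simp
qed

text \<open>Otherwise the p-part of \<open>dd\<close> divides p^m with m = \<nu>-1-j. A p-primary
  solution h of c h = -a \<open>\<gamma> p\<close> can be chosen as a p^m-fold, so that
  \<open>zmul b (\<gamma> p) + zmul d h\<close> is one as well and pairs integrally with x; then
  \<open>row_eq_0\<close> applies.\<close>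

lemma row_order:
  assumes M: "M \<in> SL2Z" and p: "prime p" "p dvd level q"
    and \<nu>: "\<nu> = multiplicity p (level q)"
    and j: "int p ^ j dvd M$2$1" "\<not> int p ^ Suc j dvd M$2$1" "j + 2 \<le> \<nu> \<or> \<nu> = 1 \<and> j = 0"
    and x: "wrow v M x \<noteq> 0" "zmul (int dd) x = 0" "dd > 0"
  shows "p ^ (\<nu> - j) dvd dd"
proof (rule ccontr)
  assume ndvd: "\<not> p ^ (\<nu> - j) dvd dd"
  obtain a b c d where abcd: "M$1$1 = a" "M$1$2 = b" "M$2$1 = c" "M$2$2 = d" by blast
  define m where "m = \<nu> - 1 - j"
  have m: "\<nu> - 1 = j + m" "\<nu> = Suc (j + m)" using j(3) by (auto simp: m_def)
  obtain N' where N': "level q = p ^ \<nu> * N'" "\<not> p dvd N'"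
    using multiplicity_decompose'[of "level q" p] level_pos p(1) unfolding \<nu>
    by (metis not_prime_unit gr_implies_not0)
  have Ndiv: "level q div p = p ^ (j + m) * N'" using N' p(1) prime_gt_0_nat[OF p(1)] by (simp add: m(2))
  obtain r0 where r0: "\<gamma> p = zmul (int (level q div p)) r0"
    using \<gamma>[OF p] by (auto simp: mul_image_def zmul_of_nat)
  \<comment> \<open>Multiplication by the part of the level prime to p makes r p-primary, and
    \<open>\<gamma> p\<close> is still p^(\<nu>-1) r.\<close>
  define r where "r = zmul (int N') r0"
  define P where "P = int p"
  have \<gamma>p: "\<gamma> p = zmul (P ^ (j + m)) r"
    by (simp add: r0 Ndiv r_def P_def flip: zmul_mult)
  have r_ord: "zmul (P ^ \<nu>) r = 0"
    using level_zmul[of r0] unfolding N'(1) r_def by (simp add: P_def flip: zmul_mult)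
  have qr: "of_int (P ^ \<nu>) * q r \<in> \<int>"
  proof -
    have "of_int (P ^ \<nu>) * q r \<simeq> of_int (P ^ \<nu>) * (of_int ((int N')\<^sup>2) * q r0)"
      unfolding r_def by (intro cg_mult q_zmul)
    also have "\<dots> = of_nat N' * (of_nat (level q) * q r0)"
      by (simp add: N'(1) P_def power2_eq_square)
    also have "\<dots> \<simeq> 0" unfolding cg_0_iff by (intro Ints_mult level_q) simp
    finally show ?thesis by (simp add: cg_0_iff)
  qed
  obtain u where u: "c = P ^ j * u" using j(1) unfolding abcd P_def by (auto elim: dvdE)
  have "\<not> P dvd u"
  proof
    assume "P dvd u"
    hence "P ^ j * P dvd c" unfolding u by (intro mult_dvd_mono) auto
    thus False using j(2) by (simp add: abcd P_def mult.commute)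
  qed
  hence "coprime u P" using p(1) unfolding P_def
    by (metis coprime_commute prime_imp_coprime prime_nat_int_transfer)
  then obtain u' l where u': "u * u' + P * l = 1"
    using bezout_int[of u P] by (metis coprime_iff_gcd_eq_1 mult.commute)
  \<comment> \<open>u' inverts u modulo p, and \<open>\<gamma> p\<close> has order p; hence c h = -a
    u u' p^(j+m) r = -a \<open>\<gamma> p\<close>.\<close>
  define n where "n = - (a * u' * P ^ m)"
  define h where "h = zmul n r"
  have 1: "zmul c h = - zmul a (\<gamma> p)"
  proof -
    have "zmul (u * u' + P * l) (\<gamma> p) = zmul (u * u') (\<gamma> p)"
      using \<gamma>_order[OF p] by (simp add: zmul_add_left P_def mult.commute[of "int p"] zmul_mult)
    hence uu: "zmul (u * u') (\<gamma> p) = \<gamma> p" using u' by simp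
    have "zmul c h = zmul (- (a * (u * u')) * P ^ (j + m)) r"
      by (simp add: h_def n_def u power_add mult_ac flip: zmul_mult)
    also have "\<dots> = - zmul a (zmul (u * u') (\<gamma> p))"
      unfolding \<gamma>p by (simp add: zmul_minus_left mult_ac flip: zmul_mult)
    finally show ?thesis unfolding uu .
  qed
  \<comment> \<open>For j \<le> \<nu>-2, that is m \<ge> 1, both numbers are divisible by p^(j+2m),
    and j + 2m \<ge> j + m + 1 = \<nu>. For \<nu> = 1 the element r is the isotropic
    \<open>\<gamma> p\<close> itself.\<close>
  have nj: "P ^ \<nu> dvd c * n\<^sup>2 \<and> P ^ \<nu> dvd n * P ^ (j + m) \<or> r = \<gamma> p" 
    using j(3)
  proof
    assume "j + 2 \<le> \<nu>"
    hence "\<nu> \<le> j + (m + m)" "\<nu> \<le> m + (j + m)" using m by linarith+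
    hence "P ^ \<nu> dvd P ^ (j + (m + m))" "P ^ \<nu> dvd P ^ (m + (j + m))" by (auto intro: le_imp_power_dvd)
    moreover have "c * n\<^sup>2 = P ^ (j + (m + m)) * (u * (a * u')\<^sup>2)"
      by (simp add: u n_def power_add power2_eq_square mult_ac)
    moreover have "n * P ^ (j + m) = P ^ (m + (j + m)) * (- (a * u'))"
      by (simp add: n_def power_add mult_ac)
    ultimately show ?thesis by (metis dvd_mult2)
  next
    assume "\<nu> = 1 \<and> j = 0"
    thus ?thesis using m \<gamma>p by simp
  qed
  have qr_mult: "of_int k * q r \<in> \<int>" if "P ^ \<nu> dvd k \<or> r = \<gamma> p" for k
    using that
  proof
    assume "P ^ \<nu> dvd k"
    then obtain k' where "k = P ^ \<nu> * k'" ..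
    hence "of_int k * q r = of_int k' * (of_int (P ^ \<nu>) * q r)" by simp
    also have "\<dots> \<in> \<int>" by (intro Ints_mult Ints_of_int qr)
    finally show ?thesis .
  next
    assume "r = \<gamma> p"
    thus ?thesis using \<gamma>[OF p] by (metis Ints_mult Ints_of_int)
  qed
  have 2: "of_int c * q h \<in> \<int>"
  proof -
    have "of_int c * q h \<simeq> of_int c * (of_int (n\<^sup>2) * q r)" unfolding h_def by (intro cg_mult q_zmul)
    also have "\<dots> = of_int (c * n\<^sup>2) * q r" by simp
    also have "\<dots> \<simeq> 0" unfolding cg_0_iff using nj qr_mult by blast
    finally show ?thesis by (simp add: cg_0_iff)
  qed
  have 3: "B h (\<gamma> p') \<in> \<int>" if p': "prime p'" "p' dvd level q" for p'
  proof (cases "p' = p")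
    case True
    have "B h (\<gamma> p) \<simeq> of_int (2 * n * P ^ (j + m)) * q r"
      unfolding h_def \<gamma>p by (rule B_zmul_zmul_self)
    also have "\<dots> \<simeq> 0" unfolding cg_0_iff
      using nj qr_mult[of "2 * n * P ^ (j + m)"] by (auto simp: mult.assoc)
    finally show ?thesis using True by (simp add: cg_0_iff)
  next
    case False
    have "zmul (P ^ \<nu>) h = 0" unfolding h_def using r_ord by (simp add: zmul_commute[of "P ^ \<nu>"])
    moreover have "coprime (P ^ \<nu>) (int p')" using False p p' by (simp add: P_def primes_coprime)
    ultimately show ?thesis using B_coprime \<gamma>_order[OF p'] by blast
  qed
  have nint: "B (zmul b (\<gamma> p) + zmul d h) x \<notin> \<int>"
    using row_eq_0[OF M p, of h x] x(1) 1 2 3 by (auto simp: abcd)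
  define s where "s = multiplicity p dd"
  obtain w where w: "dd = p ^ s * w" "\<not> p dvd w"
    using multiplicity_decompose'[of dd p] x(3) p(1) unfolding s_def
    by (metis not_prime_unit gr_implies_not0)
  have "s \<le> m"
  proof (rule ccontr)
    assume "\<not> s \<le> m"
    hence "p ^ (\<nu> - j) dvd p ^ s" by (intro le_imp_power_dvd) (simp add: m(2))
    thus False using ndvd w(1) by auto
  qed
  define k where "k = b * P ^ j - d * a * u'"
  have lam: "zmul b (\<gamma> p) + zmul d h = zmul (P ^ m) (zmul k r)"
    unfolding \<gamma>p h_def by (simp add: k_def n_def power_add algebra_simps flip: zmul_mult zmul_add_left)
  have "B (zmul b (\<gamma> p) + zmul d h) x \<in> \<int>"
  proof (rule Ints_coprime)
    have "zmul (P ^ \<nu>) (zmul (P ^ m) (zmul k r)) = 0"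
      using r_ord by (metis zmul_commute zmul_0_right)
    thus "of_int (P ^ \<nu>) * B (zmul b (\<gamma> p) + zmul d h) x \<in> \<int>" unfolding lam by (rule order_B)
    have "of_int (int w) * B (zmul (P ^ m) (zmul k r)) x \<simeq> of_int (int w) * (of_int (P ^ m) * B (zmul k r) x)"
      by (intro cg_mult B_zmul_left)
    also have "\<dots> = of_int (P ^ (m - s)) * (of_int (int dd) * B (zmul k r) x)"
      using \<open>s \<le> m\<close> by (simp add: w(1) P_def flip: power_add)
    also have "\<dots> \<simeq> 0" unfolding cg_0_iff by (intro Ints_mult Ints_of_int order_B_right x)
    finally show "of_int (int w) * B (zmul b (\<gamma> p) + zmul d h) x \<in> \<int>" unfolding lam cg_0_iff .
    show "coprime (P ^ \<nu>) (int w)"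
      using w(2) p(1) by (simp add: P_def prime_imp_coprime)
  qed
  thus False using nint by simp
qed

text \<open>As c h = 0, \<open>row_translate\<close> compares the row value at x with itself, so the
  two phases agree, and d can be cancelled because it is prime to p. For varying h this puts x into
  a coset of the complement of the p^j-torsion. That h pairs integrally with
  \<open>\<gamma> p\<close> uses j < \<nu>: then \<open>\<gamma> p\<close> is a p^j-fold.\<close>

lemma row_dual_coset:
  assumes M: "M \<in> SL2Z" and p: "prime p" "p dvd level q"
    and j: "int p ^ j dvd M$2$1" "1 \<le> j" "j < multiplicity p (level q)"
    and h: "zmul (int p ^ j) h = 0" and x: "wrow v M x \<noteq> 0"
  shows "B h x + of_int (M$2$1) * q h \<in> \<int>"
proof -
  obtain a b c d where abcd: "M$1$1 = a" "M$1$2 = b" "M$2$1 = c" "M$2$2 = d" by blast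
  obtain u where u: "c = int p ^ j * u" using j(1) unfolding abcd by (auto elim: dvdE)
  have ch: "zmul c h = 0" using h unfolding u by (simp add: mult.commute[of _ u] zmul_mult)
  define n where "n = multiplicity p (level q) - 1 - j"
  have "B h (\<gamma> p') \<in> \<int>" if p': "prime p'" "p' dvd level q" for p'
  proof (cases "p' = p")
    case True
    have "p ^ (j + n) * p = p ^ multiplicity p (level q)"
      using j by (simp add: n_def flip: power_Suc2)
    hence "p ^ (j + n) * p dvd level q" by (simp add: multiplicity_dvd)
    then obtain l where "level q = p ^ (j + n) * p * l" ..
    hence l: "level q div p = p ^ (j + n) * l" using prime_gt_0_nat[OF p(1)] by simp
    obtain r where "\<gamma> p = zmul (int (level q div p)) r"
      using \<gamma>[OF p] by (auto simp: mul_image_def zmul_of_nat)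
    hence "\<gamma> p = zmul (int p ^ j) (zmul (int p ^ n * int l) r)"
      by (simp add: l power_add mult_ac flip: zmul_mult)
    hence "B h (\<gamma> p) \<simeq> of_int (int p ^ j) * B h (zmul (int p ^ n * int l) r)"
      using B_zmul_right[of h "int p ^ j" "zmul (int p ^ n * int l) r"] by simp
    also have "\<dots> \<simeq> 0" unfolding cg_0_iff by (rule order_B[OF h])
    finally show ?thesis using True by (simp add: cg_0_iff)
  next
    case False
    hence "coprime (int p ^ j) (int p')" using p p' by (simp add: primes_coprime)
    thus ?thesis using B_coprime[OF h] \<gamma>_order[OF p'] by blast
  qed
  hence hv: "B h y \<in> \<int>" if "v y \<noteq> 0" for y using v_props(4)[OF that, of h] by simp
  have "wrow v M (x + zmul c h) * E (B (zmul d h) x) = E (of_int (- (c * d)) * q h) * wrow v M x"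
    using row_translate[OF M, of v h x] hv by (simp add: abcd)
  hence "E (B (zmul d h) x) = E (of_int (- (c * d)) * q h)" using x by (simp add: ch)
  hence "E (B (zmul d h) x - of_int (- (c * d)) * q h) = 1"
    using E_add[of "B (zmul d h) x - of_int (- (c * d)) * q h" "of_int (- (c * d)) * q h"] by simp
  hence *: "B (zmul d h) x + of_int (c * d) * q h \<in> \<int>" by (simp add: E_eq_1_iff)
  show ?thesis unfolding abcd
  proof (rule Ints_coprime)
    have "of_int d * (B h x + of_int c * q h) = of_int d * B h x + of_int (c * d) * q h"
      by (simp add: algebra_simps)
    also have "\<dots> \<simeq> B (zmul d h) x + of_int (c * d) * q h"
      by (intro cg_add cg_refl cg_sym[OF B_zmul_left])
    finally show "of_int d * (B h x + of_int c * q h) \<in> \<int>" using * by (simp add: cg_Ints)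
    have "of_int ((int p ^ j)\<^sup>2) * q h \<simeq> q (zmul (int p ^ j) h)" by (rule cg_sym[OF q_zmul])
    hence "of_int ((int p ^ j)\<^sup>2) * q h \<in> \<int>" using cg_Ints q_0 h by auto
    hence "of_int u * (of_int ((int p ^ j)\<^sup>2) * q h) \<in> \<int>" by (rule Ints_mult[OF Ints_of_int])
    moreover have "of_int (int p ^ j) * B h x \<in> \<int>" by (rule order_B[OF h])
    moreover have "of_int (int p ^ j) * (B h x + of_int c * q h) =
        of_int (int p ^ j) * B h x + of_int u * (of_int ((int p ^ j)\<^sup>2) * q h)"
      by (simp add: u algebra_simps power2_eq_square)
    ultimately show "of_int (int p ^ j) * (B h x + of_int c * q h) \<in> \<int>" by simp
    have "int p dvd c" using u j(2) by (simp add: dvd_power)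
    hence "coprime d (int p)" using SL2Z_coprime(1)[OF M] unfolding abcd
      by (meson coprime_commute coprime_divisors dvd_refl)
    thus "coprime d (int p ^ j)" by simp
  qed
qed

end


section \<open>Orders of Fourier expansions\<close>

text \<open>A bound in terms of some expansion, with no coefficient required to be non-zero. This
  makes it stable under sums without any uniqueness of expansions.\<close>

definition order_at_least :: "(complex \<Rightarrow> complex) \<Rightarrow> rat \<Rightarrow> bool" where
  "order_at_least f r \<longleftrightarrow> (\<exists>h m a. q_expansion f h m a \<and> r \<le> of_int m / of_nat h)"

text \<open>Zeros are inserted between and in front of the coefficients. This brings two expansions
  to a common denominator and a common first exponent.\<close>

lemma q_expansion_refine:
  assumes f: "q_expansion f h m a" and l: "l > 0" and m': "m' \<le> m * int l"
  shows "\<exists>a'. q_expansion f (h * l) m' a'"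
proof -
  define s where "s = nat (m * int l - m')"
  define g where "g j = s + j * l" for j
  have s: "int s = m * int l - m'" using m' by (simp add: s_def)
  have g: "strict_mono g" using l by (auto simp: g_def strict_mono_def)
  define a' where "a' n = (if n \<in> range g then a (inv g n) else 0)" for n
  have a'g: "a' (g j) = a j" for j using g by (simp add: a'_def strict_mono_imp_inj_on)
  have h: "h > 0" using f by (simp add: q_expansion_def)
  have "(\<lambda>n. a' n * e (of_int (m' + int n) / of_nat (h * l) * \<tau>)) sums f \<tau>"
    if \<tau>: "\<tau> \<in> upper_half_plane" for \<tau>
  proof (rule sums_mono_reindex[OF g, THEN iffD1])
    have "m' + int (g j) = (m + int j) * int l" for j by (simp add: g_def s algebra_simps)
    hence "of_int (m' + int (g j)) / of_nat (h * l) = (of_int (m + int j) / of_nat h :: complex)" for j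
      using l h by (simp add: field_simps)
    thus "(\<lambda>j. a' (g j) * e (of_int (m' + int (g j)) / of_nat (h * l) * \<tau>)) sums f \<tau>"
      using f \<tau> by (simp only: a'g q_expansion_def)
  qed (simp add: a'_def)
  thus ?thesis using h l by (intro exI[of _ a']) (simp add: q_expansion_def)
qed

lemma order_at_least_mono: "order_at_least f r \<Longrightarrow> s \<le> r \<Longrightarrow> order_at_least f s"
  unfolding order_at_least_def by (meson order_trans)

lemma order_at_least_cong:
  assumes "order_at_least f r" "\<And>\<tau>. \<tau> \<in> upper_half_plane \<Longrightarrow> f \<tau> = g \<tau>"
  shows "order_at_least g r"
  using assms unfolding order_at_least_def q_expansion_def by metis

lemma order_at_least_add:
  assumes "order_at_least f r" "order_at_least g r"
  shows "order_at_least (\<lambda>\<tau>. f \<tau> + g \<tau>) r"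
proof -
  obtain h m a where f: "q_expansion f h m a" "r \<le> of_int m / of_nat h"
    using assms(1) by (auto simp: order_at_least_def)
  obtain h' m' a' where g: "q_expansion g h' m' a'" "r \<le> of_int m' / of_nat h'"
    using assms(2) by (auto simp: order_at_least_def)
  have h: "h > 0" "h' > 0" using f g by (auto simp: q_expansion_def)
  define n where "n = min (m * int h') (m' * int h)"
  obtain b where b: "q_expansion f (h * h') n b"
    using q_expansion_refine[OF f(1) h(2), of n] by (auto simp: n_def)
  obtain b' where b': "q_expansion g (h * h') n b'"
    using q_expansion_refine[OF g(1) h(1), of n] by (auto simp: n_def mult.commute[of h])
  have "q_expansion (\<lambda>\<tau>. f \<tau> + g \<tau>) (h * h') n (\<lambda>j. b j + b' j)"
    using b b' unfolding q_expansion_def by (auto simp: distrib_right intro!: sums_add)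
  moreover have "r \<le> of_int n / of_nat (h * h')"
    using f(2) g(2) h by (auto simp: n_def min_def field_simps)
  ultimately show ?thesis unfolding order_at_least_def by blast
qed

lemma order_at_least_0: "order_at_least (\<lambda>\<tau>. 0) r"
proof -
  have "q_expansion (\<lambda>\<tau>. 0) 1 \<lceil>r\<rceil> (\<lambda>j. 0)" by (simp add: q_expansion_def)
  thus ?thesis unfolding order_at_least_def by (intro exI conjI, assumption) simp
qed

lemma order_at_least_cmult: "order_at_least f r \<Longrightarrow> order_at_least (\<lambda>\<tau>. c * f \<tau>) r"
  unfolding order_at_least_def
proof (elim exE conjE)
  fix h m a assume "q_expansion f h m a" "r \<le> of_int m / of_nat h"
  moreover from this have "q_expansion (\<lambda>\<tau>. c * f \<tau>) h m (\<lambda>j. c * a j)"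
    by (auto simp: q_expansion_def mult.assoc intro!: sums_mult)
  ultimately show "\<exists>h m a. q_expansion (\<lambda>\<tau>. c * f \<tau>) h m a \<and> r \<le> of_int m / of_nat h" by blast
qed

lemma order_at_least_sum:
  assumes "finite A" "\<And>x. x \<in> A \<Longrightarrow> c x \<noteq> 0 \<Longrightarrow> order_at_least (f x) r"
  shows "order_at_least (\<lambda>\<tau>. \<Sum>x\<in>A. c x * f x \<tau>) r"
  using assms
proof (induction A rule: finite_induct)
  case empty
  show ?case by (simp add: order_at_least_0)
next
  case (insert x A)
  have "order_at_least (\<lambda>\<tau>. c x * f x \<tau>) r"
    using insert.prems[of x] by (cases "c x = 0") (auto simp: order_at_least_0 order_at_least_cmult)
  from order_at_least_add[OF this insert.IH] show ?case using insert by simp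
qed

lemma meromorphic_at_ioo_iff: "meromorphic_at_ioo f \<longleftrightarrow> (\<exists>r. order_at_least f r)"
  unfolding meromorphic_at_ioo_def order_at_least_def by auto

lemma leading_term_imp_order_at_least: "leading_term f r c \<Longrightarrow> order_at_least f r"
  unfolding leading_term_def order_at_least_def by auto

text \<open>The coefficient in \<open>leading_term\<close> may vanish, so after refining by the
  denominator of r the first exponent can be lowered to exactly r.\<close>

lemma order_at_least_imp_leading_term:
  assumes "order_at_least f r"
  shows "\<exists>c. leading_term f r c"
proof -
  obtain h m a where f: "q_expansion f h m a" "r \<le> of_int m / of_nat h"
    using assms by (auto simp: order_at_least_def)
  have h: "h > 0" using f by (simp add: q_expansion_def)
  obtain n d where nd: "quotient_of r = (n, d)" by fastforce
  have d: "d > 0" and r: "r = of_int n / of_int d"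
    using quotient_of_denom_pos[OF nd] quotient_of_div[OF nd] by auto
  have "of_int (n * int h) \<le> (of_int (m * d) :: rat)"
    using f(2) h d unfolding r by (simp add: field_simps)
  hence "n * int h \<le> m * int (nat d)" using d by (simp only: of_int_le_iff) simp
  then obtain a' where "q_expansion f (h * nat d) (n * int h) a'"
    using q_expansion_refine[OF f(1), of "nat d" "n * int h"] d by auto
  moreover have "of_int (n * int h) / of_nat (h * nat d) = r"
    using h d by (simp add: r field_simps of_nat_nat)
  ultimately show ?thesis unfolding leading_term_def by blast
qed

text \<open>On the imaginary axis f is an exponential factor times a power series in z = exp(-2 pi y
  / h), and z tends to 0. So the growth of f detects its leading coefficient.\<close>

lemma q_expansion_limit:
  assumes "q_expansion f h m a"
  shows "((\<lambda>y. f (\<i> * of_real y) * of_real (exp (2 * pi * (of_int m / of_nat h) * y))) \<longlongrightarrow> a 0) at_top"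
proof -
  have h: "h > 0" using assms by (simp add: q_expansion_def)
  define z where "z y = exp (- (2 * pi / h) * y)" for y :: real
  have e_z: "e (of_int (m + int j) / of_nat h * (\<i> * of_real y)) =
      of_real (exp (- (2 * pi * (of_int m / of_nat h) * y))) * of_real (z y) ^ j" for j and y :: real
  proof -
    have "e (of_int (m + int j) / of_nat h * (\<i> * of_real y)) =
        of_real (exp (- (2 * pi * (of_int m / of_nat h) * y) + of_nat j * (- (2 * pi / h) * y)))"
      unfolding e_def exp_of_real[symmetric] using h by (simp add: field_simps)
    thus ?thesis by (simp only: exp_add exp_of_nat_mult z_def of_real_mult of_real_power)
  qed
  have sums: "(\<lambda>j. a j * of_real (z y) ^ j) sums (f (\<i> * of_real y) * of_real (exp (2 * pi * (of_int m / of_nat h) * y)))"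
    if "y > 0" for y
  proof -
    have "\<i> * of_real y \<in> upper_half_plane" using that by (simp add: upper_half_plane_def)
    hence "(\<lambda>j. a j * e (of_int (m + int j) / of_nat h * (\<i> * of_real y))) sums f (\<i> * of_real y)"
      using assms by (simp add: q_expansion_def)
    hence "(\<lambda>j. a j * e (of_int (m + int j) / of_nat h * (\<i> * of_real y)) *
        of_real (exp (2 * pi * (of_int m / of_nat h) * y))) sums
        (f (\<i> * of_real y) * of_real (exp (2 * pi * (of_int m / of_nat h) * y)))"
      by (rule sums_mult2)
    moreover have "a j * e (of_int (m + int j) / of_nat h * (\<i> * of_real y)) *
        of_real (exp (2 * pi * (of_int m / of_nat h) * y)) = a j * of_real (z y) ^ j" for j
    proof -
      have "complex_of_real (exp (- (2 * pi * (of_int m / of_nat h) * y))) *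
          of_real (exp (2 * pi * (of_int m / of_nat h) * y)) = 1"
        unfolding of_real_mult[symmetric] exp_add[symmetric] by simp
      thus ?thesis unfolding e_z by (simp add: mult_ac)
    qed
    ultimately show ?thesis by (simp only:)
  qed
  have lim: "((\<lambda>w. \<Sum>j. a j * w ^ j) \<longlongrightarrow> a 0) (at 0)"
  proof (rule powser_limit_0)
    show "0 < z 1" by (simp add: z_def)
    fix w :: complex assume "norm w < z 1"
    hence "norm w < norm (complex_of_real (z 1))" by (simp add: z_def)
    from powser_inside[OF _ this, of a] sums[of 1] show "(\<lambda>j. a j * w ^ j) sums (\<Sum>j. a j * w ^ j)"
      by (auto intro: summable_sums simp: sums_iff)
  qed
  have z: "filterlim (\<lambda>y. complex_of_real (z y)) (at 0) at_top"
  proof (rule filterlim_atI)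
    have "(z \<longlongrightarrow> 0) at_top"
      unfolding z_def using h by real_asymp
    thus "((\<lambda>y. complex_of_real (z y)) \<longlongrightarrow> 0) at_top"
      using tendsto_of_real by fastforce
  qed (simp add: z_def)
  have "((\<lambda>y. \<Sum>j. a j * complex_of_real (z y) ^ j) \<longlongrightarrow> a 0) at_top"
    by (rule filterlim_compose[OF lim z])
  moreover have "\<forall>\<^sub>F y in at_top. (\<Sum>j. a j * complex_of_real (z y) ^ j) =
      f (\<i> * of_real y) * of_real (exp (2 * pi * (of_int m / of_nat h) * y))"
    using eventually_gt_at_top[of 0] by eventually_elim (use sums in \<open>simp add: sums_iff\<close>)
  ultimately show ?thesis by (rule Lim_transform_eventually)
qed

text \<open>Without a pole, vanishing first coefficients are stripped off until the first exponent
  is non-negative. Conversely, a pole forces a growth on the imaginary axis that an expansion with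
  non-negative exponents does not have.\<close>

lemma not_pole_iff:
  assumes "meromorphic_at_ioo f"
  shows "\<not> pole_at_ioo f \<longleftrightarrow> order_at_least f 0"
proof
  assume np: "\<not> pole_at_ioo f"
  have "order_at_least f 0" if "q_expansion f h m a" "nat (- m) = n" for h m a n
    using that
  proof (induction n arbitrary: m a)
    case 0
    thus ?case unfolding order_at_least_def by (intro exI[of _ h] exI[of _ m] exI[of _ a]) simp
  next
    case (Suc n)
    have "m < 0" using Suc.prems(2) by simp
    hence "a 0 = 0" using np Suc.prems(1) unfolding pole_at_ioo_def by blast
    have "(\<lambda>j. a (Suc j) * e (of_int (m + 1 + int j) / of_nat h * \<tau>)) sums f \<tau>"
      if "\<tau> \<in> upper_half_plane" for \<tau>
    proof -
      have "(\<lambda>j. a j * e (of_int (m + int j) / of_nat h * \<tau>)) sums f \<tau>"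
        using Suc.prems(1) that by (simp add: q_expansion_def)
      hence "(\<lambda>j. a (Suc j) * e (of_int (m + int (Suc j)) / of_nat h * \<tau>)) sums f \<tau>"
        using \<open>a 0 = 0\<close> by (subst sums_Suc_iff) simp
      thus ?thesis by (simp add: add_ac)
    qed
    hence "q_expansion f h (m + 1) (\<lambda>j. a (Suc j))"
      using Suc.prems(1) by (simp add: q_expansion_def)
    thus ?case using Suc.IH Suc.prems(2) by simp
  qed
  thus "order_at_least f 0" using assms unfolding meromorphic_at_ioo_def by blast
next
  assume "order_at_least f 0"
  then obtain h m a where f: "q_expansion f h m a" "0 \<le> (of_int m / of_nat h :: rat)"
    by (auto simp: order_at_least_def)
  have h: "h > 0" using f by (simp add: q_expansion_def)
  have m: "m \<ge> 0" using f(2) h by (simp add: zero_le_divide_iff)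
  show "\<not> pole_at_ioo f"
  proof
    assume "pole_at_ioo f"
    then obtain h' m' a' where f': "q_expansion f h' m' a'" "m' < 0" "a' 0 \<noteq> 0"
      by (auto simp: pole_at_ioo_def)
    have h': "h' > 0" using f' by (simp add: q_expansion_def)
    define r where "r = real_of_int m / real h - real_of_int m' / real h'"
    have "real_of_int m / real h \<ge> 0" "real_of_int m' / real h' < 0"
      using m f'(2) h h' by (simp_all add: divide_neg_pos)
    hence r: "r > 0" by (simp add: r_def)
    have "((\<lambda>y. of_real (exp (- (2 * pi * r) * y))) \<longlongrightarrow> (of_real 0 :: complex)) at_top"
      using r by (intro tendsto_of_real) real_asymp
    from tendsto_mult[OF q_expansion_limit[OF f(1)] this]
    have "((\<lambda>y. f (\<i> * of_real y) * of_real (exp (2 * pi * (of_int m' / of_nat h') * y))) \<longlongrightarrow> 0) at_top"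
      by (simp add: mult.assoc r_def algebra_simps flip: of_real_mult exp_add)
    from tendsto_unique[OF _ this q_expansion_limit[OF f'(1)]] f'(3) show False by simp
  qed
qed


section \<open>Alternating forms modulo 2\<close>

definition subgrp :: "'a::ab_group_add set \<Rightarrow> bool" where
  "subgrp A \<longleftrightarrow> 0 \<in> A \<and> (\<forall>x\<in>A. \<forall>y\<in>A. x - y \<in> A)"

lemma subgrpD:
  assumes "subgrp A"
  shows "0 \<in> A" "x \<in> A \<Longrightarrow> y \<in> A \<Longrightarrow> x - y \<in> A" "x \<in> A \<Longrightarrow> - x \<in> A" "x \<in> A \<Longrightarrow> y \<in> A \<Longrightarrow> x + y \<in> A"
proof -
  show 0: "0 \<in> A" and d: "x \<in> A \<Longrightarrow> y \<in> A \<Longrightarrow> x - y \<in> A" for x y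
    using assms by (auto simp: subgrp_def)
  show m: "x \<in> A \<Longrightarrow> - x \<in> A" for x using d[OF 0, of x] by simp
  show "x \<in> A \<Longrightarrow> y \<in> A \<Longrightarrow> x + y \<in> A" using d[OF _ m, of x y] by simp
qed

lemma subgrp_zmul: "subgrp A \<Longrightarrow> x \<in> A \<Longrightarrow> zmul n x \<in> A"
proof -
  assume A: "subgrp A" and x: "x \<in> A"
  have "nmul k x \<in> A" for k by (induction k) (auto simp: subgrpD[OF A] x)
  thus ?thesis unfolding zmul_def using subgrpD[OF A] by simp
qed

lemma subgrp_UNIV [simp]: "subgrp UNIV"
  by (simp add: subgrp_def)

text \<open>Predicates serve as functions into the field of two elements, with inequality as
  addition. So h is a surjective homomorphism, and translation by w exchanges its two
  fibres.\<close>

lemma card_index_2: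
  assumes A: "finite A" "subgrp A"
    and add: "\<And>x y. x \<in> A \<Longrightarrow> y \<in> A \<Longrightarrow> h (x + y) \<longleftrightarrow> h x \<noteq> h y"
    and w: "w \<in> A" "h w"
  shows "card A = 2 * card {x \<in> A. \<not> h x}" "subgrp {x \<in> A. \<not> h x}"
proof -
  note sg = subgrpD[OF A(2)]
  have "bij_betw (\<lambda>x. x + w) {x \<in> A. \<not> h x} {x \<in> A. h x}"
  proof (rule bij_betw_byWitness[of _ "\<lambda>x. x - w"])
    show "(\<lambda>x. x + w) ` {x \<in> A. \<not> h x} \<subseteq> {x \<in> A. h x}" using w sg by (auto simp: add)
    show "(\<lambda>x. x - w) ` {x \<in> A. h x} \<subseteq> {x \<in> A. \<not> h x}"
    proof (clarsimp, intro conjI)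
      fix x assume x: "x \<in> A" "h x"
      thus xw: "x - w \<in> A" using w sg by auto
      show "\<not> h (x - w)" using add[OF xw w(1)] x w by simp
    qed
  qed auto
  hence "card {x \<in> A. h x} = card {x \<in> A. \<not> h x}" using bij_betw_same_card by metis
  moreover have "card A = card {x \<in> A. h x} + card {x \<in> A. \<not> h x}"
    using A(1) by (subst card_Un_disjoint[symmetric]) (auto intro: arg_cong[of _ _ card])
  ultimately show "card A = 2 * card {x \<in> A. \<not> h x}" by simp
  have 0: "\<not> h 0" using add[of 0 0] sg by simp
  have "h (x - y) \<longleftrightarrow> h x \<noteq> h y" if "x \<in> A" "y \<in> A" for x y
    using add[of "x - y" y] that sg by auto
  thus "subgrp {x \<in> A. \<not> h x}" using 0 sg unfolding subgrp_def by simp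
qed

text \<open>Hyperbolic planes are split off: if \<open>b x y\<close>, the elements orthogonal to
  both x and y form a subgroup of index 4 with the same radical.\<close>

lemma alternating_card:
  assumes "finite A" "subgrp A"
    and "\<And>x y z. x \<in> A \<Longrightarrow> y \<in> A \<Longrightarrow> z \<in> A \<Longrightarrow> b (x + y) z \<longleftrightarrow> b x z \<noteq> b y z"
    and "\<And>x y. x \<in> A \<Longrightarrow> y \<in> A \<Longrightarrow> b x y \<longleftrightarrow> b y x"
    and "\<And>x. x \<in> A \<Longrightarrow> \<not> b x x"
  shows "\<exists>k. card A = 4 ^ k * card {x \<in> A. \<forall>y\<in>A. \<not> b x y}"
  using assms
proof (induction "card A" arbitrary: A rule: less_induct)
  case (less A)
  note sg = subgrpD[OF less.prems(2)]
  show ?case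
  proof (cases "\<exists>x\<in>A. \<exists>y\<in>A. b x y")
    case False
    hence "{x \<in> A. \<forall>y\<in>A. \<not> b x y} = A" by blast
    thus ?thesis by (intro exI[of _ 0]) simp
  next
    case True
    then obtain x y where xy: "x \<in> A" "y \<in> A" "b x y" by blast
    define A1 where "A1 = {z \<in> A. \<not> b z x}"
    define A2 where "A2 = {z \<in> A1. \<not> b z y}"
    have 1: "card A = 2 * card A1" "subgrp A1"
      unfolding A1_def using card_index_2[of A "\<lambda>z. b z x" y] less.prems xy by blast+
    have "finite A1" "x \<in> A1" using less.prems xy by (auto simp: A1_def)
    hence 2: "card A1 = 2 * card A2" "subgrp A2"
      unfolding A2_def using card_index_2[of A1 "\<lambda>z. b z y" x] less.prems xy 1
      by (auto simp: A1_def)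
    have A2A: "A2 \<subseteq> A" by (auto simp: A1_def A2_def)
    have "finite A2" using A2A less.prems(1) finite_subset by blast
    have "card A2 > 0" using \<open>finite A2\<close> subgrpD(1)[OF 2(2)] by (auto simp: card_gt_0_iff)
    hence "\<exists>k. card A2 = 4 ^ k * card {x \<in> A2. \<forall>y\<in>A2. \<not> b x y}"
    proof (intro less.hyps)
      show "card A2 < card A" using 1 2 \<open>card A2 > 0\<close> by simp
      show "finite A2" "subgrp A2" by fact+
      show "b (x + y) z \<longleftrightarrow> b x z \<noteq> b y z" if "x \<in> A2" "y \<in> A2" "z \<in> A2" for x y z
        using that A2A by (intro less.prems(3)) blast+
      show "b x y \<longleftrightarrow> b y x" if "x \<in> A2" "y \<in> A2" for x y
        using that A2A by (intro less.prems(4)) blast+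
      show "\<not> b x x" if "x \<in> A2" for x
        using that A2A by (intro less.prems(5)) blast
    qed
    then obtain k where k: "card A2 = 4 ^ k * card {x \<in> A2. \<forall>y\<in>A2. \<not> b x y}" ..
    have "{x \<in> A2. \<forall>y\<in>A2. \<not> b x y} = {x \<in> A. \<forall>y\<in>A. \<not> b x y}"
    proof (intro set_eqI iffI; clarsimp)
      fix z assume z: "z \<in> A2" "\<forall>y\<in>A2. \<not> b z y"
      have zA: "z \<in> A" "\<not> b z x" "\<not> b z y" using z by (auto simp: A1_def A2_def)
      have "\<not> b z u" if u: "u \<in> A" for u
      proof -
        have add: "b z (s + t) \<longleftrightarrow> b z s \<noteq> b z t" if "s \<in> A" "t \<in> A" for s t
          using less.prems(3,4) that zA(1) sg(4) by metis
        have sxy: "b (s + t) x \<longleftrightarrow> b s x \<noteq> b t x" "b (s + t) y \<longleftrightarrow> b s y \<noteq> b t y"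
          if "s \<in> A" "t \<in> A" for s t using less.prems(3) that xy by metis+
        \<comment> \<open>The correction s + t from the plane of x and y makes u orthogonal to both,
          without changing its pairing with z.\<close>
        define s where "s = (if b u x then y else 0)"
        define t where "t = (if b u y then x else 0)"
        have 0: "\<not> b 0 x" "\<not> b 0 y" "\<not> b z 0" using sxy[of 0 0] add[of 0 0] sg by auto
        have st: "s \<in> A" "t \<in> A" using xy sg by (auto simp: s_def t_def)
        have bst: "b s x = b u x" "\<not> b s y" "\<not> b t x" "b t y = b u y"
          using xy 0 less.prems(4,5) by (auto simp: s_def t_def)
        have "u + (s + t) \<in> A2"
          using u st bst sg sxy by (auto simp: A1_def A2_def)
        hence "\<not> b z (u + (s + t))" using z by blast
        moreover have "\<not> b z s" "\<not> b z t" using zA 0 by (auto simp: s_def t_def)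
        ultimately show ?thesis using add u st sg by auto
      qed
      thus "z \<in> A \<and> (\<forall>y\<in>A. \<not> b z y)" using zA by blast
    next
      fix z assume "z \<in> A" "\<forall>y\<in>A. \<not> b z y"
      thus "z \<in> A2 \<and> (\<forall>y\<in>A2. \<not> b z y)" using xy A2A by (auto simp: A1_def A2_def)
    qed
    hence "card A = 4 ^ Suc k * card {x \<in> A. \<forall>y\<in>A. \<not> b x y}" using 1 2 k by simp
    thus ?thesis by blast
  qed
qed


section \<open>The 2-torsion of the discriminant group of a lattice of even rank\<close>

definition lift :: "bit \<Rightarrow> int" where
  "lift t = (if t = 1 then 1 else 0)"

lemma of_int_lift [simp]: "(of_int (lift t) :: bit) = t"
  by (cases t) (auto simp: lift_def)

lemma bit_add_eq_1_iff: "s + t = (1 :: bit) \<longleftrightarrow> (s = 1) \<noteq> (t = 1)"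
  by (cases s; cases t) auto

lemma of_int_bit_eq_0_iff: "(of_int n :: bit) = 0 \<longleftrightarrow> even n"
proof -
  have "(of_int n :: bit) = of_int (n mod 2)"
    by (metis add.right_neutral mult_eq_0_iff bit_numeral_even  of_int_add of_int_mult of_int_numeral mult_div_mod_eq add_0)
  thus ?thesis by (cases "even n") (auto simp: odd_iff_mod_2_eq_one even_iff_mod_2_eq_zero)
qed

text \<open>In characteristic 2 the terms at (i, j) and (j, i) cancel.\<close>

lemma bit_double_sum_alternating:
  fixes t :: "nat \<Rightarrow> nat \<Rightarrow> bit"
  assumes "\<And>i j. i < m \<Longrightarrow> j < m \<Longrightarrow> t i j = t j i" "\<And>i. i < m \<Longrightarrow> t i i = 0"
  shows "(\<Sum>i<m. \<Sum>j<m. t i j) = 0"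
  using assms
proof (induction m)
  case (Suc m)
  have "(\<Sum>i<Suc m. \<Sum>j<Suc m. t i j) = (\<Sum>i<m. \<Sum>j<m. t i j) + (\<Sum>i<m. t i m) + (\<Sum>j<m. t m j) + t m m"
    by (simp only: sum.lessThan_Suc sum.distrib ac_simps)
  also have "(\<Sum>i<m. t i m) = (\<Sum>j<m. t m j)" using Suc.prems by (intro sum.cong) auto
  also have "(\<Sum>i<m. \<Sum>j<m. t i j) = 0" using Suc by simp
  finally show ?case using Suc.prems by (cases "\<Sum>j<m. t m j") auto
qed simp

context disc_form
begin

text \<open>The Gram matrix of an even lattice is alternating modulo 2, so its rank modulo 2 is
  even. Its radical is the 2-torsion of L'/L: a vector modulo 2 is in the radical iff half of an
  integral lift lies in L'. For even m the 2-rank of D is therefore even.\<close>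

lemma card_2_torsion_lattice:
  assumes L: "even_lattice m G bp bm" and D: "has_discriminant_form m G q"
  shows "\<exists>k. 2 ^ m = 4 ^ k * card {x :: 'd. zmul 2 x = 0}"
proof -
  have sym: "G i j = G j i" if "i < m" "j < m" for i j using L that by (simp add: even_lattice_def)
  have even: "even (G i i)" if "i < m" for i using L that by (simp add: even_lattice_def)
  obtain \<phi> :: "(nat \<Rightarrow> rat) \<Rightarrow> 'd" where
    \<phi>_add: "\<And>x y. x \<in> dual_lattice m G \<Longrightarrow> y \<in> dual_lattice m G \<Longrightarrow> \<phi> (\<lambda>i. x i + y i) = \<phi> x + \<phi> y"
    and \<phi>_surj: "\<phi> ` dual_lattice m G = UNIV"
    and \<phi>_0: "\<And>x. x \<in> dual_lattice m G \<Longrightarrow> \<phi> x = 0 \<longleftrightarrow> x \<in> int_lattice m"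
    using D unfolding has_discriminant_form_def by blast
  define V where "V = {x :: nat \<Rightarrow> bit. \<forall>i\<ge>m. x i = 0}"
  define b where "b x y \<longleftrightarrow> (\<Sum>i<m. \<Sum>j<m. x i * of_int (G i j) * y j) = (1 :: bit)" for x y :: "nat \<Rightarrow> bit"
  have V: "finite V \<and> card V = 2 ^ m"
  proof -
    have "bij_betw (\<lambda>x. restrict x {..<m}) V ({..<m} \<rightarrow>\<^sub>E (UNIV :: bit set))"
      by (rule bij_betw_byWitness[of _ "\<lambda>x i. if i < m then x i else 0"])
        (auto simp: V_def fun_eq_iff restrict_def PiE_def extensional_def)
    moreover have bit: "(UNIV :: bit set) = {0, 1}" by auto
    have "finite (UNIV :: bit set)" "card (UNIV :: bit set) = 2" unfolding bit by simp_all
    hence "finite ({..<m} \<rightarrow>\<^sub>E (UNIV :: bit set))" "card ({..<m} \<rightarrow>\<^sub>E (UNIV :: bit set)) = 2 ^ m"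
      by (auto intro!: finite_PiE simp: card_PiE)
    ultimately show ?thesis using bij_betw_finite bij_betw_same_card by metis
  qed
  have "\<exists>k. card V = 4 ^ k * card {x \<in> V. \<forall>y\<in>V. \<not> b x y}"
  proof (rule alternating_card)
    show "finite V" using V by simp
    show "subgrp V" by (simp add: subgrp_def V_def)
    show "b (x + y) z \<longleftrightarrow> b x z \<noteq> b y z" for x y z
    proof -
      have "(\<Sum>i<m. \<Sum>j<m. (x + y) i * of_int (G i j) * z j) =
          (\<Sum>i<m. \<Sum>j<m. x i * of_int (G i j) * z j) + (\<Sum>i<m. \<Sum>j<m. y i * of_int (G i j) * z j)"
        by (simp only: plus_fun_apply distrib_right sum.distrib)
      thus ?thesis unfolding b_def by (simp only: bit_add_eq_1_iff)
    qed
    show "b x y \<longleftrightarrow> b y x" for x y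
    proof -
      have "(\<Sum>i<m. \<Sum>j<m. x i * of_int (G i j) * y j) = (\<Sum>j<m. \<Sum>i<m. x i * of_int (G i j) * y j)"
        by (rule sum.swap)
      also have "\<dots> = (\<Sum>j<m. \<Sum>i<m. y j * of_int (G j i) * x i)"
        by (intro sum.cong refl) (simp add: sym mult_ac)
      finally show ?thesis by (simp add: b_def)
    qed
    show "\<not> b x x" for x
    proof -
      have "(\<Sum>i<m. \<Sum>j<m. x i * of_int (G i j) * x j) = 0"
        using sym even by (intro bit_double_sum_alternating) (auto simp: mult_ac of_int_bit_eq_0_iff[THEN iffD2])
      thus ?thesis by (simp add: b_def)
    qed
  qed
  moreover have "card {x \<in> V. \<forall>y\<in>V. \<not> b x y} = card {x :: 'd. zmul 2 x = 0}"
  proof -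
    define half where "half x i = (of_int (lift (x i)) / 2 :: rat)" for x :: "nat \<Rightarrow> bit" and i :: nat
    define col where "col x j = (\<Sum>i<m. lift (x i) * G i j)" for x :: "nat \<Rightarrow> bit" and j :: nat
    have rad: "(\<forall>y\<in>V. \<not> b x y) \<longleftrightarrow> (\<forall>j<m. even (col x j))" for x
    proof -
      have b: "b x y \<longleftrightarrow> (\<Sum>j<m. of_int (col x j) * y j) = 1" for y
      proof -
        have "(\<Sum>i<m. \<Sum>j<m. x i * of_int (G i j) * y j) = (\<Sum>j<m. \<Sum>i<m. x i * of_int (G i j) * y j)"
          by (rule sum.swap)
        moreover have "(\<Sum>i<m. x i * of_int (G i j) * y j) = of_int (col x j) * y j" for j
          by (simp only: col_def of_int_sum of_int_mult of_int_lift sum_distrib_right)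
        ultimately show ?thesis by (simp only: b_def)
      qed
      show ?thesis
      proof (intro iffI allI impI ballI)
        fix j assume j: "\<forall>y\<in>V. \<not> b x y" "j < m"
        define y where "y i = (if i = j then 1 else 0 :: bit)" for i
        have "y \<in> V" using j by (auto simp: V_def y_def)
        hence "(\<Sum>j<m. of_int (col x j) * y j) \<noteq> 1" using j b by blast
        also have "(\<Sum>j<m. of_int (col x j) * y j) = of_int (col x j)"
          using j(2) by (simp add: y_def if_distrib cong: if_cong)
        finally show "even (col x j)" by (simp add: of_int_bit_eq_0_iff[symmetric])
      qed (simp add: b of_int_bit_eq_0_iff[THEN iffD2])
    qed
    have gram_half: "gram_form m G (half x) y = (\<Sum>j<m. of_int (col x j) / 2 * y j)" for x and y :: "nat \<Rightarrow> rat"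
    proof -
      have "gram_form m G (half x) y = (\<Sum>j<m. \<Sum>i<m. half x i * of_int (G i j) * y j)"
        unfolding gram_form_def by (rule sum.swap)
      thus ?thesis by (simp add: half_def col_def sum_distrib_right sum_divide_distrib)
    qed
    have half_dual: "half x \<in> dual_lattice m G \<longleftrightarrow> (\<forall>j<m. even (col x j))" if "x \<in> V" for x
    proof
      assume h: "half x \<in> dual_lattice m G"
      show "\<forall>j<m. even (col x j)"
      proof (intro allI impI)
        fix j assume j: "j < m"
        define y where "y i = (if i = j then 1 else 0 :: rat)" for i
        have "y \<in> int_lattice m" using j by (auto simp: int_lattice_def y_def)
        hence "gram_form m G (half x) y \<in> \<int>" using h by (simp add: dual_lattice_def)
        moreover have "gram_form m G (half x) y = of_int (col x j) / 2"
          unfolding gram_half using j by (simp add: y_def if_distrib cong: if_cong)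
        ultimately obtain l where "of_int (col x j) / 2 = (of_int l :: rat)" by (auto elim: Ints_cases)
        hence "of_int (col x j) = (of_int (2 * l) :: rat)" by simp
        thus "even (col x j)" by (simp only: of_int_eq_iff) simp
      qed
    next
      assume ev: "\<forall>j<m. even (col x j)"
      have "gram_form m G (half x) y \<in> \<int>" if "y \<in> int_lattice m" for y
        unfolding gram_half
      proof (intro Ints_sum Ints_mult)
        fix j assume "j \<in> {..<m}"
        thus "of_int (col x j) / 2 \<in> (\<int> :: rat set)" "y j \<in> \<int>"
          using ev that by (auto simp: int_lattice_def elim!: evenE)
      qed
      moreover have "half x i = 0" if "i \<ge> m" for i using \<open>x \<in> V\<close> that by (simp add: V_def half_def lift_def)
      ultimately show "half x \<in> dual_lattice m G" by (simp add: dual_lattice_def)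
    qed
    have dual_sub: "(\<lambda>i. x i - y i) \<in> dual_lattice m G" if "x \<in> dual_lattice m G" "y \<in> dual_lattice m G" for x y
    proof -
      have "gram_form m G (\<lambda>i. x i - y i) z = gram_form m G x z - gram_form m G y z" for z
        by (simp add: gram_form_def left_diff_distrib sum_subtractf)
      thus ?thesis using that by (simp add: dual_lattice_def)
    qed
    have int_dual: "x \<in> dual_lattice m G" if "x \<in> int_lattice m" for x
      using that unfolding dual_lattice_def int_lattice_def gram_form_def
      by (auto intro!: Ints_sum Ints_mult)
    have \<phi>_sub: "\<phi> (\<lambda>i. x i - y i) = \<phi> x - \<phi> y" if "x \<in> dual_lattice m G" "y \<in> dual_lattice m G" for x y
      using \<phi>_add[OF dual_sub[OF that] that(2)] by simp
    have "bij_betw (\<lambda>x. \<phi> (half x)) {x \<in> V. \<forall>y\<in>V. \<not> b x y} {x. zmul 2 x = 0}"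
      unfolding bij_betw_def
    proof (intro conjI inj_onI set_eqI iffI)
      fix x y assume x: "x \<in> {x \<in> V. \<forall>y\<in>V. \<not> b x y}" and y: "y \<in> {x \<in> V. \<forall>y\<in>V. \<not> b x y}"
        and eq: "\<phi> (half x) = \<phi> (half y)"
      have d: "half x \<in> dual_lattice m G" "half y \<in> dual_lattice m G" using x y by (auto simp: half_dual rad)
      have "(\<lambda>i. half x i - half y i) \<in> int_lattice m"
        using \<phi>_sub[OF d] eq \<phi>_0[OF dual_sub[OF d]] by simp
      hence *: "half x i - half y i \<in> \<int>" if "i < m" for i using that by (simp add: int_lattice_def)
      show "x = y"
      proof
        fix i
        show "x i = y i"
        proof (cases "i < m")
          case True
          have "(1 / 2 :: rat) \<notin> \<int>" "(- (1 / 2) :: rat) \<notin> \<int>"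
            using fraction_not_in_Ints[of 2 1, where ?'a = rat] fraction_not_in_Ints[of 2 "-1", where ?'a = rat] by auto
          thus ?thesis using *[OF True] by (cases "x i"; cases "y i") (auto simp: half_def lift_def)
        qed (use x y in \<open>auto simp: V_def\<close>)
      qed
    next
      fix \<delta> assume "\<delta> \<in> (\<lambda>x. \<phi> (half x)) ` {x \<in> V. \<forall>y\<in>V. \<not> b x y}"
      then obtain x where x: "x \<in> V" "half x \<in> dual_lattice m G" "\<delta> = \<phi> (half x)"
        by (auto simp: half_dual rad)
      have "(\<lambda>i. half x i + half x i) \<in> int_lattice m"
        using x(1) by (auto simp: int_lattice_def half_def V_def lift_def)
      hence "\<delta> + \<delta> = 0" using \<phi>_add[OF x(2,2)] \<phi>_0[OF int_dual] x(3) by simp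
      thus "\<delta> \<in> {x. zmul 2 x = 0}" using zmul_add_left[of 1 1 \<delta>] by simp
    next
      fix \<delta> :: 'd assume "\<delta> \<in> {x. zmul 2 x = 0}"
      hence \<delta>: "\<delta> + \<delta> = 0" using zmul_add_left[of 1 1 \<delta>] by simp
      obtain z where z: "z \<in> dual_lattice m G" "\<delta> = \<phi> z" using \<phi>_surj by (metis UNIV_I imageE)
      have zz: "(\<lambda>i. z i + z i) \<in> dual_lattice m G"
        using dual_sub[OF z(1) dual_sub[OF int_dual z(1)], of "\<lambda>i. 0"] by (simp add: int_lattice_def)
      hence "(\<lambda>i. z i + z i) \<in> int_lattice m" using \<phi>_0[OF zz] \<phi>_add[OF z(1,1)] \<delta> z(2) by simp
      hence zi: "z i + z i \<in> \<int>" "i \<ge> m \<Longrightarrow> z i + z i = 0" for i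
        unfolding int_lattice_def by (cases "i < m"; simp)+
      \<comment> \<open>As 2 z is integral, the floor is exact; the reduction of w = 2 z modulo 2 is
        the wanted preimage.\<close>
      define w where "w i = \<lfloor>z i + z i\<rfloor>" for i
      have w: "z i + z i = of_int (w i)" "i \<ge> m \<Longrightarrow> w i = 0" for i
        using zi[of i] by (auto simp: w_def elim!: Ints_cases)
      define x where "x i = (of_int (w i) :: bit)" for i
      have xV: "x \<in> V" by (auto simp: V_def x_def w(2))
      have "z i - half x i \<in> \<int>" for i
      proof -
        have "even (w i - lift (x i))"
          unfolding of_int_bit_eq_0_iff[symmetric] by (simp add: x_def)
        then obtain l where "w i - lift (x i) = 2 * l" ..
        hence "of_int (w i) - of_int (lift (x i)) = (2 * of_int l :: rat)" by (metis of_int_diff of_int_mult of_int_numeral)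
        hence "z i - half x i = of_int l" using w(1)[of i] by (simp add: half_def field_simps)
        thus ?thesis by simp
      qed
      moreover have "z i - half x i = 0" if "i \<ge> m" for i
        using w[of i] that by (simp add: half_def x_def lift_def)
      ultimately have zx: "(\<lambda>i. z i - half x i) \<in> int_lattice m" by (simp add: int_lattice_def)
      have hx: "half x \<in> dual_lattice m G"
        using dual_sub[OF z(1) int_dual[OF zx]] by simp
      have "\<phi> z = \<phi> (half x)" using \<phi>_sub[OF z(1) hx] \<phi>_0[OF int_dual[OF zx]] zx by simp
      thus "\<delta> \<in> (\<lambda>x. \<phi> (half x)) ` {x \<in> V. \<forall>y\<in>V. \<not> b x y}"
        using z(2) xV hx by (auto simp: half_dual rad)
    qed
    thus ?thesis by (rule bij_betw_same_card)
  qed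
  ultimately show ?thesis using V by simp
qed

end


section \<open>Duality and Jordan splitting\<close>

context disc_form
begin

lemma sum_E_subgrp:
  assumes A: "subgrp A"
  shows "(\<Sum>a\<in>A. E (B a g)) = (if \<forall>a\<in>A. B a g \<in> \<int> then of_nat (card A) else 0)"
proof (cases "\<forall>a\<in>A. B a g \<in> \<int>")
  case True
  hence "(\<Sum>a\<in>A. E (B a g)) = (\<Sum>a\<in>A. 1)" by (intro sum.cong) (auto simp: E_eq_1_iff)
  thus ?thesis using True by simp
next
  case False
  then obtain w where w: "w \<in> A" "B w g \<notin> \<int>" by blast
  have "(\<Sum>a\<in>A. E (B a g)) = (\<Sum>a\<in>A. E (B (w + a) g))"
    using w(1) subgrpD[OF A]
    by (intro sum.reindex_bij_witness[of _ "\<lambda>a. w + a" "\<lambda>a. a - w"]) auto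
  also have "\<dots> = E (B w g) * (\<Sum>a\<in>A. E (B a g))" by (simp add: E_B_add_left sum_distrib_left)
  finally have "(\<Sum>a\<in>A. E (B a g)) = 0 \<or> E (B w g) = 1" by simp
  thus ?thesis unfolding if_not_P[OF False] using w(2) by (simp add: E_eq_1_iff)
qed

text \<open>The character sum over A \<times> G is evaluated in both orders; each inner sum is a
  group order or 0.\<close>

lemma perp_card:
  assumes "subgrp A" "subgrp G"
  shows "card A * card {g \<in> G. \<forall>a\<in>A. B a g \<in> \<int>} = card G * card {a \<in> A. \<forall>g\<in>G. B a g \<in> \<int>}"
proof -
  have "(\<Sum>g\<in>G. \<Sum>a\<in>A. E (B a g)) = (\<Sum>g\<in>G. if \<forall>a\<in>A. B a g \<in> \<int> then of_nat (card A) else 0)"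
    by (simp add: sum_E_subgrp[OF assms(1)])
  also have "\<dots> = of_nat (card A * card {g \<in> G. \<forall>a\<in>A. B a g \<in> \<int>})"
    by (simp add: sum.If_cases Int_def)
  finally have 1: "(\<Sum>g\<in>G. \<Sum>a\<in>A. E (B a g)) = of_nat (card A * card {g \<in> G. \<forall>a\<in>A. B a g \<in> \<int>})" .
  have "(\<Sum>g\<in>G. \<Sum>a\<in>A. E (B a g)) = (\<Sum>a\<in>A. \<Sum>g\<in>G. E (B g a))"
    by (subst sum.swap) (simp only: B_commute)
  also have "\<dots> = (\<Sum>a\<in>A. if \<forall>g\<in>G. B a g \<in> \<int> then of_nat (card G) else 0)"
  proof (rule sum.cong[OF refl])
    fix a
    show "(\<Sum>g\<in>G. E (B g a)) = (if \<forall>g\<in>G. B a g \<in> \<int> then of_nat (card G) else 0)"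
      using sum_E_subgrp[OF assms(2), of a] by (simp only: B_commute[of _ a])
  qed
  also have "\<dots> = of_nat (card G * card {a \<in> A. \<forall>g\<in>G. B a g \<in> \<int>})"
    by (simp add: sum.If_cases Int_def)
  finally show ?thesis using 1 by (simp only: of_nat_eq_iff)
qed

definition nondeg :: "'d set \<Rightarrow> bool" where
  "nondeg A \<longleftrightarrow> (\<forall>x\<in>A. (\<forall>y\<in>A. B x y \<in> \<int>) \<longrightarrow> x = 0)"

lemma nondeg_UNIV: "nondeg UNIV"
  unfolding nondeg_def using B_nondegenerate by (simp add: B_commute)

text \<open>The complement of the kernel of c is the image of c: one inclusion is formal, and
  \<open>perp_card\<close> for kernel and image against the whole group gives equal orders.\<close>

lemma perp_kernel:
  assumes "\<And>z. zmul c z = 0 \<Longrightarrow> B z x \<in> \<int>"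
  shows "\<exists>y. x = zmul c y"
proof -
  define K where "K = {z :: 'd. zmul c z = 0}"
  define I where "I = range (zmul c :: 'd \<Rightarrow> 'd)"
  have sg: "subgrp K" "subgrp I"
    unfolding subgrp_def K_def I_def
    by (auto simp: zmul_diff_right) (auto simp: image_iff simp flip: zmul_diff_right intro: exI[of _ 0])
  have BcI: "B (zmul c y) z \<simeq> B y (zmul c z)" for y z
    using cg_trans[OF B_zmul_left cg_sym[OF B_zmul_right]] .
  have zero: "{a \<in> A. \<forall>g\<in>UNIV. B a g \<in> \<int>} = {0}" if "subgrp A" for A
    using nondeg_UNIV subgrpD(1)[OF that] B_0_left by (auto simp: nondeg_def)
  have IK: "{g \<in> UNIV. \<forall>a\<in>I. B a g \<in> \<int>} = K"
  proof (intro set_eqI iffI)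
    fix g assume "g \<in> {g \<in> UNIV. \<forall>a\<in>I. B a g \<in> \<int>}"
    hence "B y (zmul c g) \<in> \<int>" for y using cg_Ints[OF BcI] by (auto simp: I_def)
    thus "g \<in> K" unfolding K_def using B_nondegenerate by blast
  next
    fix g assume "g \<in> K"
    hence "B (zmul c y) g \<in> \<int>" for y using cg_Ints[OF BcI] B_0_right by (simp add: K_def)
    thus "g \<in> {g \<in> UNIV. \<forall>a\<in>I. B a g \<in> \<int>}" by (auto simp: I_def)
  qed
  define K' where "K' = {g. \<forall>a\<in>K. B a g \<in> \<int>}"
  have "I \<subseteq> K'"
  proof
    fix g assume "g \<in> I"
    then obtain y where y: "g = zmul c y" by (auto simp: I_def)
    have "B a g \<in> \<int>" if "a \<in> K" for a
      using cg_Ints[OF BcI[of a y]] that B_0_left unfolding y K_def by auto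
    thus "g \<in> K'" by (simp add: K'_def)
  qed
  moreover have "card K' = card I"
  proof -
    have "card K * card K' = card K * card I"
      using perp_card[OF sg(1) subgrp_UNIV] perp_card[OF sg(2) subgrp_UNIV]
      by (simp add: zero[OF sg(1), simplified] zero[OF sg(2), simplified] IK[simplified] K'_def mult.commute)
    moreover have "K \<noteq> {}" using subgrpD(1)[OF sg(1)] by auto
    ultimately show ?thesis by simp
  qed
  ultimately have "I = K'" by (intro card_subset_eq) auto
  moreover have "x \<in> K'" using assms by (simp add: K'_def K_def)
  ultimately show ?thesis by (auto simp: I_def)
qed

end

text \<open>Besides the basis, this records the facts about order, divisibility and 2-torsion that
  later arguments use, so that these can avoid coordinates; \<open>homog_extend\<close> maintains
  them when a cyclic summand is added.\<close>

definition homog :: "'a::ab_group_add set \<Rightarrow> nat \<Rightarrow> nat \<Rightarrow> bool" where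
  "homog A s n \<longleftrightarrow> subgrp A \<and> homogeneous_subgroup A (2 ^ s) n \<and> (\<forall>a\<in>A. zmul (2 ^ s) a = 0) \<and>
     (\<forall>a\<in>A. zmul 2 a = 0 \<longrightarrow> (\<exists>a'\<in>A. a = zmul (2 ^ (s - 1)) a')) \<and>
     card {a \<in> A. zmul 2 a = 0} = 2 ^ n"

lemma homog_0: "homog {0} s 0"
proof -
  have "bij_betw (\<lambda>c. \<Sum>i<0. nmul (c i) (b i)) ({..<0::nat} \<rightarrow>\<^sub>E {..<2 ^ s :: nat}) {0 :: 'a}" for b
    by (simp add: bij_betw_def)
  hence "homogeneous_subgroup {0 :: 'a} (2 ^ s) 0" unfolding homogeneous_subgroup_def by blast
  moreover have "{a :: 'a. a = 0 \<and> zmul 2 a = 0} = {0}" by auto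
  ultimately show ?thesis by (simp add: homog_def subgrp_def)
qed

text \<open>By \<open>ind\<close>, x has order exactly 2^s and generates a group that meets A
  trivially, so the sum is direct. Its 2-torsion consists of that of A and its translate by the
  involution w = 2^(s-1) x.\<close>

lemma homog_extend:
  fixes A :: "'a::{ab_group_add,finite} set"
  assumes A: "homog A s n" and s: "s \<ge> 1" and x: "zmul (2 ^ s) x = 0"
    and ind: "\<And>k. zmul k x \<in> A \<Longrightarrow> 2 ^ s dvd k"
  shows "homog {a + zmul k x | a k. a \<in> A} s (Suc n)"
proof -
  define A' where "A' = {a + zmul k x | a k. a \<in> A}"
  have sgA: "subgrp A" and A_ord: "\<And>a. a \<in> A \<Longrightarrow> zmul (2 ^ s) a = 0"
    and A_div: "\<And>a. a \<in> A \<Longrightarrow> zmul 2 a = 0 \<Longrightarrow> \<exists>a'\<in>A. a = zmul (2 ^ (s - 1)) a'"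
    and A_card: "card {a \<in> A. zmul 2 a = 0} = 2 ^ n"
    using A by (auto simp: homog_def)
  obtain b where b: "\<And>i. i < n \<Longrightarrow> nmul (2 ^ s) (b i) = 0"
    "bij_betw (\<lambda>c. \<Sum>i<n. nmul (c i) (b i)) ({..<n} \<rightarrow>\<^sub>E {..<2 ^ s}) A"
    using A by (auto simp: homog_def homogeneous_subgroup_def)
  note sg = subgrpD[OF sgA]
  define w where "w = zmul (2 ^ (s - 1)) x"
  have s2: "2 ^ s = 2 * (2 ^ (s - 1) :: int)" using s by (simp flip: power_Suc)
  have sgA': "subgrp A'"
    unfolding subgrp_def
  proof (intro conjI ballI)
    show "0 \<in> A'" using sg(1) unfolding A'_def by (force intro: exI[of _ 0])
    fix y z assume "y \<in> A'" "z \<in> A'"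
    then obtain a k a' k' where "a \<in> A" "a' \<in> A" "y = a + zmul k x" "z = a' + zmul k' x"
      by (auto simp: A'_def)
    hence "y - z = (a - a') + zmul (k - k') x" "a - a' \<in> A" using sg by (auto simp: zmul_diff_left)
    thus "y - z \<in> A'" unfolding A'_def by blast
  qed
  have ord: "zmul (2 ^ s) y = 0" if "y \<in> A'" for y
    using that A_ord x by (auto simp: A'_def zmul_add_right zmul_commute[of "2 ^ s" _ x])
  have tors: "\<exists>l. k = 2 ^ (s - 1) * l" "zmul 2 a = 0" if "a \<in> A" "zmul 2 (a + zmul k x) = 0" for a k
  proof -
    have eq: "zmul 2 a = - zmul (2 * k) x"
      using that(2) by (simp add: zmul_add_right zmul_mult eq_neg_iff_add_eq_0)
    hence "zmul (2 * k) x \<in> A" using subgrp_zmul[OF sgA that(1), of 2] sg(3) by force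
    from ind[OF this] show l: "\<exists>l. k = 2 ^ (s - 1) * l" unfolding s2 by auto
    then obtain l where "k = 2 ^ (s - 1) * l" ..
    hence "zmul (2 * k) x = zmul l (zmul (2 ^ s) x)" by (simp add: s2 mult_ac flip: zmul_mult)
    thus "zmul 2 a = 0" using eq x by simp
  qed
  have div: "\<exists>a'\<in>A'. y = zmul (2 ^ (s - 1)) a'" if "y \<in> A'" and y2: "zmul 2 y = 0" for y
  proof -
    obtain a k where ak: "a \<in> A" "y = a + zmul k x" using \<open>y \<in> A'\<close> by (auto simp: A'_def)
    obtain l where "k = 2 ^ (s - 1) * l" using tors(1)[OF ak(1)] y2 ak(2) by blast
    moreover obtain a' where "a' \<in> A" "a = zmul (2 ^ (s - 1)) a'"
      using A_div[OF ak(1)] tors(2)[OF ak(1)] y2 ak(2) by blast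
    ultimately have "y = zmul (2 ^ (s - 1)) (a' + zmul l x)" "a' + zmul l x \<in> A'"
      unfolding ak(2) A'_def by (auto simp: zmul_add_right zmul_mult)
    thus ?thesis by blast
  qed
  have w2: "zmul 2 w = 0" using x by (simp add: w_def s2 flip: zmul_mult)
  have wA: "w \<notin> A"
  proof
    assume "w \<in> A"
    from ind[OF this[unfolded w_def]] have "(2::int) ^ s \<le> 2 ^ (s - 1)" by (rule zdvd_imp_le) simp
    thus False unfolding s2 by simp
  qed
  have card: "card {a \<in> A'. zmul 2 a = 0} = 2 ^ Suc n"
  proof -
    define K where "K = {a \<in> A. zmul 2 a = 0}"
    have "{a \<in> A'. zmul 2 a = 0} = K \<union> (\<lambda>a. a + w) ` K"
    proof (intro set_eqI iffI)
      fix y assume "y \<in> {a \<in> A'. zmul 2 a = 0}"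
      then obtain a k where y: "zmul 2 y = 0" "a \<in> A" "y = a + zmul k x" by (auto simp: A'_def)
      obtain l where l: "k = 2 ^ (s - 1) * l" using tors(1)[OF y(2)] y(1,3) by blast
      have aK: "a \<in> K" using tors(2)[OF y(2)] y by (auto simp: K_def)
      have kx: "zmul k x = zmul l w" by (simp add: l w_def mult.commute flip: zmul_mult)
      show "y \<in> K \<union> (\<lambda>a. a + w) ` K"
      proof (cases "even l")
        case True
        then obtain l' where "l = l' * 2" by (metis dvdE mult.commute)
        hence "zmul l w = 0" by (simp add: zmul_mult w2)
        thus ?thesis using aK y(3) kx by simp
      next
        case False
        then obtain l' where "l = l' * 2 + 1" by (metis oddE mult.commute)
        hence "zmul l w = w" by (simp add: zmul_add_left zmul_mult w2)
        thus ?thesis using aK y(3) kx by simp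
      qed
    next
      fix y assume "y \<in> K \<union> (\<lambda>a. a + w) ` K"
      moreover have "a + w \<in> A'" "a \<in> A'" if "a \<in> K" for a
      proof -
        have "a = a + zmul 0 x" by simp
        thus "a + w \<in> A'" "a \<in> A'" using that unfolding A'_def K_def w_def by blast+
      qed
      ultimately show "y \<in> {a \<in> A'. zmul 2 a = 0}" using w2 by (auto simp: K_def zmul_add_right)
    qed
    moreover have "K \<inter> (\<lambda>a. a + w) ` K = {}"
      using wA sg(2) unfolding K_def by (fastforce simp: algebra_simps)
    moreover have "card ((\<lambda>a. a + w) ` K) = card K" by (intro card_image inj_onI) simp
    ultimately show ?thesis using A_card by (simp add: card_Un_disjoint K_def)
  qed
  define b' where "b' = b(n := x)"
  have sum: "(\<Sum>i<Suc n. nmul (c i) (b' i)) = (\<Sum>i<n. nmul (c i) (b i)) + zmul (int (c n)) x" for c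
  proof -
    have "(\<Sum>i<n. nmul (c i) (b' i)) = (\<Sum>i<n. nmul (c i) (b i))" by (intro sum.cong) (auto simp: b'_def)
    thus ?thesis by (simp add: b'_def zmul_of_nat)
  qed
  have restr: "(\<Sum>i<n. nmul (restrict c {..<n} i) (b i)) = (\<Sum>i<n. nmul (c i) (b i))" for c
    by (intro sum.cong) auto
  have restr_in: "restrict c {..<n} \<in> {..<n} \<rightarrow>\<^sub>E {..<2 ^ s}" if "c \<in> {..<Suc n} \<rightarrow>\<^sub>E {..<2 ^ s}" for c :: "nat \<Rightarrow> nat"
    using that by (simp add: restrict_PiE_iff PiE_iff)
  have inA: "(\<Sum>i<n. nmul (c i) (b i)) \<in> A" if "c \<in> {..<Suc n} \<rightarrow>\<^sub>E {..<2 ^ s}" for c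
    using bspec[OF bij_betwE[OF b(2)] restr_in[OF that]] unfolding restr .
  have "bij_betw (\<lambda>c. \<Sum>i<Suc n. nmul (c i) (b' i)) ({..<Suc n} \<rightarrow>\<^sub>E {..<2 ^ s}) A'"
    unfolding bij_betw_def
  proof (intro conjI inj_onI set_eqI iffI)
    fix c c' assume c: "c \<in> {..<Suc n} \<rightarrow>\<^sub>E {..<2 ^ s :: nat}" and c': "c' \<in> {..<Suc n} \<rightarrow>\<^sub>E {..<2 ^ s :: nat}"
      and eq: "(\<Sum>i<Suc n. nmul (c i) (b' i)) = (\<Sum>i<Suc n. nmul (c' i) (b' i))"
    have "zmul (int (c n) - int (c' n)) x = (\<Sum>i<n. nmul (c' i) (b i)) - (\<Sum>i<n. nmul (c i) (b i))"
      using eq unfolding sum by (simp add: zmul_diff_left algebra_simps)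
    also have "\<dots> \<in> A" by (rule sg(2)[OF inA[OF c'] inA[OF c]])
    finally have "2 ^ s dvd int (c n) - int (c' n)" by (rule ind)
    hence "int (c n) mod 2 ^ s = int (c' n) mod 2 ^ s" by (simp only: mod_eq_dvd_iff)
    moreover have "c n \<in> {..<2 ^ s}" "c' n \<in> {..<2 ^ s}"
      by (rule PiE_mem[OF c], simp, rule PiE_mem[OF c'], simp)
    hence "int (c n) < 2 ^ s" "int (c' n) < 2 ^ s"
      by (metis lessThan_iff of_nat_less_iff of_nat_numeral of_nat_power)+
    ultimately have n: "c n = c' n" by simp
    hence "(\<Sum>i<n. nmul (restrict c {..<n} i) (b i)) = (\<Sum>i<n. nmul (restrict c' {..<n} i) (b i))"
      using eq unfolding sum restr by simp
    hence "restrict c {..<n} = restrict c' {..<n}"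
      by (rule inj_onD[OF bij_betw_imp_inj_on[OF b(2)] _ restr_in[OF c] restr_in[OF c']])
    hence lt: "c i = c' i" if "i < n" for i using that by (metis lessThan_iff restrict_apply')
    show "c = c'"
    proof
      fix i show "c i = c' i"
        using lt[of i] n c c' by (cases "i < n"; cases "i = n") (auto simp: PiE_def extensional_def)
    qed
  next
    fix y assume "y \<in> (\<lambda>c. \<Sum>i<Suc n. nmul (c i) (b' i)) ` ({..<Suc n} \<rightarrow>\<^sub>E {..<2 ^ s})"
    then obtain c where c: "c \<in> {..<Suc n} \<rightarrow>\<^sub>E {..<2 ^ s}" "y = (\<Sum>i<Suc n. nmul (c i) (b' i))" ..
    show "y \<in> A'" unfolding A'_def c(2) sum using inA[OF c(1)] by blast
  next
    fix y assume "y \<in> A'"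
    then obtain a k where ak: "a \<in> A" "y = a + zmul k x" by (auto simp: A'_def)
    have "a \<in> (\<lambda>c. \<Sum>i<n. nmul (c i) (b i)) ` ({..<n} \<rightarrow>\<^sub>E {..<2 ^ s})"
      using ak(1) unfolding bij_betw_imp_surj_on[OF b(2)] .
    then obtain c0 where c0: "c0 \<in> {..<n} \<rightarrow>\<^sub>E {..<2 ^ s}" "a = (\<Sum>i<n. nmul (c0 i) (b i))" ..
    define c where "c = c0(n := nat (k mod 2 ^ s))"
    have "nat (k mod 2 ^ s) < 2 ^ s" by (simp add: nat_less_iff)
    hence cn: "c n \<in> {..<2 ^ s}" by (simp add: c_def)
    have "c \<in> {..<Suc n} \<rightarrow>\<^sub>E {..<2 ^ s}"
    proof (rule PiE_I)
      fix i assume "i \<in> {..<Suc n}"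
      thus "c i \<in> {..<2 ^ s}"
        using cn PiE_mem[OF c0(1), of i] by (cases "i = n") (simp_all add: c_def)
    next
      fix i assume "i \<notin> {..<Suc n}"
      thus "c i = undefined" using PiE_arb[OF c0(1), of i] by (simp add: c_def)
    qed
    moreover have "(\<Sum>i<n. nmul (c i) (b i)) = a" unfolding c0(2) by (intro sum.cong) (auto simp: c_def)
    moreover have "zmul (int (c n)) x = zmul k x"
    proof -
      have "zmul k x = zmul (k div 2 ^ s * 2 ^ s + k mod 2 ^ s) x" by (simp only: div_mult_mod_eq)
      also have "\<dots> = zmul (k mod 2 ^ s) x" unfolding zmul_add_left zmul_mult x by simp
      finally show ?thesis by (simp add: c_def)
    qed
    ultimately show "y \<in> (\<lambda>c. \<Sum>i<Suc n. nmul (c i) (b' i)) ` ({..<Suc n} \<rightarrow>\<^sub>E {..<2 ^ s})"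
      by (intro image_eqI[of _ _ c]) (simp_all only: ak(2) sum)
  qed
  moreover have "nmul (2 ^ s) (b' i) = 0" if "i < Suc n" for i
    using b(1) x that zmul_of_nat[of "2 ^ s" x] by (auto simp: b'_def less_Suc_eq)
  ultimately have "homogeneous_subgroup A' (2 ^ s) (Suc n)" unfolding homogeneous_subgroup_def by blast
  thus ?thesis using sgA' ord div card unfolding homog_def A'_def by blast
qed

context disc_form
begin

text \<open>A is maximal among the homogeneous subgroups for 2^s in G. Maximality gives 2^(s-1) G
  \<subseteq> A; from this A is non-degenerate, so that G is the direct sum of A and its complement
  H. As 2^(s-1) H lies in A \<inter> H = 0, the exponent of H is smaller.\<close>

lemma jordan_split:
  assumes s: "s \<ge> 1" and G: "subgrp G" "nondeg G" "\<And>g. g \<in> G \<Longrightarrow> zmul (2 ^ s) g = 0"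
  shows "\<exists>A n H. A \<subseteq> G \<and> H \<subseteq> G \<and> homog A s n \<and> nondeg A \<and> subgrp H \<and> nondeg H \<and>
    (\<forall>h\<in>H. zmul (2 ^ (s - 1)) h = 0) \<and> orthogonal_sets q A H \<and> bij_betw (\<lambda>(a, h). a + h) (A \<times> H) G"
proof -
  define S where "S = {A. A \<subseteq> G \<and> (\<exists>n. homog A s n)}"
  have "{0} \<in> S" using homog_0 subgrpD(1)[OF G(1)] by (auto simp: S_def)
  moreover have "finite S" by simp
  ultimately obtain A where A: "A \<in> S" "\<And>A'. A' \<in> S \<Longrightarrow> A \<subseteq> A' \<Longrightarrow> A = A'"
    using finite_has_maximal[of S] by blast
  then obtain n where n: "homog A s n" and AG: "A \<subseteq> G" by (auto simp: S_def)
  have sgA: "subgrp A" and A_ord: "\<And>a. a \<in> A \<Longrightarrow> zmul (2 ^ s) a = 0"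
    and A_div: "\<And>a. a \<in> A \<Longrightarrow> zmul 2 a = 0 \<Longrightarrow> \<exists>a'\<in>A. a = zmul (2 ^ (s - 1)) a'"
    using n by (auto simp: homog_def)
  have s2: "2 ^ s = 2 * (2 ^ (s - 1) :: int)" using s by (simp flip: power_Suc)
  have max: "zmul (2 ^ (s - 1)) g \<in> A" if g: "g \<in> G" for g
  proof (rule ccontr)
    assume gA: "zmul (2 ^ (s - 1)) g \<notin> A"
    \<comment> \<open>If k = 2^f l with l odd and f < s, then inverting l modulo 2^s and multiplying
      by 2^(s-1-f) would put 2^(s-1) g into A. So A could be extended by g.\<close>
    have "2 ^ s dvd k" if k: "zmul k g \<in> A" for k
    proof (rule ccontr)
      assume nd: "\<not> 2 ^ s dvd k"
      hence "k \<noteq> 0" by auto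
      then obtain l where "k = 2 ^ multiplicity 2 k * l" "odd l"
        using multiplicity_decompose'[of k 2] by auto
      then obtain f where fl: "k = 2 ^ f * l" "odd l" by blast
      have "f < s"
      proof (rule ccontr)
        assume "\<not> f < s"
        hence "(2::int) ^ s dvd 2 ^ f" by (intro le_imp_power_dvd) simp
        thus False using nd fl(1) by simp
      qed
      have "coprime l (2 ^ s)" using fl(2) by simp
      then obtain u v where uv: "u * l + v * 2 ^ s = 1" using bezout_int[of l "2 ^ s"] by (metis coprime_iff_gcd_eq_1)
      have "2 ^ (s - 1) = 2 ^ (s - 1 - f) * (2 ^ f :: int)" using \<open>f < s\<close> by (simp flip: power_add)
      hence "2 ^ (s - 1) * (u * l + v * 2 ^ s) = (2 ^ (s - 1 - f) * u) * k + (2 ^ (s - 1) * v) * 2 ^ s"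
        by (simp add: fl(1) algebra_simps)
      hence "2 ^ (s - 1) = (2 ^ (s - 1 - f) * u) * k + (2 ^ (s - 1) * v) * 2 ^ s"
        unfolding uv mult_1_right .
      hence "zmul (2 ^ (s - 1)) g = zmul ((2 ^ (s - 1 - f) * u) * k + (2 ^ (s - 1) * v) * 2 ^ s) g"
        by (rule arg_cong)
      also have "\<dots> = zmul (2 ^ (s - 1 - f) * u) (zmul k g)"
        using G(3)[OF g] by (simp only: zmul_add_left zmul_mult) simp
      finally have "zmul (2 ^ (s - 1)) g = zmul (2 ^ (s - 1 - f) * u) (zmul k g)" .
      thus False using gA subgrp_zmul[OF sgA k] by simp
    qed
    hence "homog {a + zmul k g | a k. a \<in> A} s (Suc n)"
      using homog_extend[OF n s G(3)[OF g]] by blast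
    moreover have "{a + zmul k g | a k. a \<in> A} \<subseteq> G"
      using AG g subgrp_zmul[OF G(1)] subgrpD(4)[OF G(1)] by blast
    ultimately have "{a + zmul k g | a k. a \<in> A} \<in> S" by (auto simp: S_def)
    moreover have "A \<subseteq> {a + zmul k g | a k. a \<in> A}"
    proof
      fix a assume "a \<in> A"
      moreover have "a = a + zmul 0 g" by simp
      ultimately show "a \<in> {a + zmul k g | a k. a \<in> A}" by blast
    qed
    ultimately have "A = {a + zmul k g | a k. a \<in> A}" by (rule A(2))
    moreover have "0 + zmul (2 ^ (s - 1)) g \<in> {a + zmul k g | a k. a \<in> A}"
      using subgrpD(1)[OF sgA] by blast
    ultimately show False using gA by simp
  qed
  have nA: "nondeg A"
    unfolding nondeg_def
  proof (intro ballI impI)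
    fix a assume a: "a \<in> A" "\<forall>y\<in>A. B a y \<in> \<int>"
    show "a = 0"
    proof (rule ccontr)
      assume a0: "a \<noteq> 0"
      \<comment> \<open>A non-zero radical element a has a multiple w of order 2. Both w and 2^(s-1)
        g are 2^(s-1)-folds of elements of A; moving this factor across B reduces (w, g) to a
        pairing inside A, against the non-degeneracy of G.\<close>
      define r where "r = (LEAST r. zmul (2 ^ r) a = 0)"
      have r: "zmul (2 ^ r) a = 0" unfolding r_def using A_ord[OF a(1)] by (rule LeastI)
      have "r \<noteq> 0" using r a0 by (metis power_0 zmul_1)
      then obtain r' where r': "r = Suc r'" by (cases r) auto
      define w where "w = zmul (2 ^ r') a"
      have w0: "w \<noteq> 0" using not_less_Least[of r' "\<lambda>r. zmul (2 ^ r) a = 0"] by (auto simp: w_def r' simp flip: r_def)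
      have w2: "zmul 2 w = 0" using r by (simp add: r' w_def flip: zmul_mult)
      have wA: "w \<in> A" unfolding w_def by (rule subgrp_zmul[OF sgA a(1)])
      obtain a' where a': "a' \<in> A" "w = zmul (2 ^ (s - 1)) a'" using A_div[OF wA w2] by blast
      have "B w g \<in> \<int>" if g: "g \<in> G" for g
      proof -
        define t where "t = zmul (2 ^ (s - 1)) g"
        have tA: "t \<in> A" unfolding t_def by (rule max[OF g])
        have "zmul 2 t = 0" using G(3)[OF g] by (simp add: t_def s2 flip: zmul_mult)
        then obtain a'' where a'': "a'' \<in> A" "t = zmul (2 ^ (s - 1)) a''" using A_div[OF tA] by blast
        have "B w g \<simeq> of_int (2 ^ (s - 1)) * B a' g" unfolding a'(2) by (rule B_zmul_left)
        also have "\<dots> \<simeq> B a' t" unfolding t_def by (rule cg_sym[OF B_zmul_right])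
        also have "\<dots> \<simeq> of_int (2 ^ (s - 1)) * B a' a''" unfolding a''(2) by (rule B_zmul_right)
        also have "\<dots> \<simeq> B w a''" unfolding a'(2) by (rule cg_sym[OF B_zmul_left])
        also have "\<dots> \<simeq> of_int (2 ^ r') * B a a''" unfolding w_def by (rule B_zmul_left)
        also have "\<dots> \<simeq> 0" unfolding cg_0_iff using a(2) a''(1) by (intro Ints_mult Ints_of_int) blast
        finally show ?thesis by (simp add: cg_0_iff)
      qed
      thus False using G(2) wA AG w0 unfolding nondeg_def by blast
    qed
  qed
  define H where "H = {g \<in> G. \<forall>a\<in>A. B a g \<in> \<int>}"
  have sgH: "subgrp H"
    unfolding subgrp_def
  proof (intro conjI ballI)
    show "0 \<in> H" using subgrpD(1)[OF G(1)] B_0_right by (simp add: H_def)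
    fix x y assume xy: "x \<in> H" "y \<in> H"
    have "B a (x - y) \<in> \<int>" if "a \<in> A" for a
    proof -
      have "B a (x + - y) \<simeq> B a x + - B a y"
        by (intro cg_trans[OF B_add_right] cg_add B_minus_right cg_refl)
      moreover have "B a x + - B a y \<in> \<int>" using xy that by (auto simp: H_def)
      ultimately show ?thesis by (simp add: cg_Ints)
    qed
    thus "x - y \<in> H" using xy subgrpD(2)[OF G(1)] by (simp add: H_def)
  qed
  have AH: "x = 0" if "x \<in> A" "x \<in> H" for x
    using nA that unfolding nondeg_def H_def by (simp add: B_commute)
  have inj: "inj_on (\<lambda>(a, h). a + h) (A \<times> H)"
  proof (rule inj_onI; clarify)
    fix a h a' h' assume *: "a \<in> A" "h \<in> H" "a' \<in> A" "h' \<in> H" "a + h = a' + h'"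
    have "a - a' \<in> A" using * subgrpD(2)[OF sgA] by blast
    moreover have "a - a' = h' - h" using *(5) by (simp add: algebra_simps)
    moreover have "h' - h \<in> H" using * subgrpD(2)[OF sgH] by blast
    ultimately have "a - a' = 0" using AH by metis
    thus "a = a' \<and> h = h'" using *(5) by simp
  qed
  have "{a \<in> A. \<forall>g\<in>G. B a g \<in> \<int>} = {0}"
    using nA AG subgrpD(1)[OF sgA] B_0_left unfolding nondeg_def by blast
  hence "card A * card H = card G" using perp_card[OF sgA G(1)] by (simp add: H_def)
  hence "card ((\<lambda>(a, h). a + h) ` (A \<times> H)) = card G" using inj by (simp add: card_image card_cartesian_product)
  moreover have "(\<lambda>(a, h). a + h) ` (A \<times> H) \<subseteq> G"
    using AG subgrpD(4)[OF G(1)] by (auto simp: H_def)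
  ultimately have img: "(\<lambda>(a, h). a + h) ` (A \<times> H) = G" by (intro card_subset_eq) auto
  have "zmul (2 ^ (s - 1)) h = 0" if "h \<in> H" for h
    using AH max subgrp_zmul[OF sgH that] that by (simp add: H_def)
  moreover have "nondeg H"
    unfolding nondeg_def
  proof (intro ballI impI)
    fix x assume x: "x \<in> H" "\<forall>y\<in>H. B x y \<in> \<int>"
    have "B x g \<in> \<int>" if g: "g \<in> G" for g
    proof -
      have "g \<in> (\<lambda>(a, h). a + h) ` (A \<times> H)" unfolding img by (rule g)
      then obtain a h where ah: "a \<in> A" "h \<in> H" "g = a + h" by auto
      have "B x a \<in> \<int>" using x(1) ah(1) by (simp add: H_def B_commute)
      moreover have "B x h \<in> \<int>" using x(2) ah(2) by blast
      ultimately show ?thesis using cg_Ints[OF B_add_right[of x a h]] ah(3) by simp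
    qed
    thus "x = 0" using G(2) x(1) unfolding nondeg_def H_def by blast
  qed
  moreover have "orthogonal_sets q A H" by (auto simp: orthogonal_sets_def H_def)
  moreover have "bij_betw (\<lambda>(a, h). a + h) (A \<times> H) G" using inj img by (simp add: bij_betw_def)
  moreover have "H \<subseteq> G" by (auto simp: H_def)
  ultimately show ?thesis using AG n nA sgH by blast
qed

end


section \<open>The exceptional 2-adic type\<close>

text \<open>Half-integers modulo 1 are a copy of the field of two elements. This supplies the
  additivity in \<open>alternating_card\<close>.\<close>

lemma half_Ints_add:
  fixes r s :: rat
  assumes "2 * r \<in> \<int>" "2 * s \<in> \<int>"
  shows "r + s \<notin> \<int> \<longleftrightarrow> (r \<notin> \<int>) \<noteq> (s \<notin> \<int>)"
proof -
  obtain m n where mn: "2 * r = of_int m" "2 * s = of_int n" using assms by (auto elim!: Ints_cases)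
  have even: "t \<in> \<int> \<longleftrightarrow> even l" if "2 * t = of_int l" for t :: rat and l
  proof
    assume "t \<in> \<int>"
    then obtain k where "t = of_int k" by (auto elim: Ints_cases)
    hence "of_int l = (of_int (2 * k) :: rat)" using that by simp
    thus "even l" by (simp only: of_int_eq_iff) simp
  next
    assume "even l"
    then obtain k where "l = 2 * k" ..
    hence "t = of_int k" using that by simp
    thus "t \<in> \<int>" by simp
  qed
  have "2 * (r + s) = of_int (m + n)" using mn by (simp add: algebra_simps)
  from even[OF this] even[OF mn(1)] even[OF mn(2)] show ?thesis by auto
qed

lemma odd_half_not_Ints: "odd w \<Longrightarrow> (of_int w / 2 :: rat) \<notin> \<int>"
  using fraction_not_in_Ints[of 2 w, where ?'a = rat] by simp

context disc_form
begin

lemma odd_zmul_2_torsion: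
  assumes "zmul 2 x = (0 :: 'd)" "odd w"
  shows "zmul w x = x"
proof -
  obtain l where "w = l * 2 + 1" using assms(2) by (metis oddE mult.commute)
  thus ?thesis using assms(1) by (simp add: zmul_add_left zmul_mult)
qed

lemma q_2_torsion:
  assumes "zmul 2 x = 0"
  shows "4 * q x \<in> \<int>"
  using cg_Ints[OF q_zmul[of 2 x]] q_0 assms by simp

lemma two_q_zmul: "2 * q (zmul n x) \<simeq> of_int (2 * n\<^sup>2) * q x"
proof -
  have "of_int 2 * q (zmul n x) \<simeq> of_int 2 * (of_int (n\<^sup>2) * q x)" by (intro cg_mult q_zmul)
  thus ?thesis by (simp add: mult.assoc)
qed

text \<open>2^(2\<nu>) q(z) is integral since 2^\<nu> kills z, and N q(z) by definition of the
  level; the greatest common divisor of the two factors is 2^\<nu>.\<close>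

lemma q_dyadic_part:
  assumes N: "level q = 2 ^ \<nu> * N'" "odd N'" and z: "zmul (2 ^ \<nu>) z = 0"
  shows "of_int (2 ^ \<nu>) * q z \<in> \<int>"
proof (rule Ints_coprime)
  have "of_int ((2 ^ \<nu>)\<^sup>2) * q z \<in> \<int>" using cg_Ints[OF q_zmul[of "2 ^ \<nu>" z]] q_0 z by simp
  thus "of_int (2 ^ \<nu>) * (of_int (2 ^ \<nu>) * q z) \<in> \<int>" by (simp add: power2_eq_square mult.assoc)
  show "of_int (int N') * (of_int (2 ^ \<nu>) * q z) \<in> \<int>" using level_q[of z] N(1) by (simp add: mult_ac)
  show "coprime (2 ^ \<nu>) (int N')" using N(2) by simp
qed

text \<open>y is the 2-part of an index causing a pole at a cusp with c congruent to 2 modulo 4, and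
  \<open>coset\<close> is the support condition there. Testing it on suitable 2-torsion elements
  leaves only \<nu> = 3 and s = 2. In this case y minus a double 2 v is 2-torsion and characteristic
  for q on the 2-torsion.\<close>

lemma dyadic_exceptional:
  assumes N: "level q = 2 ^ \<nu> * N'" "odd N'" and \<nu>: "\<nu> \<ge> 3"
    and y: "zmul (2 ^ s) y = 0" "q y \<simeq> of_int w / of_int (2 ^ s)" "odd w"
    and s: "s = \<nu> \<or> s = \<nu> - 1"
    and coset: "\<And>h. zmul 2 h = 0 \<Longrightarrow> B h y + 2 * q h \<in> \<int>"
  shows "\<nu> = 3 \<and> (\<exists>y'. zmul 2 y' = 0 \<and> 2 * q y' \<simeq> 1 / 2 \<and> (\<forall>h. zmul 2 h = 0 \<longrightarrow> B h y' \<simeq> 2 * q h))"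
proof -
  \<comment> \<open>Below, m + 1 and m + 2 stand for \<nu>-2 and \<nu>-1.\<close>
  obtain m where m: "\<nu> = m + 3" using \<nu> by (metis add.commute le_Suc_ex)
  have N2: "zmul (2 ^ \<nu>) (zmul (int N') z) = 0" for z :: 'd
    using level_zmul[of z] by (simp add: N(1) flip: zmul_mult)
  have "s \<noteq> \<nu>"
  proof
    assume "s = \<nu>"
    note y' = y(1,2)[unfolded this]
    define A where "A = zmul (2 ^ (m + 2)) y"
    show False
    \<comment> \<open>If 2^(\<nu>-1) y = 0, then h = 2^(\<nu>-2) y is 2-torsion with (h, y) = w/2
      and 2 q(h) integral. Otherwise some z pairs non-integrally with A, and h = 2^(\<nu>-1) N' z
      gives the contradiction.\<close>
    proof (cases "A = 0")
      case True
      define h where "h = zmul (2 ^ (m + 1)) y"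
      have "zmul 2 h = 0" using True by (simp add: h_def A_def flip: zmul_mult)
      note * = coset[OF this]
      have "B h y \<simeq> of_int (2 ^ (m + 1)) * (2 * q y)"
        unfolding h_def by (intro cg_trans[OF B_zmul_left] cg_mult B_self)
      also have "\<dots> = of_int (2 ^ (m + 2)) * q y" by simp
      also have "\<dots> \<simeq> of_int (2 ^ (m + 2)) * (of_int w / of_int (2 ^ \<nu>))" by (rule cg_mult[OF y'(2)])
      also have "\<dots> = of_int w / 2" by (simp add: m power_add)
      finally have 1: "B h y \<simeq> of_int w / 2" .
      have "2 * q h \<simeq> of_int (2 * (2 ^ (m + 1))\<^sup>2) * q y"
        unfolding h_def by (rule two_q_zmul)
      also have "\<dots> = of_int (2 * 2 ^ (2 * m + 2)) * q y" by (simp add: power_add power_mult power2_eq_square mult_ac)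
      also have "\<dots> \<simeq> of_int (2 * 2 ^ (2 * m + 2)) * (of_int w / of_int (2 ^ \<nu>))" by (rule cg_mult[OF y'(2)])
      also have "2 * 2 ^ (2 * m + 2) = (2 ^ Suc (2 * m + 2) :: int)" by (rule power_Suc[symmetric])
      also have "Suc (2 * m + 2) = m + \<nu>" using m by simp
      also have "2 ^ (m + \<nu>) = (2 ^ m * 2 ^ \<nu> :: int)" by (rule power_add)
      also have "of_int (2 ^ m * 2 ^ \<nu>) * (of_int w / of_int (2 ^ \<nu>)) = (of_int (2 ^ m * w) :: rat)" by simp
      also have "\<dots> \<simeq> 0" unfolding cg_0_iff by (rule Ints_of_int)
      finally have "B h y + 2 * q h \<simeq> of_int w / 2 + 0" by (intro cg_add 1)
      thus False using * odd_half_not_Ints[OF y(3)] cg_Ints by simp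
    next
      case False
      then obtain z where z: "B z A \<notin> \<int>" using B_nondegenerate by blast
      define z' where "z' = zmul (int N') z"
      define h where "h = zmul (2 ^ (m + 2)) z'"
      have "zmul 2 h = 0" using N2[of z] by (simp add: h_def z'_def m power_add mult_ac flip: zmul_mult)
      note * = coset[OF this]
      have "2 * q h \<simeq> of_int (2 * (2 ^ (m + 2))\<^sup>2) * q z'"
        unfolding h_def by (rule two_q_zmul)
      also have "\<dots> = of_int (2 ^ (m + 2)) * (of_int (2 ^ \<nu>) * q z')"
        by (simp add: m power_add power2_eq_square mult_ac)
      also have "\<dots> \<simeq> 0" unfolding cg_0_iff
        unfolding z'_def by (rule Ints_mult[OF Ints_of_int q_dyadic_part[OF N N2]])
      finally have "B h y + 2 * q h \<simeq> B h y + 0" by (intro cg_add cg_refl)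
      hence "B h y \<in> \<int>" using * cg_Ints by simp
      have "B h y \<simeq> of_int (2 ^ (m + 2)) * (of_int (int N') * B z y)"
        unfolding h_def z'_def by (intro cg_trans[OF B_zmul_left] cg_mult B_zmul_left)
      also have "\<dots> = of_int (int N') * (of_int (2 ^ (m + 2)) * B z y)" by simp
      also have "\<dots> \<simeq> of_int (int N') * B z A" unfolding A_def by (rule cg_mult[OF cg_sym[OF B_zmul_right]])
      finally have "of_int (int N') * B z A \<in> \<int>" using \<open>B h y \<in> \<int>\<close> cg_Ints by blast
      moreover have "zmul 2 A = 0" using y'(1) by (simp add: A_def m power_add mult_ac flip: zmul_mult)
      hence "of_int 2 * B z A \<in> \<int>" by (rule order_B_right)
      ultimately show False using z Ints_coprime[of "int N'" "B z A" 2] N(2) by simp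
    qed
  qed
  hence s: "s = m + 2" using s m by simp
  note y' = y(1,2)[unfolded s]
  define A where "A = zmul (2 ^ (m + 1)) y"
  \<comment> \<open>By \<open>coset\<close> for h = 2^(\<nu>-2) z, A is orthogonal to the kernel of
    2^(\<nu>-1) and hence a 2^(\<nu>-1)-fold. With the 2-primary v obtained from this, y - 2 v is
    killed by 2^(\<nu>-2).\<close>
  have "\<exists>v. A = zmul (2 ^ (m + 2)) v"
  proof (rule perp_kernel)
    fix z :: 'd assume z: "zmul (2 ^ (m + 2)) z = 0"
    define h where "h = zmul (2 ^ (m + 1)) z"
    have "zmul 2 h = 0" using z by (simp add: h_def flip: zmul_mult)
    note * = coset[OF this]
    have z': "zmul (2 ^ \<nu>) z = 0"
    proof -
      have "zmul (2 ^ \<nu>) z = zmul 2 (zmul (2 ^ (m + 2)) z)" by (simp add: m power_add mult_ac flip: zmul_mult)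
      thus ?thesis using z by simp
    qed
    have "2 * q h \<simeq> of_int (2 * (2 ^ (m + 1))\<^sup>2) * q z"
      unfolding h_def by (rule two_q_zmul)
    also have "\<dots> = of_int (2 ^ m) * (of_int (2 ^ \<nu>) * q z)"
      by (simp add: m power_add power2_eq_square mult_ac)
    also have "\<dots> \<simeq> 0" unfolding cg_0_iff by (rule Ints_mult[OF Ints_of_int q_dyadic_part[OF N z']])
    finally have "B h y + 2 * q h \<simeq> B h y + 0" by (intro cg_add cg_refl)
    hence "B h y \<in> \<int>" using * cg_Ints by simp
    moreover have "B h y \<simeq> B z A"
      unfolding h_def A_def by (rule cg_trans[OF B_zmul_left cg_sym[OF B_zmul_right]])
    ultimately show "B z A \<in> \<int>" using cg_Ints by blast
  qed
  then obtain v0 where v0: "A = zmul (2 ^ (m + 2)) v0" ..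
  define v where "v = zmul (int N') v0"
  have v_ord: "zmul (2 ^ \<nu>) v = 0" unfolding v_def by (rule N2)
  have "zmul 2 A = 0" using y'(1) by (simp add: A_def flip: zmul_mult)
  hence "zmul (int N') A = A" using N(2) by (intro odd_zmul_2_torsion) auto
  hence Av: "A = zmul (2 ^ (m + 2)) v" unfolding v_def v0 by (metis zmul_commute)
  define y1 where "y1 = zmul 1 y + zmul (-2) v"
  have y1_ord: "zmul (2 ^ (m + 1)) y1 = 0"
  proof -
    have "zmul (2 ^ (m + 1)) y1 = A + zmul (- (2 ^ (m + 2))) v"
      by (simp add: y1_def zmul_add_right A_def flip: zmul_mult)
    thus ?thesis by (simp add: Av zmul_minus_left)
  qed
  have q1: "of_int (2 ^ (m + 1)) * q y1 \<simeq> of_int w / 2"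
  proof -
    have "of_int (2 ^ (m + 1)) * q y1 \<simeq> of_int (2 ^ (m + 1)) * (of_int (1\<^sup>2) * q y + of_int ((-2)\<^sup>2) * q v + of_int (1 * (-2)) * B y v)"
      unfolding y1_def by (rule cg_mult[OF q_lincomb])
    also have "\<dots> = of_int (2 ^ (m + 1)) * q y + of_int (2 ^ \<nu>) * q v + - (of_int (2 ^ (m + 2)) * B y v)"
      by (simp add: algebra_simps m power_add)
    also have "\<dots> \<simeq> of_int w / 2 + 0 + - 0"
    proof (intro cg_add cg_minus)
      have "of_int (2 ^ (m + 1)) * q y \<simeq> of_int (2 ^ (m + 1)) * (of_int w / of_int (2 ^ (m + 2)))" by (rule cg_mult[OF y'(2)])
      thus "of_int (2 ^ (m + 1)) * q y \<simeq> of_int w / 2" by (simp add: power_add)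
      show "of_int (2 ^ \<nu>) * q v \<simeq> 0" unfolding cg_0_iff by (rule q_dyadic_part[OF N v_ord])
      have "of_int (2 ^ (m + 2)) * B y v \<simeq> B y A" unfolding Av by (rule cg_sym[OF B_zmul_right])
      also have "B y A \<simeq> of_int (2 ^ (m + 1)) * (2 * q y)"
        unfolding A_def by (intro cg_trans[OF B_zmul_right] cg_mult B_self)
      also have "\<dots> = of_int (2 ^ (m + 2)) * q y" by simp
      also have "\<dots> \<simeq> of_int (2 ^ (m + 2)) * (of_int w / of_int (2 ^ (m + 2)))" by (rule cg_mult[OF y'(2)])
      also have "\<dots> = of_int w" by simp
      also have "\<dots> \<simeq> 0" unfolding cg_0_iff by (rule Ints_of_int)
      finally show "of_int (2 ^ (m + 2)) * B y v \<simeq> 0" .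
    qed
    finally show ?thesis by simp
  qed
  have By: "B h y \<simeq> B h y1 + of_int 2 * B h v" for h
  proof -
    have "y = y1 + zmul 2 v" by (simp add: y1_def zmul_minus_left)
    hence "B h y = B h (y1 + zmul 2 v)" by simp
    also have "\<dots> \<simeq> B h y1 + of_int 2 * B h v" by (intro cg_trans[OF B_add_right] cg_add cg_refl B_zmul_right)
    finally show ?thesis .
  qed
  have m0: "m = 0"
  proof (rule ccontr)
    assume "m \<noteq> 0"
    then obtain m' where m': "m = Suc m'" by (cases m) auto
    \<comment> \<open>For m > 0 this h violates \<open>coset\<close>: (h, y) = w/2, while 2 q(h) =
      2^m w/2 is integral.\<close>
    define h where "h = zmul (2 ^ m) y1"
    have "zmul 2 h = 0" using y1_ord by (simp add: h_def flip: zmul_mult)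
    note * = coset[OF this]
    have "B h y \<simeq> of_int (2 ^ m) * (B y1 y1 + of_int 2 * B y1 v)"
      unfolding h_def by (intro cg_trans[OF B_zmul_left] cg_mult By)
    also have "\<dots> \<simeq> of_int (2 ^ m) * (2 * q y1 + of_int 2 * B y1 v)" by (intro cg_mult cg_add B_self cg_refl)
    also have "\<dots> = of_int (2 ^ (m + 1)) * q y1 + of_int (2 ^ (m + 1)) * B y1 v" by (simp add: algebra_simps)
    also have "\<dots> \<simeq> of_int w / 2 + 0"
      using order_B[OF y1_ord, of v] by (intro cg_add q1) (simp add: cg_0_iff)
    finally have 1: "B h y \<simeq> of_int w / 2 + 0" .
    have "2 * q h \<simeq> of_int (2 * (2 ^ m)\<^sup>2) * q y1"
      unfolding h_def by (rule two_q_zmul)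
    also have "\<dots> = of_int (2 ^ m) * (of_int (2 ^ (m + 1)) * q y1)"
      by (simp add: power2_eq_square)
    also have "\<dots> \<simeq> of_int (2 ^ m) * (of_int w / 2)" by (rule cg_mult[OF q1])
    also have "\<dots> = of_int (2 ^ m' * w)" by (simp add: m')
    also have "\<dots> \<simeq> 0" unfolding cg_0_iff by (rule Ints_of_int)
    finally have "B h y + 2 * q h \<simeq> of_int w / 2 + 0 + 0" by (intro cg_add 1)
    thus False using * odd_half_not_Ints[OF y(3)] cg_Ints by simp
  qed
  have "zmul 2 y1 = 0" "2 * q y1 \<simeq> of_int w / 2" using y1_ord q1 by (simp_all add: m0)
  moreover have "of_int w / 2 \<simeq> 1 / 2"
  proof -
    obtain l where "w = 2 * l + 1" using y(3) by (elim oddE)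
    hence "of_int w / 2 - 1 / 2 = (of_int l :: rat)" by (simp add: field_simps)
    thus ?thesis unfolding cg_def by simp
  qed
  moreover have "B h y1 \<simeq> 2 * q h" if h: "zmul 2 h = 0" for h
  proof -
    have 1: "of_int 2 * B h v \<in> \<int>" by (rule order_B[OF h])
    have 2: "B h y - (B h y1 + of_int 2 * B h v) \<in> \<int>" using By by (simp add: cg_def)
    have "B h y + 2 * q h - (B h y - (B h y1 + of_int 2 * B h v)) - of_int 2 * B h v - 4 * q h \<in> \<int>"
      by (rule Ints_diff[OF Ints_diff[OF Ints_diff[OF coset[OF h] 2] 1] q_2_torsion[OF h]])
    thus ?thesis by (simp add: cg_def algebra_simps)
  qed
  ultimately show ?thesis using m0 m by (auto intro: cg_trans)
qed

text \<open>As 8 q is integral on A, 4 B modulo 1 is an alternating form with values 0 and 1/2. Its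
  radical is the complement in A of 4 A, and 4 A is the 2-torsion of A. So the radical has index
  2^n, which must be a power of 4.\<close>

lemma even_rank_of_even_type:
  assumes A: "homog A 3 n" "nondeg A" and q: "\<And>x. x \<in> A \<Longrightarrow> 8 * q x \<in> \<int>"
  shows "even n"
proof -
  have sg: "subgrp A" and ord: "\<And>x. x \<in> A \<Longrightarrow> zmul 8 x = 0"
    and div: "\<And>a. a \<in> A \<Longrightarrow> zmul 2 a = 0 \<Longrightarrow> \<exists>a'\<in>A. a = zmul 4 a'"
    and card: "card {a \<in> A. zmul 2 a = 0} = 2 ^ n"
    using A(1) by (simp_all add: homog_def)
  define b where "b x y \<longleftrightarrow> 4 * B x y \<notin> \<int>" for x y
  have B4: "4 * B (x + y) z \<simeq> 4 * B x z + 4 * B y z" for x y z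
    using cg_mult[OF B_add_left, of 4] by (simp add: algebra_simps)
  have B8: "2 * (4 * B x y) \<in> \<int>" if "x \<in> A" for x y
    using order_B[OF ord[OF that], of y] by simp
  have "\<exists>k. card A = 4 ^ k * card {x \<in> A. \<forall>y\<in>A. \<not> b x y}"
  proof (rule alternating_card[OF _ sg])
    show "b (x + y) z \<longleftrightarrow> b x z \<noteq> b y z" if "x \<in> A" "y \<in> A" for x y z
      using half_Ints_add[OF B8[OF that(1)] B8[OF that(2)], of z z] cg_Ints[OF B4] by (simp add: b_def)
    show "b x y \<longleftrightarrow> b y x" for x y by (simp add: b_def B_commute)
    show "\<not> b x x" if "x \<in> A" for x
      using cg_Ints[OF cg_mult[OF B_self, of 4 x]] q[OF that] by (simp add: b_def)
  qed simp
  then obtain k where k: "card A = 4 ^ k * card {x \<in> A. \<forall>y\<in>A. \<not> b x y}" ..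
  define I where "I = {a \<in> A. zmul 2 a = 0}"
  have I: "I = zmul 4 ` A"
  proof (intro set_eqI iffI)
    fix a assume "a \<in> I"
    thus "a \<in> zmul 4 ` A" using div unfolding I_def by blast
  next
    fix a assume "a \<in> zmul 4 ` A"
    then obtain a' where "a' \<in> A" "a = zmul 4 a'" by blast
    thus "a \<in> I" using ord[of a'] subgrp_zmul[OF sg] by (simp add: I_def flip: zmul_mult)
  qed
  have sgI: "subgrp I" using subgrpD[OF sg] by (auto simp: subgrp_def I_def zmul_diff_right)
  have "{g \<in> A. \<forall>a\<in>I. B a g \<in> \<int>} = {x \<in> A. \<forall>y\<in>A. \<not> b x y}"
    unfolding I b_def using cg_Ints[OF B_zmul_left[of 4]] by (auto simp: B_commute)
  moreover have "{a \<in> I. \<forall>g\<in>A. B a g \<in> \<int>} = {0}"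
    using A(2) subgrpD(1)[OF sgI] B_0_left by (auto simp: nondeg_def I_def)
  ultimately have "card I * card {x \<in> A. \<forall>y\<in>A. \<not> b x y} = card A"
    using perp_card[OF sgI sg] by simp
  moreover have "0 \<in> {x \<in> A. \<forall>y\<in>A. \<not> b x y}"
    using subgrpD(1)[OF sg] B_0_left by (auto simp: b_def intro: Ints_mult)
  hence "card {x \<in> A. \<forall>y\<in>A. \<not> b x y} \<noteq> 0" by (metis card_0_eq empty_iff finite)
  ultimately have "card I = 4 ^ k" using k by simp
  hence "2 ^ n = (2 :: nat) ^ (2 * k)" using card by (simp add: I_def power_mult)
  thus ?thesis by (simp add: power_inject_exp)
qed

text \<open>In F_2-notation b(x, x) = b(x, u), so b(x, y) + b(x, u) b(y, u) is alternating. Since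
  b(u, u) = 1, its radical is {0, u}. Hence 2^n is twice a power of 4.\<close>

lemma odd_rank_of_characteristic:
  assumes A: "homog A 1 n" "nondeg A" and u: "u \<in> A" "2 * q u \<simeq> 1 / 2"
    and char: "\<And>x. x \<in> A \<Longrightarrow> B x u \<simeq> 2 * q x"
  shows "odd n"
proof -
  have sg: "subgrp A" and ord: "\<And>x. x \<in> A \<Longrightarrow> zmul 2 x = 0"
    and card: "card {a \<in> A. zmul 2 a = 0} = 2 ^ n"
    using A(1) by (simp_all add: homog_def)
  have cardA: "card A = 2 ^ n"
  proof -
    have "{a \<in> A. zmul 2 a = 0} = A" using ord by blast
    thus ?thesis using card by simp
  qed
  define b where "b x y \<longleftrightarrow> B x y \<notin> \<int>" for x y
  have B2: "2 * B x y \<in> \<int>" if "x \<in> A" for x y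
    using order_B[OF ord[OF that], of y] by simp
  have b_add: "b (x + y) z \<longleftrightarrow> b x z \<noteq> b y z" if "x \<in> A" "y \<in> A" for x y z
    using half_Ints_add[OF B2[OF that(1)] B2[OF that(2)], of z z] cg_Ints[OF B_add_left] by (simp add: b_def)
  have b_sym: "b x y \<longleftrightarrow> b y x" for x y by (simp add: b_def B_commute)
  have b_char: "b x u \<longleftrightarrow> b x x" if "x \<in> A" for x
    using cg_Ints[OF char[OF that]] cg_Ints[OF B_self[of x]] by (simp add: b_def)
  have "(1 / 2 :: rat) \<notin> \<int>" using odd_half_not_Ints[of 1] by simp
  hence b_u: "b u u" using cg_Ints[OF B_self[of u]] cg_Ints[OF u(2)] by (simp add: b_def)
  have b_0: "\<not> b 0 x" for x using B_0_left by (simp add: b_def)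
  define b1 where "b1 x y \<longleftrightarrow> b x y \<noteq> (b x u \<and> b y u)" for x y
  have ex: "\<exists>k. card A = 4 ^ k * card {x \<in> A. \<forall>y\<in>A. \<not> b1 x y}"
  proof (rule alternating_card[OF _ sg])
    show "b1 (x + y) z \<longleftrightarrow> b1 x z \<noteq> b1 y z" if "x \<in> A" "y \<in> A" for x y z
      using b_add[OF that] by (auto simp: b1_def)
    show "b1 x y \<longleftrightarrow> b1 y x" for x y by (auto simp: b1_def b_sym)
    show "\<not> b1 x x" if "x \<in> A" for x using b_char[OF that] by (simp add: b1_def)
  qed simp
  have rad: "{x \<in> A. \<forall>y\<in>A. \<not> b1 x y} = {0, u}"
  proof (intro set_eqI iffI)
    fix x assume x: "x \<in> {x \<in> A. \<forall>y\<in>A. \<not> b1 x y}"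
    hence xA: "x \<in> A" and xb: "\<And>y. y \<in> A \<Longrightarrow> b x y \<longleftrightarrow> b x u \<and> b y u" by (auto simp: b1_def)
    show "x \<in> {0, u}"
    proof (cases "b x u")
      case False
      hence "x = 0" using A(2) xA xb unfolding nondeg_def b_def by blast
      thus ?thesis by simp
    next
      case True
      hence "\<not> b (x + u) y" if "y \<in> A" for y
        using b_add[OF xA u(1), of y] xb[OF that] b_sym[of u y] by simp
      hence "x + u = 0" using A(2) subgrpD(4)[OF sg xA u(1)] unfolding nondeg_def b_def by blast
      moreover have "u + u = 0" using ord[OF u(1)] zmul_add_left[of 1 1 u] by simp
      ultimately have "x = u" by (metis add_right_cancel)
      thus ?thesis by simp
    qed
  next
    fix x assume "x \<in> {0, u}"
    thus "x \<in> {x \<in> A. \<forall>y\<in>A. \<not> b1 x y}"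
      using subgrpD(1)[OF sg] u(1) b_0 b_u b_sym by (auto simp: b1_def)
  qed
  have "u \<noteq> 0" using b_u b_0 by blast
  hence "card {0, u} = 2" by simp
  then obtain k where "2 ^ n = 4 ^ k * (2 :: nat)" using ex cardA unfolding rad by metis
  hence "2 ^ n = (2 :: nat) ^ (2 * k + 1)" by (simp add: power_mult)
  hence "n = 2 * k + 1" by (simp only: power_inject_exp)
  thus ?thesis by simp
qed

text \<open>The 2-part is split three times. The rank n8 is even because 8 q is integral on the
  2-part, and positive because \<gamma> is non-zero in D^(N/2). The rank n2 is odd because the
  component of y is characteristic there. The total rank is even as m is, which leaves n4
  odd.\<close>

lemma exceptional_type:
  assumes N: "level q = 8 * N'" "odd N'"
    and reg: "\<gamma> \<in> mul_image (level q div 2)" "\<gamma> \<noteq> (0 :: 'd)"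
    and L: "even_lattice m G bp bm" "has_discriminant_form m G q" "even m"
    and y: "zmul 2 y = 0" "2 * q y \<simeq> 1 / 2" "\<And>h. zmul 2 h = 0 \<Longrightarrow> B h y \<simeq> 2 * q h"
  shows "type_2_4_8II_odd_ranks q"
proof -
  define D2 where "D2 = {x :: 'd. zmul 8 x = 0}"
  have two_adic: "two_adic_part = D2"
  proof (intro set_eqI iffI)
    fix x :: 'd assume "x \<in> two_adic_part"
    then obtain k where "nmul (2 ^ k) x = 0" by (auto simp: two_adic_part_def)
    hence k: "zmul (2 ^ k) x = 0" using zmul_of_nat[of "2 ^ k" x] by simp
    have "zmul (2 ^ k) (zmul 8 x) = 0" using k by (simp add: zmul_commute[of _ 8])
    moreover have "zmul (int N') (zmul 8 x) = 0" using level_zmul[of x] by (simp add: N(1) mult.commute flip: zmul_mult)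
    moreover have "coprime (2 ^ k) (int N')" using N(2) by simp
    ultimately show "x \<in> D2" unfolding D2_def using zmul_eq_0_coprime by blast
  next
    fix x :: 'd assume "x \<in> D2"
    hence "nmul (2 ^ 3) x = 0" using zmul_of_nat[of 8 x] by (simp add: D2_def)
    thus "x \<in> two_adic_part" unfolding two_adic_part_def by blast
  qed
  have N'D2: "zmul (int N') z \<in> D2" for z
    using level_zmul[of z] by (simp add: D2_def N(1) flip: zmul_mult)
  have q8: "8 * q x \<in> \<int>" if "x \<in> D2" for x
    using q_dyadic_part[of 3 N' x] N that by (simp add: D2_def)
  have sg: "subgrp D2" by (simp add: subgrp_def D2_def zmul_diff_right)
  have nd: "nondeg D2"
    unfolding nondeg_def
  proof (intro ballI impI)
    fix x assume x: "x \<in> D2" "\<forall>y\<in>D2. B x y \<in> \<int>"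
    have "B z x \<in> \<int>" for z
    proof (rule Ints_coprime)
      have "B x (zmul (int N') z) \<in> \<int>" using x(2) N'D2 by blast
      thus "of_int (int N') * B z x \<in> \<int>" using cg_Ints[OF B_zmul_right] by (simp add: B_commute)
      show "of_int 8 * B z x \<in> \<int>" using x(1) by (intro order_B_right) (simp add: D2_def)
      show "coprime (int N') 8" using N(2) coprime_power_right_iff[of "int N'" 2 3] by simp
    qed
    thus "x = 0" by (rule B_nondegenerate)
  qed
  obtain A8 n8 H8 where A8: "A8 \<subseteq> D2" "H8 \<subseteq> D2" "homog A8 3 n8" "nondeg A8" "subgrp H8" "nondeg H8"
    "\<And>h. h \<in> H8 \<Longrightarrow> zmul 4 h = 0" "orthogonal_sets q A8 H8" "bij_betw (\<lambda>(a, h). a + h) (A8 \<times> H8) D2"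
    using jordan_split[of 3, OF _ sg nd] by (auto simp: D2_def)
  obtain A4 n4 H4 where A4: "A4 \<subseteq> H8" "H4 \<subseteq> H8" "homog A4 2 n4" "nondeg A4" "subgrp H4" "nondeg H4"
    "\<And>h. h \<in> H4 \<Longrightarrow> zmul 2 h = 0" "orthogonal_sets q A4 H4" "bij_betw (\<lambda>(a, h). a + h) (A4 \<times> H4) H8"
    using jordan_split[of 2, OF _ A8(5,6)] A8(7) by auto
  obtain A2 n2 H2 where A2: "A2 \<subseteq> H4" "H2 \<subseteq> H4" "homog A2 1 n2" "nondeg A2" "subgrp H2"
    "\<And>h. h \<in> H2 \<Longrightarrow> h = 0" "bij_betw (\<lambda>(a, h). a + h) (A2 \<times> H2) H4"
    using jordan_split[of 1, OF _ A4(5,6)] A4(7) by auto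
  \<comment> \<open>The last complement is killed by 2^0, so the elementary part \<open>H4\<close>
    is homogeneous as a whole.\<close>
  have H2: "H2 = {0}" using A2(6) subgrpD(1)[OF A2(5)] by blast
  have sgA: "subgrp A2" "subgrp A4" "subgrp A8" using A2(3) A4(3) A8(3) by (auto simp: homog_def)
  have A2H4: "A2 = H4"
  proof -
    have "(\<lambda>(a, h). a + h) ` (A2 \<times> H2) = A2" by (force simp: H2)
    thus ?thesis using A2(7) by (simp add: bij_betw_def)
  qed
  have orth': "B z x \<in> \<int>" if "x \<in> A2 \<and> z \<in> A4 \<or> x \<in> A2 \<and> z \<in> A8 \<or> x \<in> A4 \<and> z \<in> A8" for x z
    using that A8(8) A4(8) A4(1,2) A2H4 unfolding orthogonal_sets_def by blast
  have orth: "B x z \<in> \<int>" if "x \<in> A2 \<and> z \<in> A4 \<or> x \<in> A2 \<and> z \<in> A8 \<or> x \<in> A4 \<and> z \<in> A8" for x z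
    using orth'[OF that] by (simp only: B_commute[of x])
  have inj: "a2 = b2 \<and> a4 = b4 \<and> a8 = b8"
    if "a2 \<in> A2" "a4 \<in> A4" "a8 \<in> A8" "b2 \<in> A2" "b4 \<in> A4" "b8 \<in> A8" "a2 + a4 + a8 = b2 + b4 + b8"
    for a2 a4 a8 b2 b4 b8
  proof -
    have H: "a4 + a2 \<in> H8" "b4 + b2 \<in> H8" using that A4 A2H4 subgrpD(4)[OF A8(5)] by blast+
    have "a8 + (a4 + a2) = b8 + (b4 + b2)" using that(7) by (simp only: ac_simps)
    hence 1: "(a8, a4 + a2) = (b8, b4 + b2)"
      using inj_onD[OF bij_betw_imp_inj_on[OF A8(9)], of "(a8, a4 + a2)" "(b8, b4 + b2)"] that(3,6) H by simp
    hence "(a4, a2) = (b4, b2)"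
      using inj_onD[OF bij_betw_imp_inj_on[OF A4(9)], of "(a4, a2)" "(b4, b2)"] that(1,2,4,5) A2H4 by simp
    thus ?thesis using 1 by simp
  qed
  have decomp: "\<exists>a2\<in>A2. \<exists>a4\<in>A4. \<exists>a8\<in>A8. x = a2 + a4 + a8" if "x \<in> D2" for x
  proof -
    have "x \<in> (\<lambda>(a, h). a + h) ` (A8 \<times> H8)" using that A8(9) by (simp add: bij_betw_def)
    then obtain a8 h8 where 8: "a8 \<in> A8" "h8 \<in> H8" "x = a8 + h8" by auto
    have "h8 \<in> (\<lambda>(a, h). a + h) ` (A4 \<times> H4)" using 8 A4(9) by (simp add: bij_betw_def)
    then obtain a4 a2 where "a4 \<in> A4" "a2 \<in> A2" "h8 = a4 + a2" using A2H4 by auto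
    moreover from this have "x = a2 + a4 + a8" using 8 by (simp add: algebra_simps)
    ultimately show ?thesis using 8(1) by blast
  qed
  have sum_D2: "a2 + a4 + a8 \<in> D2" if "a2 \<in> A2" "a4 \<in> A4" "a8 \<in> A8" for a2 a4 a8
  proof -
    have "a2 \<in> D2" "a4 \<in> D2" "a8 \<in> D2" using that A8(1,2) A4(1,2) A2H4 by auto
    thus ?thesis by (intro subgrpD(4)[OF sg])
  qed
  have bij: "bij_betw (\<lambda>(x, y, z). x + y + z) (A2 \<times> A4 \<times> A8) two_adic_part"
    unfolding two_adic bij_betw_def
  proof (intro conjI)
    show "inj_on (\<lambda>(x, y, z). x + y + z) (A2 \<times> A4 \<times> A8)" by (rule inj_onI, clarify, use inj in blast)
    show "(\<lambda>(x, y, z). x + y + z) ` (A2 \<times> A4 \<times> A8) = D2"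
    proof (intro set_eqI iffI)
      fix x assume "x \<in> D2"
      from decomp[OF this] obtain a2 a4 a8 where "a2 \<in> A2" "a4 \<in> A4" "a8 \<in> A8" "x = a2 + a4 + a8" by blast
      thus "x \<in> (\<lambda>(x, y, z). x + y + z) ` (A2 \<times> A4 \<times> A8)"
        by (intro image_eqI[of _ _ "(a2, a4, a8)"]) simp_all
    qed (use sum_D2 in auto)
  qed
  have tors: "zmul 2 (a2 + a4 + a8) = 0 \<longleftrightarrow> zmul 2 a2 = 0 \<and> zmul 2 a4 = 0 \<and> zmul 2 a8 = 0"
    if "a2 \<in> A2" "a4 \<in> A4" "a8 \<in> A8" for a2 a4 a8
    using inj[of "zmul 2 a2" "zmul 2 a4" "zmul 2 a8" 0 0 0] that sgA
    by (auto simp: zmul_add_right subgrp_zmul subgrpD(1))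
  have parity: "even (n2 + n4 + n8)"
  proof -
    define K where "K A = {a \<in> A. zmul 2 a = (0 :: 'd)}" for A
    have cards: "card (K A2) = 2 ^ n2" "card (K A4) = 2 ^ n4" "card (K A8) = 2 ^ n8"
      using A2(3) A4(3) A8(3) by (auto simp: homog_def K_def)
    have "bij_betw (\<lambda>(x, y, z). x + y + z) (K A2 \<times> K A4 \<times> K A8) {x. zmul 2 x = 0}"
      unfolding bij_betw_def
    proof (intro conjI set_eqI iffI)
      show "inj_on (\<lambda>(x, y, z). x + y + z) (K A2 \<times> K A4 \<times> K A8)"
        unfolding K_def by (rule inj_onI, clarify, use inj in blast)
      fix x assume "x \<in> (\<lambda>(x, y, z). x + y + z) ` (K A2 \<times> K A4 \<times> K A8)"
      thus "x \<in> {x. zmul 2 x = 0}" by (auto simp: K_def zmul_add_right)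
    next
      fix x :: 'd assume x: "x \<in> {x. zmul 2 x = 0}"
      hence "zmul (4 * 2) x = 0" by (simp only: zmul_mult) simp
      hence "x \<in> D2" by (simp add: D2_def)
      from decomp[OF this] obtain a2 a4 a8 where a: "a2 \<in> A2" "a4 \<in> A4" "a8 \<in> A8" "x = a2 + a4 + a8" by blast
      hence "(a2, a4, a8) \<in> K A2 \<times> K A4 \<times> K A8" using tors[OF a(1-3)] x by (simp add: K_def)
      thus "x \<in> (\<lambda>(x, y, z). x + y + z) ` (K A2 \<times> K A4 \<times> K A8)"
        using a(4) by (intro image_eqI[of _ _ "(a2, a4, a8)"]) simp_all
    qed
    from bij_betw_same_card[OF this] have "card {x :: 'd. zmul 2 x = 0} = 2 ^ (n2 + n4 + n8)"
      by (simp add: card_cartesian_product cards power_add)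
    then obtain k where "2 ^ m = 4 ^ k * (2 :: nat) ^ (n2 + n4 + n8)"
      using card_2_torsion_lattice[OF L(1,2)] by auto
    hence "2 ^ m = (2 :: nat) ^ (2 * k + (n2 + n4 + n8))" by (simp add: power_add power_mult)
    hence "m = 2 * k + (n2 + n4 + n8)" by (simp only: power_inject_exp)
    thus ?thesis using L(3) by simp
  qed
  have n8: "even n8" using even_rank_of_even_type[OF A8(3,4)] q8 A8(1) by blast
  have "n8 > 0"
  proof (rule ccontr)
    assume "\<not> n8 > 0"
    hence "A8 = {0}" using A8(3) by (auto simp: homog_def homogeneous_subgroup_def bij_betw_def)
    hence "h \<in> H8" if "h \<in> D2" for h using that A8(9) by (auto simp: bij_betw_def)
    hence 4: "zmul 4 h = 0" if "h \<in> D2" for h using that A8(7) by blast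
    obtain r where "\<gamma> = zmul (int (level q div 2)) r"
      using reg(1) by (auto simp: mul_image_def zmul_of_nat)
    hence "\<gamma> = zmul 4 (zmul (int N') r)" by (simp add: N(1) flip: zmul_mult)
    thus False using reg(2) 4 N'D2 by simp
  qed
  have "odd n2"
  proof -
    have "zmul (4 * 2) y = 0" using y(1) by (simp only: zmul_mult) simp
    hence "y \<in> D2" by (simp add: D2_def)
    from decomp[OF this] obtain a2 a4 a8 where a: "a2 \<in> A2" "a4 \<in> A4" "a8 \<in> A8" "y = a2 + a4 + a8" by blast
    have t: "zmul 2 a4 = 0" "zmul 2 a8 = 0" using tors[OF a(1-3)] y(1) a(4) by auto
    \<comment> \<open>The components of y in \<open>A4\<close> and \<open>A8\<close> are 2-torsion,
      hence of the form 2 a4' and 4 a8'. So 2 q is integral on them, and a2 inherits the properties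
      of y.\<close>
    obtain a4' where a4': "a4' \<in> A4" "a4 = zmul 2 a4'" using A4(3) a(2) t(1) by (auto simp: homog_def)
    obtain a8' where a8': "a8' \<in> A8" "a8 = zmul 4 a8'" using A8(3) a(3) t(2) by (auto simp: homog_def)
    have "2 * q a4 \<simeq> 8 * q a4'" using two_q_zmul[of 2 a4'] by (simp add: a4'(2))
    hence qa4: "2 * q a4 \<simeq> 0" using q8[of a4'] a4'(1) A4(1) A8(2) cg_Ints by (auto simp: cg_0_iff)
    have "2 * q a8 \<simeq> of_int 4 * (8 * q a8')" using two_q_zmul[of 4 a8'] by (simp add: a8'(2))
    also have "\<dots> \<simeq> 0" unfolding cg_0_iff using a8'(1) A8(1) by (intro Ints_mult[OF Ints_of_int q8]) blast
    finally have qa8: "2 * q a8 \<simeq> 0" .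
    show ?thesis
    proof (rule odd_rank_of_characteristic[OF A2(3,4) a(1)])
      have "B (a2 + a4) a8 \<simeq> B a2 a8 + B a4 a8" by (rule B_add_left)
      also have "\<dots> \<simeq> 0" unfolding cg_0_iff using orth a(1-3) by (intro Ints_add) auto
      finally have "of_int 2 * B (a2 + a4) a8 \<simeq> of_int 2 * 0" by (rule cg_mult)
      moreover have "B a2 a4 \<simeq> 0" unfolding cg_0_iff using orth a(1-3) by auto
      hence "of_int 2 * B a2 a4 \<simeq> of_int 2 * 0" by (rule cg_mult)
      ultimately have "2 * q a2 + of_int 2 * B a2 a4 + 2 * q a4 + 2 * q a8 + of_int 2 * B (a2 + a4) a8 \<simeq>
          2 * q a2 + of_int 2 * 0 + 0 + 0 + of_int 2 * 0"
        by (intro cg_add cg_refl qa4 qa8)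
      moreover have "q y = q a2 + q a4 + B a2 a4 + q a8 + B (a2 + a4) a8" unfolding a(4) by (simp only: q_add)
      hence "2 * q a2 + of_int 2 * B a2 a4 + 2 * q a4 + 2 * q a8 + of_int 2 * B (a2 + a4) a8 = 2 * q y" by simp
      ultimately have "2 * q y \<simeq> 2 * q a2" by simp
      from cg_trans[OF cg_sym[OF this] y(2)] show "2 * q a2 \<simeq> 1 / 2" .
      fix x assume x: "x \<in> A2"
      hence "zmul 2 x = 0" using A4(7) A2H4 by blast
      hence 1: "B x y \<simeq> 2 * q x" by (rule y(3))
      have "B x y \<simeq> B x a2 + B x a4 + B x a8"
        unfolding a(4) by (intro cg_trans[OF B_add_right] cg_add B_add_right cg_refl)
      also have "\<dots> \<simeq> B x a2 + 0 + 0"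
        using orth x a by (intro cg_add cg_refl) (auto simp: cg_0_iff)
      finally have "B x y \<simeq> B x a2" by simp
      from cg_trans[OF cg_sym[OF this] 1] show "B x a2 \<simeq> 2 * q x" .
    qed
  qed
  hence "odd n4" using parity n8 by auto
  have "8 * q x \<in> \<int>" if "x \<in> A8" for x using that A8(1) q8 by blast
  moreover have "homogeneous_subgroup A2 2 n2" "homogeneous_subgroup A4 4 n4" "homogeneous_subgroup A8 8 n8"
    using A2(3) A4(3) A8(3) by (auto simp: homog_def)
  moreover have "orthogonal_sets q A2 A4" "orthogonal_sets q A2 A8" "orthogonal_sets q A4 A8"
    using orth by (auto simp: orthogonal_sets_def)
  ultimately show ?thesis
    unfolding type_2_4_8II_odd_ranks_def using \<open>odd n2\<close> \<open>odd n4\<close> \<open>n8 > 0\<close> bij by blast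
qed

end


section \<open>Cusps\<close>

text \<open>Below the cap the valuation of gcd(c, N) is that of c; at the cap only divisibility of c
  is known.\<close>

lemma cusp_valuation_props:
  assumes "prime p" "N > 0" "p dvd N" and j: "j = cusp_valuation p N M"
  shows "int p ^ j dvd M$2$1" "j \<le> multiplicity p N"
    "j < multiplicity p N \<Longrightarrow> \<not> int p ^ Suc j dvd M$2$1"
proof -
  define G where "G = gcd (M$2$1) (int N)"
  have G: "G \<noteq> 0" "\<not> is_unit (int p)" using assms(1,2) by (auto simp: G_def)
  have iff: "int p ^ n dvd G \<longleftrightarrow> n \<le> j" for n
    using power_dvd_iff_le_multiplicity[OF G] by (simp add: j cusp_valuation_def G_def)
  have N: "int p ^ n dvd int N \<longleftrightarrow> n \<le> multiplicity p N" for n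
    using power_dvd_iff_le_multiplicity[of N p n] assms(2) prime_gt_1_nat[OF assms(1)]
    by (simp flip: of_nat_power)
  have "int p ^ j dvd G" using iff by simp
  thus "int p ^ j dvd M$2$1" "j \<le> multiplicity p N" using N by (auto simp: G_def)
  show "\<not> int p ^ Suc j dvd M$2$1" if "j < multiplicity p N"
    using that N[of "Suc j"] iff[of "Suc j"] by (auto simp: G_def)
qed

lemma cusp_width_props:
  assumes "N > 0"
  shows "cusp_width N M > 0" "int N dvd (M$2$1)\<^sup>2 * int (cusp_width N M)"
    "N = cusp_width N M * nat (gcd ((M$2$1)\<^sup>2) (int N))"
proof -
  define g where "g = nat (gcd ((M$2$1)\<^sup>2) (int N))"
  have g: "int g = gcd ((M$2$1)\<^sup>2) (int N)" by (simp add: g_def)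
  hence "int g dvd int N" by simp
  hence "g dvd N" by (simp only: of_nat_dvd_iff)
  hence N: "N = cusp_width N M * g" by (simp add: cusp_width_def g_def)
  thus "N = cusp_width N M * nat (gcd ((M$2$1)\<^sup>2) (int N))" by (simp add: g_def)
  show "cusp_width N M > 0" using N assms by (metis gr0I mult_0)
  have "int g dvd (M$2$1)\<^sup>2" using g by simp
  hence "int g * int (cusp_width N M) dvd (M$2$1)\<^sup>2 * int (cusp_width N M)" by (intro mult_dvd_mono) auto
  thus "int N dvd (M$2$1)\<^sup>2 * int (cusp_width N M)" by (metis N mult.commute of_nat_mult)
qed

text \<open>\<open>matrix_inv\<close> is a choice, identified here with the adjugate. The lower left
  entry of the stabilizer is -c^2 t, a multiple of N for the width t.\<close>

lemma cusp_stabilizer_props: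
  assumes M: "M \<in> SL2Z" and N: "N > 0"
  shows "cusp_stabilizer N M \<in> Gamma0 N" "cusp_stabilizer N M ** M = M ** T_mat (int (cusp_width N M))"
proof -
  define M' :: "int^2^2" where "M' = vector [vector [M$2$2, - (M$1$2)], vector [- (M$2$1), M$1$1]]"
  have M': "M'$1$1 = M$2$2" "M'$1$2 = - (M$1$2)" "M'$2$1 = - (M$2$1)" "M'$2$2 = M$1$1" by (simp_all add: M'_def)
  have d: "M$1$1 * M$2$2 - M$1$2 * M$2$1 = 1" using M by (simp add: SL2Z_iff)
  have inv: "M ** M' = mat 1" "M' ** M = mat 1" using d by (simp_all add: mat2_eq_iff mat2_mult M' algebra_simps)
  hence "\<exists>A'. M ** A' = mat 1 \<and> A' ** M = mat 1" by blast
  hence "M ** matrix_inv M = mat 1 \<and> matrix_inv M ** M = mat 1" unfolding matrix_inv_def by (rule someI_ex)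
  hence M'_eq: "matrix_inv M = M'" using inv by (metis matrix_mul_assoc matrix_mul_lid matrix_mul_rid)
  have M'_SL: "M' \<in> SL2Z" using d by (simp add: SL2Z_iff M' algebra_simps)
  show "cusp_stabilizer N M ** M = M ** T_mat (int (cusp_width N M))"
    unfolding cusp_stabilizer_def M'_eq by (simp add: inv flip: matrix_mul_assoc)
  have "cusp_stabilizer N M $ 2 $ 1 = - ((M$2$1)\<^sup>2 * int (cusp_width N M))"
    unfolding cusp_stabilizer_def M'_eq by (simp add: mat2_mult M' power2_eq_square algebra_simps)
  thus "cusp_stabilizer N M \<in> Gamma0 N"
    using cusp_width_props(2)[OF N] M M'_SL by (simp add: Gamma0_def cusp_stabilizer_def M'_eq)
qed

lemma aut_factor_nonzero:
  assumes "M \<in> SL2Z" "\<tau> \<in> upper_half_plane"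
  shows "aut_factor M \<tau> \<noteq> 0"
proof
  assume 0: "aut_factor M \<tau> = 0"
  hence "Im (aut_factor M \<tau>) = 0" by simp
  hence c: "M$2$1 = 0" using assms(2) by (simp add: aut_factor_def upper_half_plane_def)
  hence "M$2$2 = 0" using 0 by (simp add: aut_factor_def)
  thus False using c assms(1) by (simp add: SL2Z_iff)
qed

section \<open>Constraints on the indices that can cause a pole\<close>

context weil_vector
begin

text \<open>Prime by prime. If p has multiplicity k > 0 in the width, then 2 j + k \<le> \<nu> for
  the valuation j of c. So j \<le> \<nu>-2, or \<nu> = 1 and j = 0, and \<open>row_order\<close>
  gives p^(\<nu>-j) | \<open>dd\<close> with \<nu>-j \<ge> k.\<close>

lemma cusp_width_dvd:
  assumes M: "M \<in> SL2Z" and x: "wrow v M x \<noteq> 0" "zmul (int dd) x = 0" "dd > 0"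
  shows "cusp_width (level q) M dvd dd"
proof (rule multiplicity_le_imp_dvd)
  let ?t = "cusp_width (level q) M"
  note w = cusp_width_props[OF level_pos, of M]
  show "?t \<noteq> 0" using w(1) by simp
  fix p :: nat assume p: "prime p"
  define k where "k = multiplicity p (?t)"
  define g where "g = nat (gcd ((M$2$1)\<^sup>2) (int (level q)))"
  define \<nu> where "\<nu> = multiplicity p (level q)"
  have g: "level q = ?t * g" using w(3) by (simp add: g_def)
  hence "g \<noteq> 0" using level_pos by (metis mult_0_right less_irrefl)
  have \<nu>: "\<nu> = k + multiplicity p g"
    unfolding \<nu>_def k_def using prime_elem_multiplicity_mult_distrib[of p "?t" g] p w(1) \<open>g \<noteq> 0\<close>
    by (subst g) auto
  show "multiplicity p (?t) \<le> multiplicity p dd"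
  proof (cases "k = 0")
    case False
    hence "p dvd ?t" using not_dvd_imp_multiplicity_0 k_def by metis
    hence pN: "p dvd level q" using g by (metis dvd_mult2)
    define j where "j = cusp_valuation p (level q) M"
    note j = cusp_valuation_props[OF p level_pos pN j_def]
    have "(int p ^ j)\<^sup>2 dvd (M$2$1)\<^sup>2" using j(1) by (simp add: dvd_power_same)
    hence "int p ^ (2 * j) dvd (M$2$1)\<^sup>2" by (simp add: power_mult mult.commute flip: power_mult)
    hence "int p ^ min (2 * j) \<nu> dvd (M$2$1)\<^sup>2" by (meson dvd_trans le_imp_power_dvd min.cobounded1)
    moreover have "p ^ min (2 * j) \<nu> dvd level q" by (rule multiplicity_dvd') (simp add: \<nu>_def)
    hence "int p ^ min (2 * j) \<nu> dvd int (level q)" by (simp flip: of_nat_power)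
    ultimately have "int (p ^ min (2 * j) \<nu>) dvd int g" by (simp add: g_def)
    hence "p ^ min (2 * j) \<nu> dvd g" by (simp only: of_nat_dvd_iff)
    hence "min (2 * j) \<nu> \<le> multiplicity p g"
      using \<open>g \<noteq> 0\<close> p by (intro multiplicity_geI) auto
    hence 2: "2 * j + k \<le> \<nu>" using \<nu> False by (simp add: min_def split: if_splits)
    have "p ^ (\<nu> - j) dvd dd"
    proof (rule row_order[OF M p pN \<nu>_def j(1) _ _ x])
      show "\<not> int p ^ Suc j dvd M$2$1" using 2 False by (intro j(3)) (simp add: \<nu>_def[symmetric])
      show "j + 2 \<le> \<nu> \<or> \<nu> = 1 \<and> j = 0" using 2 False by linarith
    qed
    moreover have "p ^ k dvd p ^ (\<nu> - j)" using 2 by (intro le_imp_power_dvd) simp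
    ultimately have "p ^ k dvd dd" by (rule dvd_trans[rotated])
    hence "k \<le> multiplicity p dd" using p x(3) by (intro multiplicity_geI) auto
    thus ?thesis by (simp add: k_def)
  qed (simp add: k_def)
qed

text \<open>Let p^i be the greatest common divisor of \<open>dd\<close> and p^j. Then h = (dd/p^i) x
  is p^j-torsion with (h, x) = 2/p^i and c q(h) integral, so the coset condition forces p^i | 2. As
  \<open>dd\<close> is divisible by p^(\<nu>-j), hence by p^2, only p = 2 and j = 1 remain.\<close>

lemma pole_valuation:
  assumes M: "M \<in> SL2Z" and p: "prime p" "p dvd level q"
    and j: "int p ^ j dvd M$2$1" "\<not> int p ^ Suc j dvd M$2$1" "1 \<le> j" "j + 2 \<le> multiplicity p (level q)"
    and x: "wrow v M x \<noteq> 0" "zmul (int dd) x = 0" "dd > 0" "q x \<simeq> 1 / of_nat dd"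
  shows "p = 2 \<and> j = 1"
proof -
  define \<nu> where "\<nu> = multiplicity p (level q)"
  have dvd: "p ^ (\<nu> - j) dvd dd" using j x by (intro row_order[OF M p \<nu>_def]) (auto simp: \<nu>_def)
  define s where "s = multiplicity p dd"
  have s: "\<nu> - j \<le> s" unfolding s_def using p x(3) dvd by (intro multiplicity_geI) auto
  define i where "i = min s j"
  have i: "1 \<le> i" "i \<le> j" "i \<le> s" using s j by (auto simp: i_def \<nu>_def)
  have "p ^ i dvd dd" using i(3) unfolding s_def by (rule multiplicity_dvd')
  then obtain l where l: "dd = p ^ i * l" ..
  have l0: "l > 0" using l x(3) by (cases l) auto
  have p0: "p > 0" using p(1) by (rule prime_gt_0_nat)
  define h where "h = zmul (int l) x"
  have pj: "int p ^ j = int p ^ (j - i) * int p ^ i" using i by (simp flip: power_add)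
  have h: "zmul (int p ^ j) h = 0"
  proof -
    have "zmul (int p ^ j) h = zmul (int p ^ (j - i)) (zmul (int dd) x)"
      by (simp add: h_def pj l mult.assoc flip: zmul_mult)
    thus ?thesis using x(2) by simp
  qed
  have "int p ^ i dvd M$2$1" using j(1) pj by (metis dvd_mult_right)
  then obtain c' where c': "M$2$1 = int p ^ i * c'" ..
  have "B h x + of_int (M$2$1) * q h \<in> \<int>" using j by (intro row_dual_coset[OF M p j(1) _ _ h x(1)]) auto
  moreover have "B h x + of_int (M$2$1) * q h \<simeq> 2 / of_nat (p ^ i) + 0"
  proof (intro cg_add)
    have "B h x \<simeq> of_int (int l) * (2 * q x)"
      unfolding h_def by (intro cg_trans[OF B_zmul_left] cg_mult B_self)
    also have "\<dots> = of_int (2 * int l) * q x" by simp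
    also have "\<dots> \<simeq> of_int (2 * int l) * (1 / of_nat dd)" by (rule cg_mult[OF x(4)])
    also have "\<dots> = 2 / of_nat (p ^ i)" using l0 p0 by (simp add: l)
    finally show "B h x \<simeq> 2 / of_nat (p ^ i)" .
    have "of_int (M$2$1) * q h \<simeq> of_int (M$2$1) * (of_int ((int l)\<^sup>2) * q x)"
      unfolding h_def by (intro cg_mult q_zmul)
    also have "\<dots> = of_int (M$2$1 * (int l)\<^sup>2) * q x" by simp
    also have "\<dots> \<simeq> of_int (M$2$1 * (int l)\<^sup>2) * (1 / of_nat dd)" by (rule cg_mult[OF x(4)])
    also have "\<dots> = of_int (c' * int l)" using l0 p0 by (simp add: l c' power2_eq_square)
    also have "\<dots> \<simeq> 0" unfolding cg_0_iff by (rule Ints_of_int)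
    finally show "of_int (M$2$1) * q h \<simeq> 0" .
  qed
  ultimately have "2 / of_nat (p ^ i) \<in> (\<int> :: rat set)" using cg_Ints by simp
  then obtain z where "2 / of_nat (p ^ i) = (of_int z :: rat)" by (auto elim: Ints_cases)
  hence "of_int 2 = (of_int (int (p ^ i) * z) :: rat)" using p0 by (simp add: field_simps)
  hence "2 = int (p ^ i) * z" by (simp only: of_int_eq_iff)
  hence "int (p ^ i) dvd int 2" by (simp add: dvd_def exI[of _ z])
  hence "p ^ i dvd 2" by (simp only: of_nat_dvd_iff)
  moreover have "p ^ i \<ge> p" using i(1) p0 by (simp add: self_le_power)
  ultimately have "p ^ i \<le> 2" "p = 2" using prime_ge_2_nat[OF p(1)] dvd_imp_le[of "p ^ i" 2] by auto
  hence "i = 1" using i(1) power_increasing[of 2 i "2::nat"] by (cases "i = 1") auto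
  thus ?thesis using \<open>p = 2\<close> i s j by (auto simp: i_def \<nu>_def min_def split: if_splits)
qed

text \<open>Reduction to \<open>dyadic_exceptional\<close>: y is x times the odd part w of
  \<open>dd\<close>. For the 2-part 2^s of \<open>dd\<close>, \<open>row_order\<close> gives s \<ge>
  \<nu>-1, and s \<le> \<nu> as \<open>dd\<close> divides the level.\<close>

lemma pole_exceptional:
  assumes M: "M \<in> SL2Z" and two: "2 dvd level q"
    and j: "2 dvd M$2$1" "\<not> 4 dvd M$2$1" "3 \<le> multiplicity 2 (level q)"
    and x: "wrow v M x \<noteq> 0" "zmul (int dd) x = 0" "q x \<simeq> 1 / of_nat dd" "dd dvd level q"
    and L: "even_lattice m G bp bm" "has_discriminant_form m G q" "even m"
  shows "type_2_4_8II_odd_ranks q"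
proof -
  define \<nu> where "\<nu> = multiplicity 2 (level q)"
  have dd: "dd > 0" using x(4) level_pos by (metis dvd_0_left gr0I less_irrefl)
  have dvd: "2 ^ (\<nu> - 1) dvd dd"
    using j x dd by (intro row_order[OF M two_is_prime_nat two \<nu>_def]) (auto simp: \<nu>_def)
  define s where "s = multiplicity 2 dd"
  have "\<nu> - 1 \<le> s" unfolding s_def using dd dvd by (intro multiplicity_geI) auto
  moreover have "s \<le> \<nu>" unfolding s_def \<nu>_def using x(4) level_pos by (intro dvd_imp_multiplicity_le) auto
  ultimately have s: "s = \<nu> \<or> s = \<nu> - 1" by linarith
  obtain w where w: "dd = 2 ^ s * w" "odd w"
    using multiplicity_decompose'[of dd 2] dd unfolding s_def by auto
  obtain N' where N: "level q = 2 ^ \<nu> * N'" "odd N'"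
    using multiplicity_decompose'[of "level q" 2] level_pos unfolding \<nu>_def by auto
  have w0: "w > 0" using w(2) by (cases w) auto
  define y where "y = zmul (int w) x"
  have y1: "zmul (2 ^ s) y = 0" using x(2) by (simp add: y_def w(1) flip: zmul_mult)
  have y2: "q y \<simeq> of_int (int w) / of_int (2 ^ s)"
  proof -
    have "q y \<simeq> of_int ((int w)\<^sup>2) * q x" unfolding y_def by (rule q_zmul)
    also have "\<dots> \<simeq> of_int ((int w)\<^sup>2) * (1 / of_nat dd)" by (rule cg_mult[OF x(3)])
    also have "\<dots> = of_int (int w) / of_int (2 ^ s)" using w0 by (simp add: w(1) power2_eq_square)
    finally show ?thesis .
  qed
  have coset: "B h y + 2 * q h \<in> \<int>" if h: "zmul 2 h = 0" for h
  proof -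
    obtain u where u: "M$2$1 = 2 * u" using j(1) ..
    have "odd u" using j(2) u by auto
    then obtain u' where u': "u = 2 * u' + 1" by (elim oddE)
    obtain w' where w': "int w = 2 * w' + 1" using w(2) by (metis even_of_nat oddE)
    have 4: "4 * q h \<in> \<int>" by (rule q_2_torsion[OF h])
    have 1: "B h x + of_int (M$2$1) * q h \<in> \<int>"
      using j h by (intro row_dual_coset[OF M two_is_prime_nat two, of 1] x(1)) auto
    have "B h y + 2 * q h \<simeq> of_int (int w) * B h x + 2 * q h"
      unfolding y_def by (intro cg_add B_zmul_right cg_refl)
    \<comment> \<open>w c is congruent to 2 modulo 4 and 4 q(h) is integral, so w times the
      condition for x is the condition for y with 2 in place of c.\<close>
    also have "of_int (int w) * B h x + 2 * q h =
        of_int (int w) * (B h x + of_int (M$2$1) * q h) - of_int (int w * u' + w') * (4 * q h)"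
    proof -
      have "2 * of_int (int w) = (4 * of_int w' + 2 :: rat)" unfolding w' by simp
      hence "(of_int (int w) * of_int (M$2$1) - 4 * of_int (int w * u' + w')) * q h = 2 * q h"
        by (simp add: u u' algebra_simps)
      thus ?thesis by (simp add: algebra_simps)
    qed
    also have "\<dots> \<simeq> 0" unfolding cg_0_iff
      by (rule Ints_diff[OF Ints_mult[OF Ints_of_int 1] Ints_mult[OF Ints_of_int 4]])
    finally show ?thesis by (simp add: cg_0_iff)
  qed
  obtain y' where "\<nu> = 3" and y': "zmul 2 y' = 0" "2 * q y' \<simeq> 1 / 2" "\<And>h. zmul 2 h = 0 \<Longrightarrow> B h y' \<simeq> 2 * q h"
    using dyadic_exceptional[OF N _ y1 y2 _ s coset] j(3) w(2) by (auto simp: \<nu>_def)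
  show ?thesis
  proof (rule exceptional_type[OF _ N(2) _ _ L y'])
    show "level q = 8 * N'" using N(1) \<open>\<nu> = 3\<close> by simp
    show "\<gamma> 2 \<in> mul_image (level q div 2)" "\<gamma> 2 \<noteq> 0" using \<gamma>[OF two_is_prime_nat two] by auto
  qed
qed


section \<open>The modular form \<open>g\<close>\<close>

context
  fixes k :: int and F :: "complex \<Rightarrow> 'd group_alg" and g :: "complex \<Rightarrow> complex"
  assumes reflective: "weakly_reflective q \<rho> k F"
    and g_def: "g = (\<lambda>\<tau>. \<Sum>\<gamma>\<in>UNIV. v \<gamma> * F \<tau> $ \<gamma>)"
begin

lemma modular: "weil_modular_form \<rho> k F"
  using reflective by (simp add: weakly_reflective_def)

lemma singularE:
  assumes "singular_component F x"
  obtains d where "d dvd level q" "d > 0" "zmul (int d) x = 0" "q x \<simeq> 1 / of_nat d"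
    "order_at_least (\<lambda>\<tau>. F \<tau> $ x) (- 1 / of_nat d)"
proof -
  obtain d c where d: "d dvd level q" "x \<in> mul_kernel_val q d (1 / of_nat d)"
      "leading_term (\<lambda>\<tau>. F \<tau> $ x) (- 1 / of_nat d) c"
    using reflective assms unfolding weakly_reflective_def by blast
  have "d > 0" using d(1) level_pos by (metis dvd_0_left gr0I less_irrefl)
  thus thesis using d leading_term_imp_order_at_least[OF d(3)]
    by (intro that[of d]) (auto simp: mul_kernel_val_def mul_kernel_def zmul_of_nat cg_def)
qed

lemma not_singular_order: "\<not> singular_component F x \<Longrightarrow> order_at_least (\<lambda>\<tau>. F \<tau> $ x) 0"
  using not_pole_iff modular by (simp add: weil_modular_form_def singular_component_def)

lemma g_moebius:
  assumes M: "M \<in> SL2Z" and \<tau>: "\<tau> \<in> upper_half_plane"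
  shows "g (moebius M \<tau>) = aut_factor M \<tau> powi k * (\<Sum>x\<in>UNIV. wrow v M x * F \<tau> $ x)"
proof -
  have F: "F (moebius M \<tau>) = aut_factor M \<tau> powi k *s (\<rho> M *v F \<tau>)"
    using modular M \<tau> by (simp add: weil_modular_form_def)
  have "g (moebius M \<tau>) = (\<Sum>y\<in>UNIV. \<Sum>x\<in>UNIV. aut_factor M \<tau> powi k * (v y * \<rho> M $ y $ x * F \<tau> $ x))"
    unfolding g_def F by (simp add: matrix_vector_mult_def sum_distrib_left mult_ac)
  also have "\<dots> = (\<Sum>x\<in>UNIV. \<Sum>y\<in>UNIV. aut_factor M \<tau> powi k * (v y * \<rho> M $ y $ x * F \<tau> $ x))"
    by (rule sum.swap)
  finally show ?thesis by (simp add: wrow_def sum_distrib_left sum_distrib_right mult_ac)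
qed

lemma slash_g:
  assumes M: "M \<in> SL2Z" and \<tau>: "\<tau> \<in> upper_half_plane"
  shows "slash k g M \<tau> = (\<Sum>x\<in>UNIV. wrow v M x * F \<tau> $ x)"
  using aut_factor_nonzero[OF assms] by (simp add: slash_def g_moebius[OF assms] power_int_minus)

lemma slash_g_order:
  assumes M: "M \<in> SL2Z" and r: "r \<le> 0"
    and sing: "\<And>x d. wrow v M x \<noteq> 0 \<Longrightarrow> singular_component F x \<Longrightarrow> d dvd level q \<Longrightarrow> d > 0 \<Longrightarrow>
      zmul (int d) x = 0 \<Longrightarrow> q x \<simeq> 1 / of_nat d \<Longrightarrow> r \<le> - 1 / of_nat d"
  shows "order_at_least (slash k g M) r"
proof (rule order_at_least_cong)
  show "order_at_least (\<lambda>\<tau>. \<Sum>x\<in>UNIV. wrow v M x * F \<tau> $ x) r"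
  proof (rule order_at_least_sum)
    fix x assume x: "wrow v M x \<noteq> 0"
    show "order_at_least (\<lambda>\<tau>. F \<tau> $ x) r"
    proof (cases "singular_component F x")
      case True
      then obtain d where d: "d dvd level q" "d > 0" "zmul (int d) x = 0" "q x \<simeq> 1 / of_nat d"
        "order_at_least (\<lambda>\<tau>. F \<tau> $ x) (- 1 / of_nat d)" by (rule singularE)
      thus ?thesis using sing[OF x True d(1-4)] order_at_least_mono by blast
    next
      case False
      thus ?thesis using order_at_least_mono[OF not_singular_order r] by blast
    qed
  qed simp
qed (simp add: slash_g[OF M])

text \<open>The width t divides d, which settles the case of character value 1. Otherwise d = t is
  impossible: then t q(x) is integral, so T^t fixes e^x, and the row value at x equals itself times
  the character value of the stabilizer. Hence d \<ge> 2 t.\<close>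

lemma slash_g_small_pole:
  assumes M: "M \<in> SL2Z"
  shows "order_at_least (slash k g M)
    (- 1 / of_nat (cusp_sign_order (level q) (weil_character \<rho>) M * cusp_width (level q) M))"
proof (rule slash_g_order[OF M])
  define t where "t = cusp_width (level q) M"
  define n where "n = cusp_sign_order (level q) (weil_character \<rho>) M"
  have t: "t > 0" unfolding t_def by (rule cusp_width_props(1)[OF level_pos])
  have n: "n > 0" by (simp add: n_def cusp_sign_order_def)
  show "- 1 / of_nat (n * t) \<le> (0 :: rat)" by simp
  fix x d assume x: "wrow v M x \<noteq> 0" and d: "d > 0" "zmul (int d) x = 0" "q x \<simeq> 1 / of_nat d"
  have td: "t dvd d" unfolding t_def by (rule cusp_width_dvd[OF M x d(2,1)])
  have "n * t \<le> d"
  proof (cases "n = 1")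
    case True
    thus ?thesis using td d(1) by (simp add: dvd_imp_le)
  next
    case False
    hence n2: "n = 2" and ch: "weil_character \<rho> (cusp_stabilizer (level q) M) \<noteq> 1"
      by (auto simp: n_def cusp_sign_order_def split: if_splits)
    note Ts = cusp_stabilizer_props[OF M level_pos]
    let ?S = "cusp_stabilizer (level q) M"
    have "d \<noteq> t"
    proof
      assume "d = t"
      have "of_int (int t) * q x \<simeq> of_int (int t) * (1 / of_nat d)" by (rule cg_mult[OF d(3)])
      also have "\<dots> = of_int 1" using t \<open>d = t\<close> by simp
      also have "\<dots> \<simeq> 0" unfolding cg_0_iff by (rule Ints_of_int)
      finally have "of_nat t * q x \<in> \<int>" by (simp add: cg_0_iff)
      hence "- of_nat t * q x \<in> \<int>" by simp
      hence E1: "E (- of_nat t * q x) = 1" by (simp only: E_eq_1_iff)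
      have "weil_character \<rho> ?S * wrow v M x =
          (\<Sum>z\<in>UNIV. weil_character \<rho> ?S * v z * \<rho> M $ z $ x)"
        by (simp add: wrow_def sum_distrib_left mult.assoc)
      also have "\<dots> = (\<Sum>z\<in>UNIV. wrow v ?S z * \<rho> M $ z $ x)"
        by (simp add: row_Gamma0[OF Ts(1) v_props(2,5)])
      also have "\<dots> = wrow v (?S ** M) x"
        by (rule row_mult[OF Gamma0_SL2Z[OF Ts(1)] M, symmetric])
      also have "\<dots> = wrow v (M ** T_mat (int t)) x" by (simp only: Ts(2) t_def)
      also have "\<dots> = wrow v M x" using row_T[OF M, of v t x] E1 by simp
      finally show False using x ch by simp
    qed
    moreover obtain l where l: "d = t * l" using td ..
    ultimately have "l \<noteq> 0" "l \<noteq> 1" using d(1) by auto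
    hence "2 \<le> l" by linarith
    thus ?thesis unfolding n2 l by (simp add: mult.commute)
  qed
  hence "(of_nat (n * t) :: rat) \<le> of_nat d" by (simp only: of_nat_le_iff)
  thus "- 1 / of_nat (n * t) \<le> (- 1 / of_nat d :: rat)" using t n d(1) by (simp add: frac_le)
qed

text \<open>All indices in the support of v are isotropic, and an isotropic x in D_(d,1/d) has d = 1
  and so x = 0. If g vanished, \<open>F_0\<close> would be a combination of components without a
  pole.\<close>

lemma g_nonzero:
  assumes "singular_component F 0"
  shows "\<exists>\<tau>\<in>upper_half_plane. g \<tau> \<noteq> 0"
proof (rule ccontr)
  assume 0: "\<not> (\<exists>\<tau>\<in>upper_half_plane. g \<tau> \<noteq> 0)"
  have "order_at_least (\<lambda>\<tau>. \<Sum>x\<in>UNIV - {0}. (- v x / v 0) * F \<tau> $ x) 0"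
  proof (rule order_at_least_sum)
    fix x assume x: "x \<in> UNIV - {0}" "- v x / v 0 \<noteq> 0"
    have "\<not> singular_component F x"
    proof
      assume "singular_component F x"
      then obtain d where d: "d > 0" "zmul (int d) x = 0" "q x \<simeq> 1 / of_nat d" by (rule singularE)
      have "q x \<in> \<int>" using v_props(2)[of x] x by simp
      hence "1 / of_nat d \<in> (\<int> :: rat set)" using cg_Ints[OF d(3)] by simp
      then obtain z where "1 / of_nat d = (of_int z :: rat)" by (auto elim: Ints_cases)
      hence "of_int 1 = (of_int (int d * z) :: rat)" using d(1) by (simp add: field_simps)
      hence "int d * z = 1" by (simp only: of_int_eq_iff)
      hence "d = 1" using d(1) by (simp add: zmult_eq_1_iff)
      thus False using d(2) x(1) by simp
    qed
    thus "order_at_least (\<lambda>\<tau>. F \<tau> $ x) 0" by (rule not_singular_order)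
  qed simp
  hence "order_at_least (\<lambda>\<tau>. F \<tau> $ 0) 0"
  proof (rule order_at_least_cong)
    fix \<tau> assume "\<tau> \<in> upper_half_plane"
    hence "0 = g \<tau>" using 0 by simp
    also have "\<dots> = v 0 * F \<tau> $ 0 + (\<Sum>x\<in>UNIV - {0}. v x * F \<tau> $ x)"
      unfolding g_def by (subst sum.remove[of _ 0]) auto
    finally have "v 0 * F \<tau> $ 0 = - (\<Sum>x\<in>UNIV - {0}. v x * F \<tau> $ x)" by (simp add: eq_neg_iff_add_eq_0)
    hence "F \<tau> $ 0 = - (\<Sum>x\<in>UNIV - {0}. v x * F \<tau> $ x) / v 0" using v_props(1) by (simp add: field_simps)
    thus "(\<Sum>x\<in>UNIV - {0}. (- v x / v 0) * F \<tau> $ x) = F \<tau> $ 0"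
      by (simp add: sum_negf sum_divide_distrib)
  qed
  thus False
    using assms not_pole_iff[of "\<lambda>\<tau>. F \<tau> $ 0"] modular
    by (simp add: singular_component_def weil_modular_form_def)
qed

lemma g_modular: "Gamma0_modular_form (level q) (weil_character \<rho>) k g"
  unfolding Gamma0_modular_form_def
proof (intro conjI ballI)
  show "g holomorphic_on upper_half_plane"
    unfolding g_def using modular by (auto simp: weil_modular_form_def intro!: holomorphic_intros)
  show "g (moebius M \<tau>) = weil_character \<rho> M * aut_factor M \<tau> powi k * g \<tau>"
    if M: "M \<in> Gamma0 (level q)" and \<tau>: "\<tau> \<in> upper_half_plane" for M \<tau>
    using g_moebius[OF Gamma0_SL2Z[OF M] \<tau>]
    by (simp add: row_Gamma0[OF M v_props(2,5)] g_def sum_distrib_left mult_ac)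
  show "meromorphic_at_ioo (slash k g M)" if "M \<in> SL2Z" for M
    using slash_g_small_pole[OF that] meromorphic_at_ioo_iff by blast
qed

lemma g_small_pole_orders: "small_pole_orders (level q) (weil_character \<rho>) k g"
  unfolding small_pole_orders_def using slash_g_small_pole order_at_least_imp_leading_term by blast

lemma g_poleE:
  assumes M: "M \<in> SL2Z" and pole: "pole_at_ioo (slash k g M)"
  obtains x d where "wrow v M x \<noteq> 0" "d dvd level q" "d > 0" "zmul (int d) x = 0" "q x \<simeq> 1 / of_nat d"
proof -
  have "\<not> order_at_least (slash k g M) 0"
    using not_pole_iff[of "slash k g M"] pole slash_g_small_pole[OF M] meromorphic_at_ioo_iff by blast
  hence "\<exists>x d. wrow v M x \<noteq> 0 \<and> d dvd level q \<and> d > 0 \<and> zmul (int d) x = 0 \<and> q x \<simeq> 1 / of_nat d"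
    using slash_g_order[OF M order_refl] by blast
  thus thesis using that by blast
qed

lemma g_pole_valuation:
  assumes M: "M \<in> SL2Z" and pole: "pole_at_ioo (slash k g M)" and p: "prime p" "p dvd level q"
    and type: "p = 2 \<Longrightarrow> \<not> type_2_4_8II_odd_ranks q"
  shows "cusp_valuation p (level q) M \<in> {0, multiplicity p (level q) - 1, multiplicity p (level q)}"
proof (rule ccontr)
  define j where "j = cusp_valuation p (level q) M"
  define \<nu> where "\<nu> = multiplicity p (level q)"
  note j = cusp_valuation_props[OF p(1) level_pos p(2) j_def]
  assume "cusp_valuation p (level q) M \<notin> {0, multiplicity p (level q) - 1, multiplicity p (level q)}"
  hence j': "1 \<le> j" "j + 2 \<le> \<nu>" using j(2) by (auto simp: \<nu>_def simp flip: j_def)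
  obtain x d where x: "wrow v M x \<noteq> 0" "d dvd level q" "d > 0" "zmul (int d) x = 0" "q x \<simeq> 1 / of_nat d"
    using g_poleE[OF M pole] by blast
  have nd: "\<not> int p ^ Suc j dvd M$2$1" using j(3) j'(2) by (simp add: \<nu>_def)
  have p2: "p = 2" "j = 1"
    using pole_valuation[OF M p j(1) nd j'(1) _ x(1,4,3,5)] j'(2) by (auto simp: \<nu>_def)
  obtain n m G where L: "even_lattice m G n 2" "has_discriminant_form m G q" "real_of_int k = 1 - real n / 2"
    using reflective unfolding weakly_reflective_def by blast
  have "even m"
  proof -
    have "real_of_int (int n) = real_of_int (2 - 2 * k)" using L(3) by simp
    hence "int n = 2 - 2 * k" by (simp only: of_int_eq_iff)
    hence "even (int n)" by simp
    moreover have "m = n + 2" using L(1) by (simp add: even_lattice_def)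
    ultimately show ?thesis by simp
  qed
  moreover have "2 dvd M$2$1" "\<not> 4 dvd M$2$1" using j(1) nd by (auto simp: p2)
  moreover have "3 \<le> multiplicity 2 (level q)" using j' by (simp add: \<nu>_def p2)
  ultimately have "type_2_4_8II_odd_ranks q"
    using pole_exceptional[OF M _ _ _ _ x(1,4,5,2) L(1,2)] p(2) p2 by blast
  thus False using type p2 by blast
qed

end

end

theorem theorem3p5:
  fixes q :: "'d::{finite,ab_group_add} \<Rightarrow> rat"
    and \<rho> :: "int^2^2 \<Rightarrow> 'd group_alg_mat"
    and k :: int
    and F :: "complex \<Rightarrow> 'd group_alg"
    and N :: nat
  assumes "discriminant_form q"
    and "regular q"
    and "even (disc_signature q)"
    and "N = level q"
    and "weil_representation q \<rho>"
    and "weakly_reflective q \<rho> k F"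
    and "singular_component F 0"
  shows "\<exists>g :: complex \<Rightarrow> complex.
    (\<exists>a :: 'd \<Rightarrow> complex. g = (\<lambda>\<tau>. \<Sum>\<gamma>\<in>UNIV. a \<gamma> * F \<tau> $ \<gamma>)) \<and>
    (\<exists>\<tau> \<in> upper_half_plane. g \<tau> \<noteq> 0) \<and>
    Gamma0_modular_form N (weil_character \<rho>) k g \<and>
    small_pole_orders N (weil_character \<rho>) k g \<and>
    (\<forall>p M. prime p \<and> odd p \<and> p dvd N \<and> M \<in> SL2Z \<and> pole_at_ioo (slash k g M) \<longrightarrow>
       cusp_valuation p N M \<in> {0, multiplicity p N - 1, multiplicity p N}) \<and>
    (2 dvd N \<and> \<not> type_2_4_8II_odd_ranks q \<longrightarrow>
       (\<forall>M. M \<in> SL2Z \<and> pole_at_ioo (slash k g M) \<longrightarrow>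
          cusp_valuation 2 N M \<in> {0, multiplicity 2 N - 1, multiplicity 2 N}))"
proof -
  interpret weil_rep q \<rho> by unfold_locales (fact assms)+
  have "\<forall>p. \<exists>x. prime p \<and> p dvd level q \<longrightarrow> x \<in> mul_image (level q div p) \<and> x \<noteq> 0 \<and> q x \<in> \<int>"
    using assms(2) unfolding regular_def by blast
  then obtain \<gamma> where \<gamma>: "\<And>p. prime p \<Longrightarrow> p dvd level q \<Longrightarrow>
      \<gamma> p \<in> mul_image (level q div p) \<and> \<gamma> p \<noteq> 0 \<and> q (\<gamma> p) \<in> \<int>" by metis
  have "\<exists>v. annihilated {p. prime p \<and> p dvd level q} \<gamma> v"
  proof (rule annihilated_vector_exists)
    show "finite {p. prime p \<and> p dvd level q}"
      using level_pos by (intro finite_subset[OF _ finite_divisors_nat[of "level q"]]) auto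
  qed (use \<gamma> prime_order in auto)
  then obtain v where v: "annihilated {p. prime p \<and> p dvd level q} \<gamma> v" ..
  interpret weil_vector q \<rho> \<gamma> v by unfold_locales (use \<gamma> v in auto)
  define g where "g = (\<lambda>\<tau>. \<Sum>\<gamma>\<in>UNIV. v \<gamma> * F \<tau> $ \<gamma>)"
  note facts = g_nonzero[OF assms(6) g_def assms(7)] g_modular[OF assms(6) g_def]
    g_small_pole_orders[OF assms(6) g_def] g_pole_valuation[OF assms(6) g_def]
  show ?thesis unfolding assms(4)
  proof (intro exI[of _ g] conjI allI impI)
    show "\<exists>a. g = (\<lambda>\<tau>. \<Sum>\<gamma>\<in>UNIV. a \<gamma> * F \<tau> $ \<gamma>)" using g_def by blast
    fix p :: nat and M assume pM: "prime p \<and> odd p \<and> p dvd level q \<and> M \<in> SL2Z \<and> pole_at_ioo (slash k g M)"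
    hence "p \<noteq> 2" by auto
    thus "cusp_valuation p (level q) M \<in> {0, multiplicity p (level q) - 1, multiplicity p (level q)}"
      using pM by (intro facts(4)) blast+
  next
    fix M assume "2 dvd level q \<and> \<not> type_2_4_8II_odd_ranks q" "M \<in> SL2Z \<and> pole_at_ioo (slash k g M)"
    thus "cusp_valuation 2 (level q) M \<in> {0, multiplicity 2 (level q) - 1, multiplicity 2 (level q)}"
      by (intro facts(4) two_is_prime_nat) blast+
  qed (fact facts)+
qed

end
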